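(* The problems $1R1D$ (the special case of $mRmD$ with a single resource type, $|R|=1$) and $mR1D$ (the special case of $mRmD$ with multiple resource types in which each demand requires a single resource type, $|M_d|=1$ for every demand $d$) are solvable (an optimal solution can be computed) in polynomial time.
   Context: Problem $mRmD$ (heterogeneous multi-resource allocation with subset demand requests). An instance consists of: a finite set $D$ of demands; a finite set $R$ of resource types; for each $r\in R$ a finite set $S^r$ of starting locations and, for each $s\in S^r$, a number $l_s^r$ of resources of type $r$ starting at $s$; for each demand $d\in D$ a nonempty set $M_d\subseteq R$ of required resource types, a service start time $\tau_d\ge 0$, a service duration $\Delta_d>0$ and a reward $w_d\ge 0$; and travel times $f_{xy}\ge 0$ between any two locations ($f_{ij}$ is the travel time between the locations of demands $i$ and $j$, and $f_{sd}$ that from starting location $s$ to the location of demand $d$). All these numbers are integers. Demand $d$ requires one unit of every resource type in $M_d$ simultaneously at time $\tau_d$ for duration $\Delta_d$. A resource of type $r$ starting at $s\in S^r$ can serve $d$ as its first demand iff $r\in M_d$ and $f_{sd}\le\tau_d$; a resource of type $r$ can serve $j$ immediately after $i$ iff $r\in M_i\cap M_j$ and $\tau_i+\Delta_i+f_{ij}\le\tau_j$. A feasible solution assigns to each resource a (possibly empty) path, i.e. a sequence of demands whose first element can be served first and in which each consecutive pair can be served one immediately after the other. Demand $d$ is met if, for every $r\in M_d$, at least one resource of type $r$ has $d$ on its path. The objective is to maximize the sum of $w_d$ over met demands $d$. *)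

theory Defs
  imports
    Complex_Main
    "HOL-Library.Log_Nat"
    "HOL-Computational_Algebra.Polynomial"
begin

section \<open>The allocation problem\<close>

text \<open>
  Demands, resource types and starting locations are numbered: they are the natural numbers below
  \<open>num_demands\<close>, \<open>num_types\<close> and \<open>num_locs\<close>.  The sets \<open>starts r\<close> of different types may overlap.
  Only the travel times that the problem refers to are recorded: \<open>travel i j\<close> between the
  locations of the demands \<open>i\<close> and \<open>j\<close>, and \<open>travel_from s d\<close> from the starting location \<open>s\<close> to the
  location of the demand \<open>d\<close>.
\<close>

record mrmd =
  num_demands :: nat
  num_types :: nat
  num_locs :: nat
  starts :: "nat \<Rightarrow> nat set"
  amount :: "nat \<Rightarrow> nat \<Rightarrow> nat" \<comment> \<open>type, starting location\<close>
  required :: "nat \<Rightarrow> nat set"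
  start_time :: "nat \<Rightarrow> nat"
  duration :: "nat \<Rightarrow> nat"
  reward :: "nat \<Rightarrow> nat"
  travel :: "nat \<Rightarrow> nat \<Rightarrow> nat"
  travel_from :: "nat \<Rightarrow> nat \<Rightarrow> nat"

definition mRmD :: "mrmd set" where
  "mRmD = {I.
     (\<forall>r < num_types I. starts I r \<subseteq> {..<num_locs I}) \<and>
     (\<forall>d < num_demands I. required I d \<noteq> {} \<and> required I d \<subseteq> {..<num_types I} \<and> duration I d > 0)}"

definition oneR1D :: "mrmd set" where
  "oneR1D = {I \<in> mRmD. num_types I = 1}"

definition mR1D :: "mrmd set" where
  "mR1D = {I \<in> mRmD. \<forall>d < num_demands I. card (required I d) = 1}"

text \<open>
  The triple \<open>(r, s, k)\<close> is the \<open>k\<close>-th resource of type \<open>r\<close> starting at \<open>s\<close>.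
\<close>

type_synonym resource = "nat \<times> nat \<times> nat"

definition resources :: "mrmd \<Rightarrow> resource set" where
  "resources I = {(r, s, k). r < num_types I \<and> s \<in> starts I r \<and> k < amount I r s}"

definition can_serve_first :: "mrmd \<Rightarrow> nat \<Rightarrow> nat \<Rightarrow> nat \<Rightarrow> bool" where
  "can_serve_first I r s d \<longleftrightarrow> r \<in> required I d \<and> travel_from I s d \<le> start_time I d"

definition can_serve_after :: "mrmd \<Rightarrow> nat \<Rightarrow> nat \<Rightarrow> nat \<Rightarrow> bool" where
  "can_serve_after I r i j \<longleftrightarrow>
     r \<in> required I i \<inter> required I j \<and>
     start_time I i + duration I i + travel I i j \<le> start_time I j"

definition is_path :: "mrmd \<Rightarrow> nat \<Rightarrow> nat \<Rightarrow> nat list \<Rightarrow> bool" where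
  "is_path I r s ds \<longleftrightarrow>
     set ds \<subseteq> {..<num_demands I} \<and>
     (ds \<noteq> [] \<longrightarrow> can_serve_first I r s (hd ds)) \<and>
     successively (can_serve_after I r) ds"

type_synonym assignment = "resource \<Rightarrow> nat list"

definition feasible :: "mrmd \<Rightarrow> assignment \<Rightarrow> bool" where
  "feasible I \<sigma> \<longleftrightarrow> (\<forall>(r, s, k) \<in> resources I. is_path I r s (\<sigma> (r, s, k)))"

definition met :: "mrmd \<Rightarrow> assignment \<Rightarrow> nat \<Rightarrow> bool" where
  "met I \<sigma> d \<longleftrightarrow>
     (\<forall>r \<in> required I d. \<exists>s k. (r, s, k) \<in> resources I \<and> d \<in> set (\<sigma> (r, s, k)))"

definition total_reward :: "mrmd \<Rightarrow> assignment \<Rightarrow> nat" where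
  "total_reward I \<sigma> = (\<Sum>d | d < num_demands I \<and> met I \<sigma> d. reward I d)"

definition optimal :: "mrmd \<Rightarrow> assignment \<Rightarrow> bool" where
  "optimal I \<sigma> \<longleftrightarrow>
     feasible I \<sigma> \<and> (\<forall>\<sigma>'. feasible I \<sigma>' \<longrightarrow> total_reward I \<sigma>' \<le> total_reward I \<sigma>)"

section \<open>Random access machines with logarithmic cost\<close>

text \<open>
  The model of computation is the random access machine over the integers with addition and
  subtraction, programmed with while programs.  Its memory consists of named arrays; a program
  mentions only finitely many of them.  Every use of an integer, be it as an operand, as an address
  or as a stored value, is charged its length in bits (logarithmic cost criterion), so that running
  time is polynomially related to that of Turing machines.
\<close>

type_synonym memory = "string \<Rightarrow> int \<Rightarrow> int"

definition bit_size :: "int \<Rightarrow> nat" where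
  "bit_size x = Suc (floorlog 2 (nat \<bar>x\<bar>))" \<comment> \<open>sign and binary digits\<close>

definition bits_size :: "int list \<Rightarrow> nat" where
  "bits_size xs = sum_list (map bit_size xs)"

datatype aexp =
    Const int
  | Read string aexp
  | Add aexp aexp
  | Sub aexp aexp

fun aval :: "memory \<Rightarrow> aexp \<Rightarrow> int" where
  "aval m (Const n) = n"
| "aval m (Read a e) = m a (aval m e)"
| "aval m (Add e1 e2) = aval m e1 + aval m e2"
| "aval m (Sub e1 e2) = aval m e1 - aval m e2"

fun acost :: "memory \<Rightarrow> aexp \<Rightarrow> nat" where
  "acost m (Const n) = bit_size n"
| "acost m (Read a e) = acost m e + bit_size (aval m e) + bit_size (m a (aval m e))"
| "acost m (Add e1 e2) = acost m e1 + acost m e2 + bit_size (aval m e1) + bit_size (aval m e2)"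
| "acost m (Sub e1 e2) = acost m e1 + acost m e2 + bit_size (aval m e1) + bit_size (aval m e2)"

datatype bexp =
    Less aexp aexp
  | Equal aexp aexp
  | Neg bexp
  | Conj bexp bexp

fun bval :: "memory \<Rightarrow> bexp \<Rightarrow> bool" where
  "bval m (Less e1 e2) \<longleftrightarrow> aval m e1 < aval m e2"
| "bval m (Equal e1 e2) \<longleftrightarrow> aval m e1 = aval m e2"
| "bval m (Neg b) \<longleftrightarrow> \<not> bval m b"
| "bval m (Conj b1 b2) \<longleftrightarrow> bval m b1 \<and> bval m b2"

fun bcost :: "memory \<Rightarrow> bexp \<Rightarrow> nat" where
  "bcost m (Less e1 e2) = acost m e1 + acost m e2 + bit_size (aval m e1) + bit_size (aval m e2)"
| "bcost m (Equal e1 e2) = acost m e1 + acost m e2 + bit_size (aval m e1) + bit_size (aval m e2)"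
| "bcost m (Neg b) = Suc (bcost m b)"
| "bcost m (Conj b1 b2) = Suc (bcost m b1 + bcost m b2)"

datatype com =
    Skip
  | Write string aexp aexp \<comment> \<open>array, index, value\<close>
  | Seq com com
  | Cond bexp com com
  | While bexp com

text \<open>
  \<open>exec c m t m'\<close>: started in memory \<open>m\<close>, the program \<open>c\<close> halts after time \<open>t\<close> with memory \<open>m'\<close>.
\<close>

inductive exec :: "com \<Rightarrow> memory \<Rightarrow> nat \<Rightarrow> memory \<Rightarrow> bool" where
  Skip: "exec Skip m 1 m"
| Write: "exec (Write a e1 e2) m
      (acost m e1 + acost m e2 + bit_size (aval m e1) + bit_size (aval m e2))
      (m(a := (m a)(aval m e1 := aval m e2)))"
| Seq: "exec c1 m t1 m1 \<Longrightarrow> exec c2 m1 t2 m2 \<Longrightarrow> exec (Seq c1 c2) m (t1 + t2) m2"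
| CondTrue: "bval m b \<Longrightarrow> exec c1 m t m' \<Longrightarrow> exec (Cond b c1 c2) m (bcost m b + t) m'"
| CondFalse: "\<not> bval m b \<Longrightarrow> exec c2 m t m' \<Longrightarrow> exec (Cond b c1 c2) m (bcost m b + t) m'"
| WhileFalse: "\<not> bval m b \<Longrightarrow> exec (While b c) m (bcost m b) m"
| WhileTrue: "bval m b \<Longrightarrow> exec c m t1 m1 \<Longrightarrow> exec (While b c) m1 t2 m2 \<Longrightarrow>
      exec (While b c) m (bcost m b + t1 + t2) m2"

definition input_memory :: "int list \<Rightarrow> memory" where
  "input_memory xs = (\<lambda>a i.
     if a = ''input'' \<and> 0 \<le> i \<and> nat i < length xs then xs ! nat i
     else if a = ''input_length'' \<and> i = 0 then int (length xs)
     else 0)"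

definition output_of :: "memory \<Rightarrow> int list" where
  "output_of m = map (\<lambda>i. m ''output'' (int i)) [0..<nat (m ''output_length'' 0)]"

text \<open>
  A search problem is given by a set \<open>X\<close> of instances, their encoding \<open>enc\<close> and the relation \<open>sol\<close>
  between instances and admissible outputs.  The output is bounded separately, since a program can
  announce a long output without having written to all of its cells.
\<close>

definition solvable_in_polynomial_time ::
  "'i set \<Rightarrow> ('i \<Rightarrow> int list) \<Rightarrow> ('i \<Rightarrow> int list \<Rightarrow> bool) \<Rightarrow> bool" where
  "solvable_in_polynomial_time X enc sol \<longleftrightarrow>
     (\<exists>(c :: com) (p :: nat poly). \<forall>I \<in> X. \<exists>t m.
        exec c (input_memory (enc I)) t m \<and>
        t \<le> poly p (bits_size (enc I)) \<and>
        bits_size (output_of m) \<le> poly p (bits_size (enc I)) \<and>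
        sol I (output_of m))"

section \<open>Encodings\<close>

definition encode_instance :: "mrmd \<Rightarrow> int list" where
  "encode_instance I =
     map int [num_demands I, num_types I, num_locs I] @
     concat (map (\<lambda>r. concat (map (\<lambda>s.
         if s \<in> starts I r then [1, int (amount I r s)] else [0, 0])
       [0..<num_locs I])) [0..<num_types I]) @
     concat (map (\<lambda>d. map (\<lambda>r. of_bool (r \<in> required I d)) [0..<num_types I])
       [0..<num_demands I]) @
     concat (map (\<lambda>d. map int [start_time I d, duration I d, reward I d]) [0..<num_demands I]) @
     concat (map (\<lambda>i. map (\<lambda>j. int (travel I i j)) [0..<num_demands I]) [0..<num_demands I]) @
     concat (map (\<lambda>s. map (\<lambda>d. int (travel_from I s d)) [0..<num_demands I]) [0..<num_locs I])"

text \<open>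
  The amounts are written in binary, so the number of resources can be exponential in the size of
  an instance.  A solution is therefore written as the list of the paths of some of the resources,
  each preceded by its resource and its length; the resources that are not listed have the empty
  path.
\<close>

definition encode_entry :: "resource \<times> nat list \<Rightarrow> int list" where
  "encode_entry = (\<lambda>((r, s, k), ds). map int (r # s # k # length ds # ds))"

definition encodes_assignment :: "mrmd \<Rightarrow> int list \<Rightarrow> assignment \<Rightarrow> bool" where
  "encodes_assignment I ys \<sigma> \<longleftrightarrow>
     (\<exists>es. ys = concat (map encode_entry es) \<and>
        distinct (map fst es) \<and> fst ` set es \<subseteq> resources I \<and>
        (\<forall>x. \<sigma> x = (case map_of es x of Some ds \<Rightarrow> ds | None \<Rightarrow> [])))"

definition outputs_optimal_solution :: "mrmd \<Rightarrow> int list \<Rightarrow> bool" where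
  "outputs_optimal_solution I ys \<longleftrightarrow> (\<exists>\<sigma>. encodes_assignment I ys \<sigma> \<and> optimal I \<sigma>)"

end

theory Submission
  imports Defs
begin

text \<open>
  Since \<open>oneR1D \<subseteq> mR1D\<close>, only \<open>mR1D\<close> matters.  Several resources may pass through the same demand, so a
  set of demands can be met iff it can be covered by disjoint chains of the transitive closure of
  "can be served after", each chain beginning at a starting location whose amount bounds the number
  of its chains.  This is an assignment problem: every demand chooses a predecessor, which is a
  starting location, an earlier demand from which it can be reached, or, if it is given up, the
  demand itself; only the last choice costs something, namely the reward.  A demand can be chosen
  once, a starting location as often as it has resources.  The amounts, which may be exponential,
  enter as capacities only.  The problem is solved by the Hungarian algorithm, row by row with dual
  prices; optimality is weak duality.

  For the running time it is enough to count steps: a machine that only adds and subtracts lengthens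
  its numbers by a bounded number of bits per step, so after polynomially many steps all numbers are
  still of polynomial length.  All loops are bounded by the length of the input.
\<close>

section \<open>Structured programs and their running time\<close>

text \<open>A chain of the closure is not yet a path: its steps have to be expanded by intermediate
  demands, which may also lie on other paths or have been given up. This does no harm, because
  meeting a demand twice or for nothing never lowers the reward; but it is the reason why the
  emitted solution is only shown to miss at most the cost of the assignment, and not exactly that.
  The other half of optimality turns an arbitrary feasible solution into an assignment whose cost is
  exactly the reward it misses. Positive durations make start times strictly increase along every
  step between demands. This one fact bounds the length of paths, makes \<open>V\<close> rounds of
  the closure enough and lets predecessors be followed back to a starting location. The loop
  language has a total denotation, so correctness is a statement about functions on memories, and
  the cost is bounded once and for all for the compiled program. The case without demands is split
  off, because the number of types is then not bounded by the length of the input.\<close>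

datatype prog =
    Nop
  | Put string aexp aexp
  | Comp prog prog (infixr ";;" 60)
  | Branch bexp prog prog
  | Upto string string prog

abbreviation Var :: "string \<Rightarrow> aexp" where
  "Var x \<equiv> Read x (Const 0)"

abbreviation Let_be :: "string \<Rightarrow> aexp \<Rightarrow> prog" (infix "::=" 62) where
  "x ::= e \<equiv> Put x (Const 0) e"

fun writes :: "prog \<Rightarrow> string set" where
  "writes Nop = {}"
| "writes (Put a e1 e2) = {a}"
| "writes (p ;; q) = writes p \<union> writes q"
| "writes (Branch b p q) = writes p \<union> writes q"
| "writes (Upto x b p) = insert x (writes p)"

text \<open>The counter is assigned after each round instead of being incremented. For well-formed
  programs this is the same, and its value is known without any hypothesis on
  \<open>g\<close>.\<close>

primrec iterate :: "string \<Rightarrow> (memory \<Rightarrow> memory) \<Rightarrow> nat \<Rightarrow> memory \<Rightarrow> memory" where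
  "iterate x g 0 m = m(x := (m x)(0 := 0))"
| "iterate x g (Suc k) m =
     (g (iterate x g k m))(x := ((g (iterate x g k m)) x)(0 := int (Suc k)))"

text \<open>Capping every loop at the input length makes all programs polynomial by construction.
  The price is paid in the correctness proofs, where each loop bound has to be shown to be at most
  \<open>input_length\<close>.\<close>

definition rounds :: "memory \<Rightarrow> string \<Rightarrow> nat" where
  "rounds m b = nat (min (m b 0) (m ''input_length'' 0))"

primrec den :: "prog \<Rightarrow> memory \<Rightarrow> memory" where
  "den Nop m = m"
| "den (Put a e1 e2) m = m(a := (m a)(aval m e1 := aval m e2))"
| "den (p ;; q) m = den q (den p m)"
| "den (Branch b p q) m = (if bval m b then den p m else den q m)"
| "den (Upto x b p) m = iterate x (den p) (rounds m b) m"

text \<open>The denotation fixes the number of rounds on entry, whereas the compiled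
  \<open>While\<close> tests the bound anew in every round. The two agree because the body changes
  neither the counter nor the bound nor the input length.\<close>

fun well_formed :: "prog \<Rightarrow> bool" where
  "well_formed Nop \<longleftrightarrow> True"
| "well_formed (Put a e1 e2) \<longleftrightarrow> a \<noteq> ''input_length''"
| "well_formed (p ;; q) \<longleftrightarrow> well_formed p \<and> well_formed q"
| "well_formed (Branch b p q) \<longleftrightarrow> well_formed p \<and> well_formed q"
| "well_formed (Upto x b p) \<longleftrightarrow> well_formed p \<and> x \<noteq> ''input_length'' \<and> x \<noteq> b \<and>
     x \<notin> writes p \<and> b \<notin> writes p"

definition loop_test :: "string \<Rightarrow> string \<Rightarrow> bexp" where
  "loop_test x b = Conj (Less (Var x) (Var b)) (Less (Var x) (Var ''input_length''))"

primrec compile :: "prog \<Rightarrow> com" where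
  "compile Nop = Skip"
| "compile (Put a e1 e2) = Write a e1 e2"
| "compile (p ;; q) = Seq (compile p) (compile q)"
| "compile (Branch b p q) = Cond b (compile p) (compile q)"
| "compile (Upto x b p) =
     Seq (Write x (Const 0) (Const 0))
       (While (loop_test x b) (Seq (compile p) (Write x (Const 0) (Add (Var x) (Const 1)))))"

section \<open>Frame properties and loop invariants\<close>

lemma iterate_frame:
  assumes "\<And>m. g m a = m a" "a \<noteq> x"
  shows "iterate x g k m a = m a"
  by (induction k) (use assms in auto)

lemma den_frame: "a \<notin> writes p \<Longrightarrow> den p m a = m a"
proof (induction p arbitrary: m)
  case (Upto x b p)
  then show ?case
    by (auto intro!: iterate_frame)
qed auto

lemma well_formed_input_length: "well_formed p \<Longrightarrow> ''input_length'' \<notin> writes p"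
  by (induction p) auto

lemma iterate_counter: "iterate x g k m x 0 = int k"
  by (cases k) auto

text \<open>The invariant has to hold whatever the counter array contains; the value of the counter
  and the frame are handed to \<open>step\<close> separately. Invariants therefore need to mention
  only what the body changes.\<close>

lemma Upto_rule:
  assumes "0 \<le> B" "m b 0 = B" "B \<le> m ''input_length'' 0"
    and init: "\<And>k. J 0 (m(x := k))"
    and step: "\<And>i m'. 0 \<le> i \<Longrightarrow> i < B \<Longrightarrow> J i m' \<Longrightarrow> m' x 0 = i \<Longrightarrow>
      (\<And>a. a \<notin> writes p \<Longrightarrow> a \<noteq> x \<Longrightarrow> m' a = m a) \<Longrightarrow> (\<And>k. J (i + 1) ((den p m')(x := k)))"
    and post: "\<And>m'. J B m' \<Longrightarrow> (\<And>a. a \<notin> writes p \<Longrightarrow> a \<noteq> x \<Longrightarrow> m' a = m a) \<Longrightarrow> Q m'"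
  shows "Q (den (Upto x b p) m)"
proof -
  have frame: "iterate x (den p) k m a = m a" if "a \<notin> writes p" "a \<noteq> x" for a k
    using that by (intro iterate_frame) (auto simp: den_frame)
  have "int k \<le> B \<Longrightarrow> J (int k) (iterate x (den p) k m)" for k
  proof (induction k)
    case 0
    show ?case using init[of "(m x)(0 := 0)"] by (simp only: iterate.simps of_nat_0)
  next
    case (Suc k)
    then have "J (int k + 1) ((den p (iterate x (den p) k m))(x := c))" for c
      by (intro step) (auto simp: iterate_counter frame)
    moreover have "int (Suc k) = int k + 1" by simp
    ultimately show ?case
      by (simp only: iterate.simps)
  qed
  from this[of "nat B"] have "J B (iterate x (den p) (nat B) m)"
    using \<open>0 \<le> B\<close> by simp
  moreover have "rounds m b = nat B"
    using assms by (simp add: rounds_def)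
  ultimately show ?thesis
    using post frame by simp
qed

lemma Upto_rule_nat:
  assumes "m b 0 = int B" "int B \<le> m ''input_length'' 0"
    and init: "\<And>k. J 0 (m(x := k))"
    and step: "\<And>i m' k. i < B \<Longrightarrow> J i m' \<Longrightarrow> m' x 0 = int i \<Longrightarrow>
      (\<And>a. a \<notin> writes p \<Longrightarrow> a \<noteq> x \<Longrightarrow> m' a = m a) \<Longrightarrow> J (Suc i) ((den p m')(x := k))"
    and post: "\<And>m'. J B m' \<Longrightarrow> (\<And>a. a \<notin> writes p \<Longrightarrow> a \<noteq> x \<Longrightarrow> m' a = m a) \<Longrightarrow> Q m'"
  shows "Q (den (Upto x b p) m)"
proof (rule Upto_rule[where B = "int B" and J = "\<lambda>i. J (nat i)"])
  fix i m' k
  assume i: "0 \<le> i" "i < int B" "J (nat i) m'" "m' x 0 = i"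
    and fr: "\<And>a. a \<notin> writes p \<Longrightarrow> a \<noteq> x \<Longrightarrow> m' a = m a"
  have "J (Suc (nat i)) ((den p m')(x := k))"
    by (rule step) (use i fr in auto)
  then show "J (nat (i + 1)) ((den p m')(x := k))"
    using i by (simp add: nat_add_distrib)
qed (use assms in auto)

text \<open>Tables are filled by two nested loops. Speaking of the set of finished cells instead of
  two counters gives a single invariant for both loops and leaves open what is claimed of a
  cell.\<close>

lemma Upto_Upto_rule:
  fixes \<Phi> :: "(nat \<times> nat) set \<Rightarrow> memory \<Rightarrow> bool"
  assumes A: "m ba 0 = int A" "int A \<le> m ''input_length'' 0"
    and B: "m bb 0 = int B" "int B \<le> m ''input_length'' 0"
    and wf: "bb \<notin> writes p" "bb \<noteq> a" "bb \<noteq> b" "''input_length'' \<notin> writes p"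
      "a \<noteq> ''input_length''" "b \<noteq> ''input_length''" "a \<notin> writes p" "a \<noteq> b"
    and upd: "\<And>P m k x. x \<in> {a, b} \<Longrightarrow> \<Phi> P (m(x := k)) \<longleftrightarrow> \<Phi> P m"
    and init: "\<Phi> {} m"
    and step: "\<And>i j P m'. i < A \<Longrightarrow> j < B \<Longrightarrow> P \<subseteq> {..<A} \<times> {..<B} \<Longrightarrow> \<Phi> P m' \<Longrightarrow>
      m' a 0 = int i \<Longrightarrow> m' b 0 = int j \<Longrightarrow>
      (\<And>c. c \<notin> writes p \<Longrightarrow> c \<noteq> a \<Longrightarrow> c \<noteq> b \<Longrightarrow> m' c = m c) \<Longrightarrow> \<Phi> (insert (i, j) P) (den p m')"
  shows "\<Phi> ({..<A} \<times> {..<B}) (den (Upto a ba (Upto b bb p)) m)"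
proof (rule Upto_rule_nat[where B = A and J = "\<lambda>i. \<Phi> ({..<i} \<times> {..<B})"])
  fix i m1 k
  assume i: "i < A" "\<Phi> ({..<i} \<times> {..<B}) m1" "m1 a 0 = int i"
    and fr1: "\<And>c. c \<notin> writes (Upto b bb p) \<Longrightarrow> c \<noteq> a \<Longrightarrow> m1 c = m c"
  define X where "X j = {..<i} \<times> {..<B} \<union> {i} \<times> {..<j}" for j
  have "\<Phi> (X B) (den (Upto b bb p) m1)"
  proof (rule Upto_rule_nat[where B = B and J = "\<lambda>j. \<Phi> (X j)"])
    show "m1 bb 0 = int B" "int B \<le> m1 ''input_length'' 0"
      using wf B fr1[of bb] fr1[of "''input_length''"] by auto
    show "\<Phi> (X 0) (m1(b := k))" for k
      using i by (simp add: upd X_def)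
  next
    fix j m2 k
    assume j: "j < B" "\<Phi> (X j) m2" "m2 b 0 = int j"
      and fr2: "\<And>c. c \<notin> writes p \<Longrightarrow> c \<noteq> b \<Longrightarrow> m2 c = m1 c"
    have "\<Phi> (insert (i, j) (X j)) (den p m2)"
    proof (rule step[OF i(1) j(1)])
      show "X j \<subseteq> {..<A} \<times> {..<B}" using i j by (auto simp: X_def)
      show "m2 a 0 = int i" using fr2[of a] i wf by auto
      show "m2 c = m c" if "c \<notin> writes p" "c \<noteq> a" "c \<noteq> b" for c
        using fr1[of c] fr2[of c] that by auto
    qed (use j in auto)
    moreover have "insert (i, j) (X j) = X (Suc j)"
      by (auto simp: X_def)
    ultimately show "\<Phi> (X (Suc j)) ((den p m2)(b := k))"
      by (simp add: upd)
  qed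
  moreover have "X B = {..<Suc i} \<times> {..<B}"
    by (auto simp: X_def)
  ultimately show "\<Phi> ({..<Suc i} \<times> {..<B}) ((den (Upto b bb p) m1)(a := k))"
    by (simp add: upd)
qed (use A init in \<open>auto simp: upd\<close>)

section \<open>Growth of the numbers and logarithmic cost\<close>

definition bounded :: "memory \<Rightarrow> nat \<Rightarrow> bool" where
  "bounded m k \<longleftrightarrow> (\<forall>a i. \<bar>m a i\<bar> < 2 ^ k)"

lemma bounded_mono: "bounded m k \<Longrightarrow> k \<le> l \<Longrightarrow> bounded m l"
  unfolding bounded_def
  by (meson less_le_trans one_le_numeral power_increasing)

lemma bit_size_le:
  assumes "\<bar>x\<bar> < 2 ^ k"
  shows "bit_size x \<le> k + 1"
proof -
  have "nat \<bar>x\<bar> < 2 ^ k"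
    using assms by (simp add: nat_less_iff)
  then show ?thesis
    unfolding bit_size_def using floorlog_leI[of "nat \<bar>x\<bar>" 2 k] by simp
qed

lemma less_two_power_bit_size: "\<bar>x\<bar> < 2 ^ bit_size x"
proof (cases "x = 0")
  case False
  then have "nat \<bar>x\<bar> < 2 ^ floorlog 2 (nat \<bar>x\<bar>)"
    by (intro floorlog_bounds[THEN conjunct2]) auto
  also have "\<dots> \<le> 2 ^ bit_size x"
    unfolding bit_size_def by (intro power_increasing) auto
  finally show ?thesis
    by (simp add: nat_less_iff)
qed auto

text \<open>One number serves twice: as a measure of the work and as the number of bits by which a
  value can exceed the longest memory cell.\<close>

primrec aweight :: "aexp \<Rightarrow> nat" where
  "aweight (Const n) = bit_size n"
| "aweight (Read a e) = aweight e + 1"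
| "aweight (Add e1 e2) = aweight e1 + aweight e2 + 1"
| "aweight (Sub e1 e2) = aweight e1 + aweight e2 + 1"

primrec bweight :: "bexp \<Rightarrow> nat" where
  "bweight (Less e1 e2) = aweight e1 + aweight e2 + 1"
| "bweight (Equal e1 e2) = aweight e1 + aweight e2 + 1"
| "bweight (Neg b) = bweight b + 1"
| "bweight (Conj b1 b2) = bweight b1 + bweight b2 + 1"

text \<open>Work \<open>w\<close> on numbers that begin with \<open>k\<close> bits and gain at most
  \<open>w\<close> bits: each unit of work handles two numbers of at most \<open>k + w + 1\<close>
  bits, the last one being the sign. This form composes along a run during which the numbers grow,
  which is \<open>budget_add\<close>.\<close>

definition budget :: "nat \<Rightarrow> nat \<Rightarrow> nat" where
  "budget w k = 2 * w * (k + w + 1)"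

lemma budget_add: "budget v k + budget w (k + v) \<le> budget (v + w) k"
  by (simp add: budget_def algebra_simps)

lemma budget_mono: "v \<le> w \<Longrightarrow> k \<le> l \<Longrightarrow> budget v k \<le> budget w l"
  unfolding budget_def by (intro mult_le_mono add_mono) auto

lemma budget_pair:
  assumes "s \<le> budget v k" "t \<le> budget w k" "x \<le> k + v + 1" "y \<le> k + w + 1"
  shows "s + t + x + y \<le> budget (v + w + 1) k"
proof -
  have "s + t + x + y \<le> budget v k + budget w k + (k + v + 1) + (k + w + 1)"
    using assms by linarith
  also have "\<dots> \<le> budget (v + w + 1) k"
    by (simp add: budget_def algebra_simps)
  finally show ?thesis .
qed

lemma abs_aval_less:
  assumes "bounded m k"
  shows "\<bar>aval m e\<bar> < 2 ^ (k + aweight e)"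
proof (induction e)
  case (Const n)
  have "\<bar>n\<bar> < 2 ^ bit_size n" by (rule less_two_power_bit_size)
  also have "\<dots> \<le> 2 ^ (k + bit_size n)" by (intro power_increasing) auto
  finally show ?case by simp
next
  case (Read a e)
  have "\<bar>m a (aval m e)\<bar> < 2 ^ k"
    using assms by (simp add: bounded_def)
  also have "(2::int) ^ k \<le> 2 ^ (k + aweight (Read a e))" by (intro power_increasing) auto
  finally show ?case by simp
next
  case (Add e1 e2)
  have "\<bar>aval m e1 + aval m e2\<bar> < 2 ^ (k + aweight e1) + 2 ^ (k + aweight e2)"
    using Add by linarith
  also have "\<dots> \<le> 2 ^ (k + aweight e1 + aweight e2) + 2 ^ (k + aweight e1 + aweight e2)"
    by (rule add_mono; rule power_increasing) auto
  finally show ?case by (simp add: add.assoc)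
next
  case (Sub e1 e2)
  have "\<bar>aval m e1 - aval m e2\<bar> < 2 ^ (k + aweight e1) + 2 ^ (k + aweight e2)"
    using Sub by linarith
  also have "\<dots> \<le> 2 ^ (k + aweight e1 + aweight e2) + 2 ^ (k + aweight e1 + aweight e2)"
    by (rule add_mono; rule power_increasing) auto
  finally show ?case by (simp add: add.assoc)
qed

lemma bit_size_aval_le: "bounded m k \<Longrightarrow> bit_size (aval m e) \<le> k + aweight e + 1"
  using abs_aval_less bit_size_le by fastforce

lemma acost_le:
  assumes "bounded m k"
  shows "acost m e \<le> budget (aweight e) k"
proof (induction e)
  case (Const n)
  show ?case by (simp add: budget_def)
next
  case (Read a e)
  have "bit_size (m a (aval m e)) \<le> k + 0 + 1"
    using bit_size_aval_le[OF assms, of "Read a e"] assms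
    by (intro order.trans[OF bit_size_le[of _ k]]) (auto simp: bounded_def)
  with budget_pair[OF Read, of 0 0 _ "bit_size (m a (aval m e))"] bit_size_aval_le[OF assms, of e]
  show ?case by simp
qed (unfold acost.simps aweight.simps, (intro budget_pair bit_size_aval_le assms; assumption)+)

lemma bcost_le:
  assumes "bounded m k"
  shows "bcost m b \<le> budget (bweight b) k"
proof (induction b)
  case (Neg b)
  then show ?case
    using budget_pair[OF Neg, of 0 0 1 0] by simp
next
  case (Conj b1 b2)
  then show ?case
    using budget_pair[OF Conj, of 1 0] by simp
qed (unfold bcost.simps bweight.simps, (intro budget_pair bit_size_aval_le acost_le assms)+)

text \<open>\<open>3\<close> is the weight of resetting the counter and \<open>7\<close> that of
  incrementing it; the test is paid once more than the body. A branch pays for both alternatives, so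
  that the weight depends only on the program and \<open>N\<close>.\<close>

primrec weight :: "prog \<Rightarrow> nat \<Rightarrow> nat" where
  "weight Nop N = 1"
| "weight (Put a e1 e2) N = aweight e1 + aweight e2 + 1"
| "weight (p ;; q) N = weight p N + weight q N"
| "weight (Branch b p q) N = bweight b + weight p N + weight q N"
| "weight (Upto x b p) N = 3 + bweight (loop_test x b) +
     N * (bweight (loop_test x b) + weight p N + 7)"

text \<open>Time and growth are bounded together, because the cost of a later command depends on how
  long the numbers have become.\<close>

definition run_within :: "com \<Rightarrow> memory \<Rightarrow> nat \<Rightarrow> nat \<Rightarrow> memory \<Rightarrow> bool" where
  "run_within c m k w m' \<longleftrightarrow> bounded m' (k + w) \<and> (\<exists>t \<le> budget w k. exec c m t m')"

lemma run_within_mono: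
  "run_within c m k v m' \<Longrightarrow> v \<le> w \<Longrightarrow> run_within c m k w m'"
  unfolding run_within_def by (meson add_left_mono bounded_mono budget_mono le_trans order_refl)

lemma run_within_Seq:
  assumes "run_within c1 m k v m1" "run_within c2 m1 (k + v) w m2"
  shows "run_within (Seq c1 c2) m k (v + w) m2"
proof -
  obtain t1 t2 where "t1 \<le> budget v k" "exec c1 m t1 m1" "t2 \<le> budget w (k + v)" "exec c2 m1 t2 m2"
    using assms by (auto simp: run_within_def)
  then show ?thesis
    using assms budget_add[of v k w] exec.Seq[of c1 m t1 m1 c2 t2 m2]
    unfolding run_within_def by (auto simp: add.assoc intro!: exI[of _ "t1 + t2"])
qed

lemma run_within_Write:
  assumes "bounded m k"
  shows "run_within (Write a e1 e2) m k (aweight e1 + aweight e2 + 1)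
    (m(a := (m a)(aval m e1 := aval m e2)))"
proof -
  have "acost m e1 + acost m e2 + bit_size (aval m e1) + bit_size (aval m e2)
      \<le> budget (aweight e1 + aweight e2 + 1) k"
    by (intro budget_pair acost_le bit_size_aval_le assms)
  moreover have "\<bar>aval m e2\<bar> < 2 ^ (k + (aweight e1 + aweight e2 + 1))"
    using abs_aval_less[OF assms, of e2]
    by (rule less_le_trans) (intro power_increasing, auto)
  then have "bounded (m(a := (m a)(aval m e1 := aval m e2))) (k + (aweight e1 + aweight e2 + 1))"
    using bounded_mono[OF assms, of "k + (aweight e1 + aweight e2 + 1)"]
    by (auto simp: bounded_def)
  ultimately show ?thesis
    using exec.Write unfolding run_within_def by blast
qed

lemma run_within_WhileTrue:
  assumes "bounded m k" "bval m b" "run_within c m k v m1" "run_within (While b c) m1 (k + v) w m2"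
  shows "run_within (While b c) m k (bweight b + v + w) m2"
proof -
  obtain t1 t2 where t: "t1 \<le> budget v k" "exec c m t1 m1"
    "t2 \<le> budget w (k + v)" "exec (While b c) m1 t2 m2"
    using assms by (auto simp: run_within_def)
  have "bcost m b + t1 + t2 \<le> budget (bweight b) k + (budget v k + budget w (k + v))"
    using t bcost_le[OF assms(1), of b] by linarith
  also have "\<dots> \<le> budget (bweight b) k + budget (v + w) (k + bweight b)"
    using budget_add[of v k w] budget_mono[of "v + w" "v + w" k "k + bweight b"] by linarith
  also have "\<dots> \<le> budget (bweight b + v + w) k"
    using budget_add[of "bweight b" k "v + w"] by (simp add: add.assoc)
  finally have "bcost m b + t1 + t2 \<le> budget (bweight b + v + w) k" .
  moreover have "bounded m2 (k + (bweight b + v + w))"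
    using assms by (auto simp: run_within_def elim!: bounded_mono)
  ultimately show ?thesis
    using exec.WhileTrue[OF assms(2) t(2,4)] unfolding run_within_def by blast
qed

lemma bounded_scalar: "bounded m k \<Longrightarrow> run_within c m k w m' \<Longrightarrow> bounded m' (k + w)"
  by (simp add: run_within_def)

lemma compile_run_within:
  assumes "well_formed p" "bounded m k" "m ''input_length'' 0 = int N"
  shows "run_within (compile p) m k (weight p N) (den p m)"
  using assms
proof (induction p arbitrary: m k)
  case Nop
  then show ?case
    using exec.Skip[of m] bounded_mono[of m k "k + 1"]
    by (auto simp: run_within_def budget_def intro!: exI[of _ 1])
next
  case (Put a e1 e2)
  then show ?case
    unfolding compile.simps weight.simps den.simps by (intro run_within_Write)
next
  case (Comp p q)
  have "den p m ''input_length'' 0 = int N"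
    using Comp.prems well_formed_input_length den_frame by auto
  moreover have p: "run_within (compile p) m k (weight p N) (den p m)"
    using Comp by auto
  ultimately show ?case
    using Comp bounded_scalar[OF _ p] by (auto intro!: run_within_Seq)
next
  case (Branch b p q)
  show ?case
  proof (cases "bval m b")
    case True
    have p: "run_within (compile p) m k (weight p N) (den p m)"
      using Branch by auto
    then obtain t where t: "t \<le> budget (weight p N) k" "exec (compile p) m t (den p m)"
      by (auto simp: run_within_def)
    have "bcost m b + t \<le> budget (bweight b) k + budget (weight p N) (k + bweight b)"
      using t bcost_le[OF Branch.prems(2), of b]
        budget_mono[of "weight p N" "weight p N" k "k + bweight b"] by linarith
    also have "\<dots> \<le> budget (bweight b + weight p N) k" by (rule budget_add)
    finally have "run_within (compile (Branch b p q)) m k (bweight b + weight p N) (den p m)"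
      using exec.CondTrue[OF True t(2), of "compile q"] p
      by (auto simp: run_within_def elim!: bounded_mono)
    then have "run_within (compile (Branch b p q)) m k (weight (Branch b p q) N) (den p m)"
      by (rule run_within_mono) simp
    with True show ?thesis by simp
  next
    case False
    have q: "run_within (compile q) m k (weight q N) (den q m)"
      using Branch by auto
    then obtain t where t: "t \<le> budget (weight q N) k" "exec (compile q) m t (den q m)"
      by (auto simp: run_within_def)
    have "bcost m b + t \<le> budget (bweight b) k + budget (weight q N) (k + bweight b)"
      using t bcost_le[OF Branch.prems(2), of b]
        budget_mono[of "weight q N" "weight q N" k "k + bweight b"] by linarith
    also have "\<dots> \<le> budget (bweight b + weight q N) k" by (rule budget_add)
    finally have "run_within (compile (Branch b p q)) m k (bweight b + weight q N) (den q m)"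
      using exec.CondFalse[OF False t(2), of "compile p"] q
      by (auto simp: run_within_def elim!: bounded_mono)
    then have "run_within (compile (Branch b p q)) m k (weight (Branch b p q) N) (den q m)"
      by (rule run_within_mono) simp
    with False show ?thesis by simp
  qed
next
  case (Upto x b p)
  define n where "n = rounds m b"
  define st where "st i = iterate x (den p) i m" for i
  define tw where "tw = bweight (loop_test x b)"
  define w where "w = weight p N + 7"
  let ?body = "Seq (compile p) (Write x (Const 0) (Add (Var x) (Const 1)))"
  have wf: "well_formed p" "x \<noteq> ''input_length''" "x \<noteq> b" "x \<notin> writes p" "b \<notin> writes p"
    using Upto.prems by auto
  have fr: "st i a = m a" if "a \<notin> writes p" "a \<noteq> x" for i a
    using that unfolding st_def by (intro iterate_frame) (auto simp: den_frame)
  have test: "bval (st i) (loop_test x b) \<longleftrightarrow> i < n" for i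
    using wf well_formed_input_length[OF wf(1)] fr[of b i] fr[of "''input_length''" i]
    by (auto simp: loop_test_def n_def rounds_def st_def iterate_counter)
  have n: "n \<le> N"
    using Upto.prems by (auto simp: n_def rounds_def)
  have one: "bit_size 0 = 1" "bit_size 1 = 2"
    by (auto simp: bit_size_def floorlog_def)
  have body: "run_within ?body (st i) l w (st (Suc i))" if "bounded (st i) l" for i l
  proof -
    have p: "run_within (compile p) (st i) l (weight p N) (den p (st i))"
      using wf well_formed_input_length[OF wf(1)] fr[of "''input_length''" i] that Upto.prems
      by (intro Upto.IH) auto
    have "run_within (Write x (Const 0) (Add (Var x) (Const 1))) (den p (st i)) (l + weight p N) 7
        (st (Suc i))"
      using run_within_Write[OF bounded_scalar[OF that p], of x "Const 0" "Add (Var x) (Const 1)"]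
        wf den_frame[of x p "st i"]
      by (simp add: one st_def iterate_counter add.commute numeral_eq_Suc)
    with p show ?thesis unfolding w_def by (rule run_within_Seq)
  qed
  \<comment> \<open>Induction on the number \<open>j\<close> of rounds left. The bit length
    \<open>l\<close> is generalised because each round may raise it.\<close>
  have loop: "run_within (While (loop_test x b) ?body) (st i) l (tw + j * (tw + w)) (st n)"
    if "i + j = n" "bounded (st i) l" for i j l
    using that
  proof (induction j arbitrary: i l)
    case 0
    then have "exec (While (loop_test x b) ?body) (st i) (bcost (st i) (loop_test x b)) (st i)"
      by (intro exec.WhileFalse) (simp add: test)
    with 0 show ?case
      using bcost_le[OF 0(2), of "loop_test x b"]
      by (auto simp: run_within_def tw_def elim!: bounded_mono)
  next
    case (Suc j)
    have b: "run_within ?body (st i) l w (st (Suc i))"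
      using Suc by (intro body)
    have "run_within (While (loop_test x b) ?body) (st (Suc i)) (l + w) (tw + j * (tw + w)) (st n)"
      using Suc.prems bounded_scalar[OF _ b] by (intro Suc.IH) auto
    from run_within_WhileTrue[OF _ _ b this] show ?case
      using Suc.prems test[of i] by (simp add: tw_def algebra_simps)
  qed
  have start: "run_within (Write x (Const 0) (Const 0)) m k 3 (st 0)"
    using run_within_Write[OF Upto.prems(2), of x "Const 0" "Const 0"]
    by (simp add: one st_def numeral_eq_Suc)
  have "run_within (compile (Upto x b p)) m k (3 + (tw + n * (tw + w))) (st n)"
    unfolding compile.simps
    by (rule run_within_Seq[OF start]) (rule loop, use bounded_scalar[OF _ start] Upto.prems in auto)
  moreover have "3 + (tw + n * (tw + w)) \<le> weight (Upto x b p) N"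
    using n by (simp add: tw_def w_def add.assoc del: mult_le_mono1)
  ultimately have "run_within (compile (Upto x b p)) m k (weight (Upto x b p) N) (st n)"
    by (rule run_within_mono)
  then show ?case
    by (simp add: st_def n_def)
qed

lemma weight_mono: "M \<le> N \<Longrightarrow> weight p M \<le> weight p N"
  by (induction p) (auto intro!: add_mono mult_le_mono)

primrec weight_poly :: "prog \<Rightarrow> nat poly" where
  "weight_poly Nop = 1"
| "weight_poly (Put a e1 e2) = [:aweight e1 + aweight e2 + 1:]"
| "weight_poly (p ;; q) = weight_poly p + weight_poly q"
| "weight_poly (Branch b p q) = [:bweight b:] + weight_poly p + weight_poly q"
| "weight_poly (Upto x b p) = [:3 + bweight (loop_test x b):] +
     [:0, 1:] * ([:bweight (loop_test x b) + 7:] + weight_poly p)"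

lemma poly_weight_poly: "poly (weight_poly p) N = weight p N"
  by (induction p) (auto simp: algebra_simps)

lemma length_le_bits_size: "length xs \<le> bits_size xs"
  by (induction xs) (auto simp: bits_size_def bit_size_def)

lemma bit_size_le_bits_size: "x \<in> set xs \<Longrightarrow> bit_size x \<le> bits_size xs"
  unfolding bits_size_def by (induction xs) auto

lemma bounded_input_memory: "bounded (input_memory xs) (bits_size xs)"
proof -
  have "\<bar>xs ! i\<bar> < 2 ^ bits_size xs" if "i < length xs" for i
  proof -
    have "\<bar>xs ! i\<bar> < 2 ^ bit_size (xs ! i)" by (rule less_two_power_bit_size)
    also have "\<dots> \<le> 2 ^ bits_size xs"
      using that by (intro power_increasing bit_size_le_bits_size) auto
    finally show ?thesis .
  qed
  moreover have "int (length xs) < 2 ^ bits_size xs"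
    using length_le_bits_size[of xs] by (meson le_less_trans of_nat_less_two_power of_nat_le_iff)
  ultimately show ?thesis
    by (auto simp: bounded_def input_memory_def)
qed

lemma bits_size_output_le:
  assumes "bounded m k"
  shows "bits_size (output_of m) \<le> length (output_of m) * (k + 1)"
proof -
  have "bits_size (output_of m) = sum_list (map bit_size (output_of m))"
    by (simp add: bits_size_def)
  also have "\<dots> \<le> sum_list (map (\<lambda>_. k + 1) (output_of m))"
    using assms by (intro sum_list_mono bit_size_le) (auto simp: output_of_def bounded_def)
  also have "\<dots> = length (output_of m) * (k + 1)"
    by (simp add: sum_list_triv)
  finally show ?thesis .
qed

text \<open>The length of the output is a separate premise because a value of
  \<open>output_length\<close> with polynomially many bits can be exponential. The length of each
  single cell is bounded by the weight.\<close>

theorem solvable_in_polynomial_timeI: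
  fixes p :: prog and q :: "nat poly"
  assumes "well_formed p"
    and "\<And>I. I \<in> X \<Longrightarrow> sol I (output_of (den p (input_memory (enc I))))"
    and "\<And>I. I \<in> X \<Longrightarrow>
      length (output_of (den p (input_memory (enc I)))) \<le> poly q (bits_size (enc I))"
  shows "solvable_in_polynomial_time X enc sol"
proof -
  define w where "w = weight_poly p"
  define time where "time = [:2:] * w * ([:1, 1:] + w)"
  define size where "size = q * ([:1, 1:] + w)"
  have time: "poly time n = budget (weight p n) n" for n
    by (simp add: time_def w_def budget_def poly_weight_poly algebra_simps)
  have size: "poly size n = poly q n * (n + weight p n + 1)" for n
    by (simp add: size_def w_def poly_weight_poly algebra_simps)
  have "\<exists>t m. exec (compile p) (input_memory (enc I)) t m \<and>
      t \<le> poly (time + size) (bits_size (enc I)) \<and>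
      bits_size (output_of m) \<le> poly (time + size) (bits_size (enc I)) \<and> sol I (output_of m)"
    if "I \<in> X" for I
  proof -
    let ?n = "bits_size (enc I)" and ?m = "den p (input_memory (enc I))"
    have "run_within (compile p) (input_memory (enc I)) ?n (weight p (length (enc I))) ?m"
      by (intro compile_run_within assms bounded_input_memory) (simp add: input_memory_def)
    then have "run_within (compile p) (input_memory (enc I)) ?n (weight p ?n) ?m"
      by (rule run_within_mono) (intro weight_mono length_le_bits_size)
    then obtain t where t: "t \<le> budget (weight p ?n) ?n" "exec (compile p) (input_memory (enc I)) t ?m"
      and b: "bounded ?m (?n + weight p ?n)"
      by (auto simp: run_within_def)
    have "bits_size (output_of ?m) \<le> length (output_of ?m) * (?n + weight p ?n + 1)"
      using bits_size_output_le[OF b] by simp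
    also have "\<dots> \<le> poly size ?n"
      unfolding size by (intro mult_le_mono assms that order_refl)
    finally show ?thesis
      using t assms(2)[OF that] time by (intro exI[of _ t] exI[of _ ?m]) auto
  qed
  then show ?thesis
    unfolding solvable_in_polynomial_time_def by blast
qed

section \<open>The assignment problem and its dual\<close>

text \<open>Every row may take the column of its own number, which has capacity 1. The identity is
  thus always a matching, and this is what keeps the search for augmenting paths from getting
  stuck.\<close>

locale assignment =
  fixes n V :: int
    and ok :: "int \<Rightarrow> int \<Rightarrow> bool"
    and c :: "int \<Rightarrow> int \<Rightarrow> int"
    and cap :: "int \<Rightarrow> int"
  assumes n_le_V: "n \<le> V"
    and self_ok: "i \<in> {0..<n} \<Longrightarrow> ok i i"
    and self_cap: "i \<in> {0..<n} \<Longrightarrow> cap i = 1"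
    and cap_nonneg: "v \<in> {0..<V} \<Longrightarrow> 0 \<le> cap v"
    and c_nonneg: "i \<in> {0..<n} \<Longrightarrow> v \<in> {0..<V} \<Longrightarrow> ok i v \<Longrightarrow> 0 \<le> c i v"
begin

definition load :: "int \<Rightarrow> (int \<Rightarrow> int) \<Rightarrow> int \<Rightarrow> int" where
  "load r f v = (\<Sum>i\<in>{0..<r}. of_bool (f i = v))"

definition placed :: "int \<Rightarrow> (int \<Rightarrow> int) \<Rightarrow> bool" where
  "placed r f \<longleftrightarrow> (\<forall>i\<in>{0..<r}. f i \<in> {0..<V} \<and> ok i (f i))"

definition matching :: "int \<Rightarrow> (int \<Rightarrow> int) \<Rightarrow> bool" where
  "matching r f \<longleftrightarrow> placed r f \<and> (\<forall>v\<in>{0..<V}. load r f v \<le> cap v)"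

definition cost :: "(int \<Rightarrow> int) \<Rightarrow> int" where
  "cost f = (\<Sum>i\<in>{0..<n}. c i (f i))"

text \<open>The constraints of the dual transportation problem: \<open>y v\<close> is the price of a
  place in column \<open>v\<close>. The sign of \<open>u\<close> is free because every row has to be
  placed exactly once.\<close>

definition dual_feasible :: "int \<Rightarrow> (int \<Rightarrow> int) \<Rightarrow> (int \<Rightarrow> int) \<Rightarrow> bool" where
  "dual_feasible r u y \<longleftrightarrow>
     (\<forall>i\<in>{0..<r}. \<forall>v\<in>{0..<V}. ok i v \<longrightarrow> u i \<le> c i v + y v) \<and> (\<forall>v\<in>{0..<V}. 0 \<le> y v)"

definition tight :: "int \<Rightarrow> (int \<Rightarrow> int) \<Rightarrow> (int \<Rightarrow> int) \<Rightarrow> (int \<Rightarrow> int) \<Rightarrow> bool" where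
  "tight r f u y \<longleftrightarrow> (\<forall>i\<in>{0..<r}. u i = c i (f i) + y (f i))"

text \<open>Complementary slackness for the capacities.\<close>

definition slack_free :: "int \<Rightarrow> (int \<Rightarrow> int) \<Rightarrow> (int \<Rightarrow> int) \<Rightarrow> bool" where
  "slack_free r f y \<longleftrightarrow> (\<forall>v\<in>{0..<V}. load r f v < cap v \<longrightarrow> y v = 0)"

definition partial_optimum :: "int \<Rightarrow> (int \<Rightarrow> int) \<Rightarrow> (int \<Rightarrow> int) \<Rightarrow> (int \<Rightarrow> int) \<Rightarrow> bool" where
  "partial_optimum r f u y \<longleftrightarrow>
     matching r f \<and> dual_feasible r u y \<and> tight r f u y \<and> slack_free r f y"

section \<open>Weak duality\<close>

lemma sum_over_columns:
  assumes "placed r f"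
  shows "(\<Sum>i\<in>{0..<r}. y (f i)) = (\<Sum>v\<in>{0..<V}. load r f v * y v)"
proof -
  have "(\<Sum>v\<in>{0..<V}. of_bool (f i = v) * y v) = y (f i)" if "i \<in> {0..<r}" for i
  proof -
    have "f i \<in> {0..<V}"
      using assms that by (simp only: placed_def)
    moreover have "(\<Sum>v\<in>{0..<V}. of_bool (f i = v) * y v) = (\<Sum>v\<in>{0..<V}. if f i = v then y v else 0)"
      by (rule sum.cong) auto
    ultimately show ?thesis
      by (simp only: sum.delta' finite_atLeastLessThan_int if_True)
  qed
  then have "(\<Sum>i\<in>{0..<r}. y (f i)) = (\<Sum>i\<in>{0..<r}. \<Sum>v\<in>{0..<V}. of_bool (f i = v) * y v)"
    by (intro sum.cong) (simp_all only:)
  also have "\<dots> = (\<Sum>v\<in>{0..<V}. \<Sum>i\<in>{0..<r}. of_bool (f i = v) * y v)"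
    by (rule sum.swap)
  finally show ?thesis
    by (simp only: load_def sum_distrib_right)
qed

text \<open>Cost plus price of a row is at least \<open>u i\<close> under \<open>g\<close> and equal
  to it under \<open>f\<close>, so it suffices that \<open>f\<close> collects at least as much in
  prices. It does: wherever a price is positive, \<open>f\<close> fills the column to its
  capacity.\<close>

lemma partial_optimum_cost_le:
  assumes "partial_optimum n f u y" "matching n g"
  shows "cost f \<le> cost g"
proof -
  have y: "0 \<le> y v" if "v \<in> {0..<V}" for v
    using assms that by (auto simp: partial_optimum_def dual_feasible_def)
  have "load n g v * y v \<le> load n f v * y v" if v: "v \<in> {0..<V}" for v
  proof (cases "load n f v < cap v")
    case True
    then show ?thesis
      using assms v by (auto simp: partial_optimum_def slack_free_def)
  next
    case False
    then have "load n g v \<le> load n f v"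
      using assms v by (force simp: partial_optimum_def matching_def)
    then show ?thesis
      using y[OF v] by (intro mult_right_mono)
  qed
  then have "(\<Sum>v\<in>{0..<V}. load n g v * y v) \<le> (\<Sum>v\<in>{0..<V}. load n f v * y v)"
    by (intro sum_mono)
  then have "(\<Sum>i\<in>{0..<n}. y (g i)) \<le> (\<Sum>i\<in>{0..<n}. y (f i))"
    using assms sum_over_columns[of n f y] sum_over_columns[of n g y]
    by (simp only: partial_optimum_def matching_def)
  moreover have "(\<Sum>i\<in>{0..<n}. u i) \<le> (\<Sum>i\<in>{0..<n}. c i (g i) + y (g i))"
    using assms
    by (intro sum_mono) (auto simp: partial_optimum_def dual_feasible_def matching_def placed_def)
  moreover have "(\<Sum>i\<in>{0..<n}. u i) = (\<Sum>i\<in>{0..<n}. c i (f i) + y (f i))"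
    using assms by (intro sum.cong) (auto simp: partial_optimum_def tight_def)
  ultimately show ?thesis
    by (simp add: cost_def sum.distrib)
qed

lemma load_nonneg: "0 \<le> load r f v"
  unfolding load_def by (intro sum_nonneg) auto

lemma load_cong: "(\<And>i. i \<in> {0..<r} \<Longrightarrow> f i = g i) \<Longrightarrow> load r f v = load r g v"
  unfolding load_def by (intro sum.cong) auto

lemma load_Suc:
  assumes "0 \<le> r"
  shows "load (r + 1) f v = load r f v + of_bool (f r = v)"
proof -
  have "{0..<r + 1} = insert r {0..<r}" using assms by auto
  then show ?thesis by (simp add: load_def)
qed

lemma load_upd_new:
  assumes "0 \<le> r"
  shows "load (r + 1) (f(r := v)) w = load r f w + of_bool (v = w)"
  using load_cong[of r "f(r := v)" f w] load_Suc[OF assms, of "f(r := v)" w] by simp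

lemma load_upd:
  assumes "i \<in> {0..<r}"
  shows "load r (f(i := v)) w = load r f w + of_bool (v = w) - of_bool (f i = w)"
proof -
  have "load r g w = of_bool (g i = w) + (\<Sum>j\<in>{0..<r} - {i}. of_bool (g j = w))" for g
    unfolding load_def using assms by (intro sum.remove) auto
  moreover have "(\<Sum>j\<in>{0..<r} - {i}. of_bool ((f(i := v)) j = w)) =
      (\<Sum>j\<in>{0..<r} - {i}. of_bool (f j = w) :: int)"
    by (intro sum.cong) auto
  ultimately show ?thesis by (simp del: sum_of_bool_eq fun_upd_apply add: fun_upd_same)
qed

section \<open>Alternating trees and augmentation\<close>

definition tree_rows :: "int \<Rightarrow> (int \<Rightarrow> int) \<Rightarrow> int set \<Rightarrow> int set" where
  "tree_rows r f C = insert r {i \<in> {0..<r}. f i \<in> C}"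

text \<open>\<open>par v\<close> is the row through which column \<open>v\<close> entered the tree
  and \<open>rank v\<close> its order of entry. Ranks fall from a column to the present column of
  its parent, so following parents ends at the root row \<open>r\<close>.\<close>

definition hooked ::
  "int \<Rightarrow> int \<Rightarrow> (int \<Rightarrow> int) \<Rightarrow> (int \<Rightarrow> int) \<Rightarrow> (int \<Rightarrow> int) \<Rightarrow> int set \<Rightarrow> (int \<Rightarrow> int) \<Rightarrow> (int \<Rightarrow> int) \<Rightarrow> bool"
  where
  "hooked r k f u y C par rank \<longleftrightarrow>
     C \<subseteq> {0..<V} \<and> int (card C) = k \<and>
     (\<forall>v\<in>C. par v \<in> {0..r} \<and> ok (par v) v \<and> u (par v) = c (par v) v + y v \<and> rank v \<in> {0..<k} \<and>
       (par v \<noteq> r \<longrightarrow> f (par v) \<in> C \<and> rank (f (par v)) < rank v))"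

definition full :: "int \<Rightarrow> (int \<Rightarrow> int) \<Rightarrow> int set \<Rightarrow> bool" where
  "full r f C \<longleftrightarrow> (\<forall>v\<in>C. load r f v = cap v)"

lemma finite_columns: "C \<subseteq> {0..<V} \<Longrightarrow> finite C"
  by (rule finite_subset) auto

text \<open>
  Otherwise the columns of the tree would be full, hence fewer than its rows, although every row has
  a column of its own.
\<close>

lemma exit_exists:
  assumes "placed r f" "full r f C" "C \<subseteq> {0..<V}" "r \<in> {0..<n}"
  shows "\<exists>i v. i \<in> tree_rows r f C \<and> v \<in> {0..<V} - C \<and> ok i v"
proof (rule ccontr)
  assume neg: "\<not> ?thesis"
  define A where "A = {i \<in> {0..<r}. f i \<in> C}"
  have rows: "tree_rows r f C = insert r A" "r \<notin> A" "finite A"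
    by (auto simp: tree_rows_def A_def intro: finite_subset[of _ "{0..<r}"])
  have R: "insert r A \<subseteq> {0..<n}"
    using assms by (auto simp: A_def)
  have RC: "insert r A \<subseteq> C"
  proof
    fix i assume i: "i \<in> insert r A"
    then have "ok i i" "i \<in> {0..<V}"
      using R self_ok n_le_V by auto
    with i neg show "i \<in> C"
      unfolding rows(1) by blast
  qed
  have fin: "finite C" by (rule finite_columns) fact
  have "int (card A) = (\<Sum>i\<in>A. 1)" by simp
  also have "\<dots> = (\<Sum>i\<in>{0..<r}. of_bool (f i \<in> C))"
    by (simp add: A_def Int_def)
  also have "\<dots> = (\<Sum>i\<in>{0..<r}. \<Sum>v\<in>C. of_bool (f i = v))"
  proof (rule sum.cong)
    fix i
    have "C \<inter> {v. f i = v} = (if f i \<in> C then {f i} else {})" by auto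
    then show "of_bool (f i \<in> C) = (\<Sum>v\<in>C. of_bool (f i = v) :: int)"
      using fin by simp
  qed simp
  also have "\<dots> = (\<Sum>v\<in>C. load r f v)"
    unfolding load_def by (rule sum.swap)
  also have "\<dots> = (\<Sum>v\<in>C. cap v)"
    using assms(2) by (intro sum.cong) (auto simp: full_def)
  finally have "int (card A) = (\<Sum>v\<in>C. cap v)" .
  moreover have "(\<Sum>v\<in>insert r A. cap v) \<le> (\<Sum>v\<in>C. cap v)"
    using RC fin assms(3) cap_nonneg by (intro sum_mono2) auto
  moreover have "(\<Sum>v\<in>insert r A. cap v) = (\<Sum>v\<in>insert r A. 1)"
    using R self_cap by (intro sum.cong) auto
  ultimately show False
    using rows by simp
qed

definition shift :: "int set \<Rightarrow> int \<Rightarrow> (int \<Rightarrow> int) \<Rightarrow> int \<Rightarrow> int" where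
  "shift A d u i = (if i \<in> A then u i + d else u i)"

text \<open>Tree rows and tree columns rise together, and a placed row is in the tree iff its column
  is, so tight edges stay tight. Edges leaving the tree lose no more than the least slack, edges
  entering it gain, and prices rise only at full columns, where complementary slackness permits
  it.\<close>

lemma dual_shift:
  assumes feas: "dual_feasible (r + 1) u y" and ti: "tight r f u y" and sf: "slack_free r f y"
    and hk: "hooked r k f u y C par rank" and fu: "full r f C"
    and exit: "i \<in> tree_rows r f C" "v \<in> {0..<V} - C" "ok i v"
    and least: "\<And>i v. i \<in> tree_rows r f C \<Longrightarrow> v \<in> {0..<V} - C \<Longrightarrow> ok i v \<Longrightarrow> d \<le> c i v + y v - u i"
    and d: "d = c i v + y v - u i" and "0 \<le> r"
  defines "u' \<equiv> shift (tree_rows r f C) d u" and "y' \<equiv> shift C d y"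
  shows "dual_feasible (r + 1) u' y'" "tight r f u' y'" "slack_free r f y'"
    "hooked r k f u' y' C par rank" "u' i = c i v + y' v"
proof -
  have "i \<in> {0..<r + 1}"
    using exit \<open>0 \<le> r\<close> by (auto simp: tree_rows_def)
  then have "0 \<le> d"
    using feas exit d by (fastforce simp: dual_feasible_def)
  then show "dual_feasible (r + 1) u' y'"
    using feas least by (fastforce simp: dual_feasible_def u'_def y'_def shift_def)
  show "tight r f u' y'"
    using ti by (auto simp: tight_def u'_def y'_def shift_def tree_rows_def)
  show "slack_free r f y'"
    using sf fu by (auto simp: slack_free_def full_def y'_def shift_def)
  show "hooked r k f u' y' C par rank"
    using hk by (auto simp: hooked_def u'_def y'_def shift_def tree_rows_def)
  show "u' i = c i v + y' v"
    using exit d by (simp add: u'_def y'_def shift_def)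
qed

lemma hook_exit:
  assumes hk: "hooked r k f u y C par rank"
    and exit: "i \<in> tree_rows r f C" "v \<in> {0..<V} - C" "ok i v" "u i = c i v + y v" and "0 \<le> r"
  shows "hooked r (k + 1) f u y (insert v C) (par(v := i)) (rank(v := k))"
proof -
  have "finite C" "C \<subseteq> {0..<V}" "int (card C) = k"
    using hk finite_columns by (auto simp: hooked_def)
  moreover have "0 \<le> k" using calculation by auto
  ultimately show ?thesis
    using hk exit \<open>0 \<le> r\<close> by (fastforce simp: hooked_def tree_rows_def)
qed

text \<open>
  While the alternating path is flipped from its free end \<open>v\<close> back to \<open>r\<close>, the column \<open>v\<close> lacks one row
  compared with the final load \<open>h\<close>.
\<close>

definition flipping where
  "flipping r t f u y C par rank h v \<longleftrightarrow>
     placed r f \<and> tight r f u y \<and> v \<in> C \<and> t + rank v < int (card C) \<and>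
     (\<forall>w\<in>C. rank w \<le> rank v \<longrightarrow> par w \<noteq> r \<longrightarrow> f (par w) \<in> C \<and> rank (f (par w)) < rank w) \<and>
     (\<forall>w\<in>{0..<V}. load r f w + of_bool (v = w) = h w)"

lemma flipping_step:
  assumes fl: "flipping r t f u y C par rank h v" and hk: "hooked r k g u y C par rank" and "par v \<noteq> r"
  shows "flipping r (t + 1) (f(par v := v)) u y C par rank h (f (par v))"
proof -
  have v: "v \<in> C" "par v \<in> {0..<r}" "ok (par v) v" "u (par v) = c (par v) v + y v" "v \<in> {0..<V}"
    using fl hk \<open>par v \<noteq> r\<close> by (auto simp: flipping_def hooked_def)
  have nx: "f (par v) \<in> C" "rank (f (par v)) < rank v"
    using fl v \<open>par v \<noteq> r\<close> by (auto simp: flipping_def)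
  \<comment> \<open>The only changed row, \<open>par v\<close>, is no parent further down: a column
    \<open>w\<close> hooked to it would have larger rank than \<open>f (par v)\<close>.\<close>
  have old: "par w \<noteq> par v" if "w \<in> C" "rank w \<le> rank (f (par v))" "par w \<noteq> r" for w
  proof
    assume eq: "par w = par v"
    have "rank w \<le> rank v" using that nx by simp
    then have "rank (f (par w)) < rank w"
      using fl that by (simp add: flipping_def)
    with eq that show False by simp
  qed
  show ?thesis
    unfolding flipping_def
  proof (intro conjI ballI impI)
    show "placed r (f(par v := v))" "tight r (f(par v := v)) u y"
      using fl v by (auto simp: flipping_def placed_def tight_def)
    show "f (par v) \<in> C" by (rule nx)
    show "t + 1 + rank (f (par v)) < int (card C)"
      using fl nx by (auto simp: flipping_def)
  next
    fix w assume "w \<in> C" "rank w \<le> rank (f (par v))" "par w \<noteq> r"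
    then show "(f(par v := v)) (par w) \<in> C" "rank ((f(par v := v)) (par w)) < rank w"
      using old[of w] fl nx by (auto simp: flipping_def)
  next
    fix w assume "w \<in> {0..<V}"
    then show "load r (f(par v := v)) w + of_bool (f (par v) = w) = h w"
      using fl by (simp add: load_upd[OF v(2)] flipping_def)
  qed
qed

text \<open>The root row is the only one without a column; placing it supplies exactly the row that
  \<open>v\<close> lacks.\<close>

lemma flipping_end:
  assumes fl: "flipping r t f u y C par rank h v" and hk: "hooked r k g u y C par rank"
    and "par v = r" "0 \<le> r"
  shows "placed (r + 1) (f(r := v))" "tight (r + 1) (f(r := v)) u y"
    "\<And>w. w \<in> {0..<V} \<Longrightarrow> load (r + 1) (f(r := v)) w = h w"
proof -
  have v: "v \<in> C" "ok r v" "u r = c r v + y v" "v \<in> {0..<V}"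
    using fl hk \<open>par v = r\<close> by (auto simp: flipping_def hooked_def)
  show "placed (r + 1) (f(r := v))"
    using fl v by (auto simp: flipping_def placed_def)
  show "tight (r + 1) (f(r := v)) u y"
    using fl v by (auto simp: flipping_def tight_def)
  show "load (r + 1) (f(r := v)) w = h w" if "w \<in> {0..<V}" for w
    using fl that by (simp add: load_upd_new[OF \<open>0 \<le> r\<close>] flipping_def)
qed

end

section \<open>The Hungarian algorithm\<close>

text \<open>
  For want of multiplication, the entries of a matrix are addressed by a table \<open>oD\<close> of the multiples of
  the number of demands.
\<close>

definition entry :: "string \<Rightarrow> string \<Rightarrow> string \<Rightarrow> aexp" where
  "entry a x y = Read a (Add (Read ''oD'' (Var x)) (Var y))"

text \<open>
  Rows are demands and columns are their possible predecessors.  \<open>tr\<close> and \<open>tc\<close> mark the rows and columns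
  of the alternating tree, \<open>us\<close> counts the rows placed in a column, and \<open>be\<close> is the least slack found by
  \<open>scan\<close>, attained at row \<open>bi\<close> and column \<open>bv\<close>.
\<close>

definition probe :: prog where
  "probe =
    Branch (Conj (Neg (Equal (Read ''tc'' (Var ''j'')) (Const 1))) (Equal (entry ''ok'' ''j'' ''i'') (Const 1)))
      (''de'' ::= Sub (Add (entry ''co'' ''j'' ''i'') (Read ''y'' (Var ''j''))) (Read ''u'' (Var ''i'')) ;;
       Branch (Conj (Equal (Var ''fd'') (Const 1)) (Neg (Less (Var ''de'') (Var ''be''))))
         Nop
         (''be'' ::= Var ''de'' ;; ''bi'' ::= Var ''i'' ;; ''bv'' ::= Var ''j'' ;; ''fd'' ::= Const 1))
      Nop"

definition scan :: prog where
  "scan =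
    ''fd'' ::= Const 0 ;;
    Upto ''i'' ''D'' (Branch (Equal (Read ''tr'' (Var ''i'')) (Const 1)) (Upto ''j'' ''V'' probe) Nop)"

text \<open>One loop up to \<open>V\<close> serves rows as well as columns, because
  \<open>n \<le> V\<close>.\<close>

definition adjust :: prog where
  "adjust =
    Upto ''x'' ''V''
      (Branch (Equal (Read ''tr'' (Var ''x'')) (Const 1))
         (Put ''u'' (Var ''x'') (Add (Read ''u'' (Var ''x'')) (Var ''be''))) Nop ;;
       Branch (Equal (Read ''tc'' (Var ''x'')) (Const 1))
         (Put ''y'' (Var ''x'') (Add (Read ''y'' (Var ''x'')) (Var ''be''))) Nop)"

definition grow :: prog where
  "grow =
    Upto ''x'' ''r''
      (Branch (Equal (Read ''f'' (Var ''x'')) (Var ''bv'')) (Put ''tr'' (Var ''x'') (Const 1)) Nop)"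

definition flip :: prog where
  "flip =
    ''cv'' ::= Var ''bv'' ;; ''fin'' ::= Const 0 ;;
    Upto ''x'' ''V''
      (Branch (Equal (Var ''fin'') (Const 0))
        (''pi'' ::= Read ''par'' (Var ''cv'') ;;
         ''ol'' ::= Read ''f'' (Var ''pi'') ;;
         Put ''f'' (Var ''pi'') (Var ''cv'') ;;
         ''cv'' ::= Var ''ol'' ;;
         Branch (Equal (Var ''pi'') (Var ''r'')) (''fin'' ::= Const 1) Nop)
        Nop)"

definition phase :: prog where
  "phase =
    scan ;; adjust ;; Put ''tc'' (Var ''bv'') (Const 1) ;; Put ''par'' (Var ''bv'') (Var ''bi'') ;;
    Branch (Less (Read ''us'' (Var ''bv'')) (Read ''cap'' (Var ''bv'')))
      (Put ''us'' (Var ''bv'') (Add (Read ''us'' (Var ''bv'')) (Const 1)) ;; ''dn'' ::= Const 1 ;; flip)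
      grow"

definition clear :: prog where
  "clear = Upto ''x'' ''V'' (Put ''tr'' (Var ''x'') (Const 0) ;; Put ''tc'' (Var ''x'') (Const 0))"

definition insert_row :: prog where
  "insert_row =
    clear ;; Put ''tr'' (Var ''r'') (Const 1) ;; Put ''u'' (Var ''r'') (Const 0) ;; ''dn'' ::= Const 0 ;;
    Upto ''k'' ''V'' (Branch (Equal (Var ''dn'') (Const 0)) phase Nop)"

definition solve :: prog where
  "solve = Upto ''r'' ''D'' insert_row"

lemmas solve_defs = entry_def probe_def scan_def adjust_def grow_def flip_def phase_def clear_def insert_row_def
  solve_def

lemma interval_Suc: "0 \<le> j \<Longrightarrow> {0..<j + 1} = insert j {0..<j}" for j :: int
  by auto

section \<open>Correctness of the Hungarian algorithm\<close>

context assignment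
begin

definition data :: "memory \<Rightarrow> bool" where
  "data m \<longleftrightarrow> m ''D'' 0 = n \<and> m ''V'' 0 = V \<and> V \<le> m ''input_length'' 0 \<and>
     (\<forall>v\<in>{0..<V}. m ''cap'' v = cap v \<and>
        (\<forall>i\<in>{0..<n}. (m ''ok'' (m ''oD'' v + i) = 1 \<longleftrightarrow> ok i v) \<and> m ''co'' (m ''oD'' v + i) = c i v))"

lemma data_cong:
  assumes "data m"
    and "\<And>a. a \<in> {''D'', ''V'', ''input_length'', ''cap'', ''ok'', ''oD'', ''co''} \<Longrightarrow> m' a = m a"
  shows "data m'"
  using assms by (simp add: data_def)

definition best :: "(int \<times> int) set \<Rightarrow> (int \<times> int \<Rightarrow> int) \<Rightarrow> memory \<Rightarrow> bool" where
  "best S s m \<longleftrightarrow> (if S = {} then m ''fd'' 0 = 0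
     else m ''fd'' 0 = 1 \<and> (m ''bi'' 0, m ''bv'' 0) \<in> S \<and> m ''be'' 0 = s (m ''bi'' 0, m ''bv'' 0) \<and>
       (\<forall>p\<in>S. m ''be'' 0 \<le> s p))"

lemma best_upd:
  "''fd'' \<noteq> x \<Longrightarrow> ''bi'' \<noteq> x \<Longrightarrow> ''bv'' \<noteq> x \<Longrightarrow> ''be'' \<noteq> x \<Longrightarrow>
    best S s (m(x := k)) \<longleftrightarrow> best S s m"
  by (simp add: best_def)

lemma probe_best:
  assumes "data m" "m ''i'' 0 = i" "m ''j'' 0 = v" "i \<in> {0..<n}" "v \<in> {0..<V}" "best S s m"
    "s (i, v) = c i v + m ''y'' v - m ''u'' i"
  shows "best (S \<union> (if m ''tc'' v \<noteq> 1 \<and> ok i v then {(i, v)} else {})) s (den probe m)"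
proof -
  have ok: "m ''ok'' (m ''oD'' v + i) = 1 \<longleftrightarrow> ok i v" and co: "m ''co'' (m ''oD'' v + i) = c i v"
    using assms by (auto simp: data_def)
  show ?thesis
  proof (cases "m ''tc'' v \<noteq> 1 \<and> ok i v")
    case False
    then show ?thesis
      using assms by (auto simp: probe_def entry_def ok)
  next
    case True
    define old where "old \<longleftrightarrow> m ''fd'' 0 = 1 \<and> m ''be'' 0 \<le> s (i, v)"
    have "den probe m ''fd'' 0 = 1"
      "den probe m ''bi'' 0 = (if old then m ''bi'' 0 else i)"
      "den probe m ''bv'' 0 = (if old then m ''bv'' 0 else v)"
      "den probe m ''be'' 0 = (if old then m ''be'' 0 else s (i, v))"
      using True assms(2,3,7) by (auto simp: probe_def entry_def ok co old_def)
    with True assms(6) show ?thesis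
      unfolding best_def old_def by (cases "S = {}") auto
  qed
qed

lemma probe_row:
  assumes "data m" "m ''i'' 0 = i" "i \<in> {0..<n}" "best S s m"
    and s: "\<And>v. v \<in> {0..<V} \<Longrightarrow> s (i, v) = c i v + m ''y'' v - m ''u'' i"
  shows "best (S \<union> {i} \<times> {v \<in> {0..<V}. m ''tc'' v \<noteq> 1 \<and> ok i v}) s (den (Upto ''j'' ''V'' probe) m)"
proof -
  define X where "X j = S \<union> {i} \<times> {v \<in> {0..<j}. m ''tc'' v \<noteq> 1 \<and> ok i v}" for j
  have "best (X V) s (den (Upto ''j'' ''V'' probe) m)"
  proof (rule Upto_rule[where B = V and J = "\<lambda>j. best (X j) s"])
    show "0 \<le> V" using assms n_le_V by auto
    show "m ''V'' 0 = V" "V \<le> m ''input_length'' 0"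
      using assms by (auto simp: data_def)
    show "best (X 0) s (m(''j'' := k))" for k
      using assms by (simp add: X_def best_upd)
  next
    fix j m' k
    assume j: "0 \<le> j" "j < V" "best (X j) s m'" "m' ''j'' 0 = j"
      and fr: "\<And>a. a \<notin> writes probe \<Longrightarrow> a \<noteq> ''j'' \<Longrightarrow> m' a = m a"
    have "best (X j \<union> (if m' ''tc'' j \<noteq> 1 \<and> ok i j then {(i, j)} else {})) s (den probe m')"
    proof (rule probe_best)
      show "data m'"
        using assms(1) by (rule data_cong) (rule fr; auto simp: solve_defs)
    qed (use assms j in \<open>auto simp: fr solve_defs\<close>)
    moreover have "X j \<union> (if m' ''tc'' j \<noteq> 1 \<and> ok i j then {(i, j)} else {}) = X (j + 1)"
      using interval_Suc[OF j(1)] by (auto simp: X_def fr solve_defs)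
    ultimately show "best (X (j + 1)) s ((den probe m')(''j'' := k))"
      by (simp add: best_upd)
  qed
  then show ?thesis by (simp add: X_def)
qed

lemma scan_best:
  assumes "data m" and n: "0 \<le> n"
  defines "S \<equiv> {(i, v). i \<in> {0..<n} \<and> m ''tr'' i = 1 \<and> v \<in> {0..<V} \<and> m ''tc'' v \<noteq> 1 \<and> ok i v}"
  shows "best S (\<lambda>(i, v). c i v + m ''y'' v - m ''u'' i) (den scan m)"
proof -
  let ?s = "\<lambda>(i, v). c i v + m ''y'' v - m ''u'' i"
  define X where
    "X j = {(i, v). i \<in> {0..<j} \<and> m ''tr'' i = 1 \<and> v \<in> {0..<V} \<and> m ''tc'' v \<noteq> 1 \<and> ok i v}" for j
  have "best (X n) ?s (den scan m)"
    unfolding scan_def den.simps(2,3)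
  proof (rule Upto_rule[where B = n and J = "\<lambda>j. best (X j) ?s"])
    show "0 \<le> n" by fact
    fix j m' k
    let ?b = "Branch (Equal (Read ''tr'' (Var ''i'')) (Const 1)) (Upto ''j'' ''V'' probe) Nop"
    assume j: "0 \<le> j" "j < n" "best (X j) ?s m'" "m' ''i'' 0 = j"
      and fr: "\<And>a. a \<notin> writes ?b \<Longrightarrow> a \<noteq> ''i'' \<Longrightarrow>
        m' a = (m(''fd'' := (m ''fd'')(aval m (Const 0) := aval m (Const 0)))) a"
    have fr': "m' a = m a" if "a \<notin> writes scan" for a
      using that fr[of a] by (auto simp: solve_defs)
    show "best (X (j + 1)) ?s ((den ?b m')(''i'' := k))"
    proof (cases "m ''tr'' j = 1")
      case True
      have "best (X j \<union> {j} \<times> {v \<in> {0..<V}. m' ''tc'' v \<noteq> 1 \<and> ok j v}) ?s (den (Upto ''j'' ''V'' probe) m')"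
      proof (rule probe_row)
        show "data m'"
          using assms(1) by (rule data_cong) (rule fr'; auto simp: solve_defs)
      qed (use assms j in \<open>auto simp: fr' solve_defs\<close>)
      moreover have "X j \<union> {j} \<times> {v \<in> {0..<V}. m' ''tc'' v \<noteq> 1 \<and> ok j v} = X (j + 1)"
        using interval_Suc[OF j(1)] True by (auto simp: X_def fr' solve_defs)
      moreover have "den ?b m' = den (Upto ''j'' ''V'' probe) m'"
        using True j by (simp add: fr' solve_defs)
      ultimately show ?thesis
        by (simp add: best_upd)
    next
      case False
      then have "X (j + 1) = X j"
        using interval_Suc[OF j(1)] by (auto simp: X_def)
      moreover have "den ?b m' = m'"
        using False j by (simp add: fr' solve_defs)
      ultimately show ?thesis
        using j by (simp add: best_upd)
    qed
  qed (use assms n_le_V in \<open>auto simp: data_def X_def best_def\<close>)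
  then show ?thesis by (simp add: X_def S_def)
qed

lemma adjust_spec:
  assumes "data m" "0 \<le> V"
  shows "den adjust m ''u'' = shift {i \<in> {0..<V}. m ''tr'' i = 1} (m ''be'' 0) (m ''u'')"
    and "den adjust m ''y'' = shift {i \<in> {0..<V}. m ''tc'' i = 1} (m ''be'' 0) (m ''y'')"
proof -
  let ?P = "\<lambda>x m'. m' ''u'' = shift {i \<in> {0..<x}. m ''tr'' i = 1} (m ''be'' 0) (m ''u'') \<and>
    m' ''y'' = shift {i \<in> {0..<x}. m ''tc'' i = 1} (m ''be'' 0) (m ''y'')"
  have "?P V (den adjust m)"
    unfolding adjust_def
    by (rule Upto_rule[where B = V and J = ?P])
      (use assms in \<open>auto simp: data_def shift_def fun_eq_iff\<close>)
  then show "den adjust m ''u'' = shift {i \<in> {0..<V}. m ''tr'' i = 1} (m ''be'' 0) (m ''u'')"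
    and "den adjust m ''y'' = shift {i \<in> {0..<V}. m ''tc'' i = 1} (m ''be'' 0) (m ''y'')"
    by auto
qed

lemma grow_spec:
  assumes "m ''r'' 0 = r" "0 \<le> r" "r \<le> m ''input_length'' 0"
  shows "den grow m ''tr'' = (\<lambda>i. if i \<in> {0..<r} \<and> m ''f'' i = m ''bv'' 0 then 1 else m ''tr'' i)"
  unfolding grow_def
  by (rule Upto_rule[where B = r and
        J = "\<lambda>x m'. m' ''tr'' = (\<lambda>i. if i \<in> {0..<x} \<and> m ''f'' i = m ''bv'' 0 then 1 else m ''tr'' i)"])
    (use assms in \<open>auto simp: fun_eq_iff\<close>)

text \<open>Each flip lowers the rank and the tree has at most \<open>V\<close> columns, so the root
  is met within \<open>V\<close> rounds; from then on the loop idles with \<open>fin\<close>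
  set.\<close>

lemma flip_spec:
  assumes "data m" "m ''r'' 0 = r" "0 \<le> r" "0 \<le> V"
    and hk: "hooked r (k + 1) (m ''f'') (m ''u'') (m ''y'') C (m ''par'') rank"
    and fl: "flipping r 0 (m ''f'') (m ''u'') (m ''y'') C (m ''par'') rank h (m ''bv'' 0)"
  defines "f' \<equiv> den flip m ''f''"
  shows "placed (r + 1) f' \<and> tight (r + 1) f' (m ''u'') (m ''y'') \<and>
    (\<forall>w\<in>{0..<V}. load (r + 1) f' w = h w)"
proof -
  let ?end = "\<lambda>f'. placed (r + 1) f' \<and> tight (r + 1) f' (m ''u'') (m ''y'') \<and>
    (\<forall>w\<in>{0..<V}. load (r + 1) f' w = h w)"
  let ?flipping = "\<lambda>t m'. flipping r t (m' ''f'') (m ''u'') (m ''y'') C (m ''par'') rank h (m' ''cv'' 0)"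
  show ?thesis
    unfolding f'_def flip_def den.simps(2,3)
  proof (rule Upto_rule[where B = V and
        J = "\<lambda>t m'. m' ''fin'' 0 = 0 \<and> ?flipping t m' \<or> m' ''fin'' 0 = 1 \<and> ?end (m' ''f'')"],
      goal_cases)
    case (5 t m' kk)
    have fr: "m' ''par'' = m ''par''" "m' ''r'' = m ''r''"
      by (rule trans[OF 5(5)]; simp)+
    show ?case
    proof (cases "m' ''fin'' 0 = 0")
      case True
      then have fl': "?flipping t m'" using 5 by auto
      let ?v = "m' ''cv'' 0"
      show ?thesis
      proof (cases "m ''par'' ?v = r")
        case r: True
        show ?thesis
          using flipping_end[OF fl' hk r \<open>0 \<le> r\<close>] r True assms(2) by (simp add: fr)
      next
        case r: False
        show ?thesis
          using flipping_step[OF fl' hk r] r True assms(2) by (simp add: fr)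
      qed
    next
      case False
      then show ?thesis using 5 by auto
    qed
  next
    case (6 m')
    have "\<not> ?flipping V m'"
    proof
      assume "?flipping V m'"
      then have "m' ''cv'' 0 \<in> C" "V + rank (m' ''cv'' 0) < int (card C)"
        by (auto simp: flipping_def)
      moreover have "C \<subseteq> {0..<V}" "0 \<le> rank (m' ''cv'' 0)"
        using hk calculation by (auto simp: hooked_def)
      moreover have "card C \<le> card {0..<V}"
        by (rule card_mono) (use calculation in auto)
      ultimately show False using \<open>0 \<le> V\<close> by simp
    qed
    then show ?case using 6 by auto
  qed (use assms in \<open>auto simp: data_def\<close>)
qed

abbreviation marked :: "(int \<Rightarrow> int) \<Rightarrow> int set" where
  "marked a \<equiv> {v \<in> {0..<V}. a v = 1}"

definition settled :: "int \<Rightarrow> memory \<Rightarrow> bool" where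
  "settled r m \<longleftrightarrow> data m \<and> partial_optimum r (m ''f'') (m ''u'') (m ''y'') \<and>
     (\<forall>v\<in>{0..<V}. m ''us'' v = load r (m ''f'') v)"

text \<open>The state of the search for a place of row \<open>r\<close> when \<open>k\<close>
  columns are in the tree. Row \<open>r\<close> already has a dual value but no column, hence
  feasibility for \<open>r + 1\<close> rows and tightness for \<open>r\<close> rows only.\<close>

definition searching :: "int \<Rightarrow> int \<Rightarrow> memory \<Rightarrow> bool" where
  "searching r k m \<longleftrightarrow> data m \<and> matching r (m ''f'') \<and> dual_feasible (r + 1) (m ''u'') (m ''y'') \<and>
     tight r (m ''f'') (m ''u'') (m ''y'') \<and> slack_free r (m ''f'') (m ''y'') \<and>
     (\<forall>v\<in>{0..<V}. m ''us'' v = load r (m ''f'') v) \<and>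
     marked (m ''tr'') = tree_rows r (m ''f'') (marked (m ''tc'')) \<and>
     full r (m ''f'') (marked (m ''tc'')) \<and>
     (\<exists>rank. hooked r k (m ''f'') (m ''u'') (m ''y'') (marked (m ''tc'')) (m ''par'') rank)"

lemma settled_cong:
  assumes "settled r m" "\<And>a. a \<in> {''D'', ''V'', ''input_length'', ''cap'', ''ok'', ''oD'', ''co'',
    ''f'', ''u'', ''y'', ''us''} \<Longrightarrow> m' a = m a"
  shows "settled r m'"
proof -
  have "data m'"
    by (rule data_cong[of m]) (use assms in \<open>auto simp: settled_def\<close>)
  with assms(1) show ?thesis
    by (simp add: settled_def assms(2))
qed

lemma searching_cong:
  assumes "searching r k m" "\<And>a. a \<in> {''D'', ''V'', ''input_length'', ''cap'', ''ok'', ''oD'', ''co'',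
    ''f'', ''u'', ''y'', ''us'', ''tr'', ''tc'', ''par''} \<Longrightarrow> m' a = m a"
  shows "searching r k m'"
proof -
  have "data m'"
    by (rule data_cong[of m]) (use assms in \<open>auto simp: searching_def\<close>)
  with assms(1) show ?thesis
    by (simp add: searching_def assms(2))
qed

text \<open>The tree has an exit, and the price change makes the cheapest exit tight. If its column
  has room, the alternating path is flipped and row \<open>r\<close> finds its place; otherwise the
  column is full and joins the tree with all rows sitting in it.\<close>

lemma phase_spec:
  assumes se: "searching r k m" and r: "m ''r'' 0 = r" "r \<in> {0..<n}" and dn: "m ''dn'' 0 = 0"
  defines "m' \<equiv> den phase m"
  shows "m' ''dn'' 0 = 0 \<and> searching r (k + 1) m' \<or> m' ''dn'' 0 = 1 \<and> settled (r + 1) m'"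
proof -
  define f C where "f = m ''f''" and "C = marked (m ''tc'')"
  have dat: "data m" and se': "matching r f" "dual_feasible (r + 1) (m ''u'') (m ''y'')"
    "tight r f (m ''u'') (m ''y'')" "slack_free r f (m ''y'')"
    "\<forall>v\<in>{0..<V}. m ''us'' v = load r f v" "marked (m ''tr'') = tree_rows r f C" "full r f C"
    using se by (auto simp: searching_def f_def C_def)
  obtain rank where hk: "hooked r k f (m ''u'') (m ''y'') C (m ''par'') rank"
    using se by (auto simp: searching_def f_def C_def)
  have n: "0 \<le> n" "0 \<le> V" "0 \<le> r" using r n_le_V by auto
  have C: "C \<subseteq> {0..<V}" by (auto simp: C_def)
  define S where "S = {(i, v). i \<in> tree_rows r f C \<and> v \<in> {0..<V} - C \<and> ok i v}"
  define s where "s = (\<lambda>(i, v). c i v + m ''y'' v - m ''u'' i)"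
  define m1 where "m1 = den scan m"
  define i v d where "i = m1 ''bi'' 0" and "v = m1 ''bv'' 0" and "d = m1 ''be'' 0"
  have rows: "tree_rows r f C \<subseteq> {0..<n}"
    using r by (auto simp: tree_rows_def)
  have mem: "j \<in> tree_rows r f C \<longleftrightarrow> j \<in> {0..<V} \<and> m ''tr'' j = 1" for j
    using se'(6) by (auto simp: set_eq_iff)
  have "{(i, v). i \<in> {0..<n} \<and> m ''tr'' i = 1 \<and> v \<in> {0..<V} \<and> m ''tc'' v \<noteq> 1 \<and> ok i v} = S"
  proof -
    have "i \<in> {0..<n} \<and> m ''tr'' i = 1 \<longleftrightarrow> i \<in> tree_rows r f C" for i
      using rows n_le_V mem[of i] by auto
    moreover have "v \<in> {0..<V} \<and> m ''tc'' v \<noteq> 1 \<longleftrightarrow> v \<in> {0..<V} - C" for v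
      by (auto simp: C_def)
    ultimately show ?thesis
      unfolding S_def by blast
  qed
  then have "best S s m1"
    using scan_best[OF dat n(1)] by (simp add: m1_def s_def)
  moreover have "S \<noteq> {}"
    using exit_exists[of r f C] se' C r by (auto simp: S_def matching_def)
  ultimately have iv: "(i, v) \<in> S" and d: "d = s (i, v)" "\<And>p. p \<in> S \<Longrightarrow> d \<le> s p"
    by (auto simp: best_def i_def v_def d_def)
  then have exit: "i \<in> tree_rows r f C" "v \<in> {0..<V} - C" "ok i v"
    by (auto simp: S_def)
  have fr1: "m1 a = m a" if "a \<notin> writes scan" for a
    unfolding m1_def using that by (rule den_frame)
  have dat1: "data m1"
    using dat by (rule data_cong) (rule fr1; auto simp: solve_defs)
  define m2 where "m2 = den adjust m1"
  have fr2: "m2 a = m1 a" if "a \<notin> writes adjust" for a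
    unfolding m2_def using that by (rule den_frame)
  define u y where "u = shift (tree_rows r f C) d (m ''u'')" and "y = shift C d (m ''y'')"
  have uy: "m2 ''u'' = u" "m2 ''y'' = y"
    using adjust_spec[OF dat1 n(2)] se'(6)
    by (simp_all add: m2_def u_def y_def fr1 solve_defs d_def C_def)
  have dual: "dual_feasible (r + 1) u y" "tight r f u y" "slack_free r f y"
    "hooked r k f u y C (m ''par'') rank" "u i = c i v + y v"
    using dual_shift[OF se'(2,3,4) hk se'(7) exit _ _ n(3)] d
    by (auto simp: u_def y_def s_def S_def)
  define m3 where "m3 = m2(''tc'' := (m ''tc'')(v := 1), ''par'' := (m ''par'')(v := i))"
  have m3: "den (Put ''par'' (Var ''bv'') (Var ''bi'')) (den (Put ''tc'' (Var ''bv'') (Const 1)) m2) = m3"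
    by (simp add: m3_def fr2 fr1 solve_defs i_def v_def)
  let ?C = "insert v C"
  have hk3: "hooked r (k + 1) f u y ?C ((m ''par'')(v := i)) (rank(v := k))"
    by (rule hook_exit) (use dual exit n in auto)
  have fr3: "m3 a = m a" if "a \<notin> {''tc'', ''par'', ''u'', ''y''} \<union> writes scan \<union> writes adjust" for a
    using that by (simp add: m3_def fr2 fr1)
  have dat3: "data m3"
    using dat by (rule data_cong) (rule fr3; auto simp: solve_defs)
  have tc: "marked (m3 ''tc'') = ?C"
    using exit by (auto simp: m3_def C_def)
  have ca: "m ''us'' v = load r f v" "m3 ''cap'' v = cap v" "m3 ''bv'' 0 = v" "m3 ''us'' = m ''us''"
      "m3 ''u'' = u" "m3 ''y'' = y" "m3 ''f'' = f" "m3 ''par'' = (m ''par'')(v := i)" "m3 ''tr'' = m ''tr''"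
      "m3 ''dn'' 0 = 0" "m3 ''r'' 0 = r"
    using se'(5) exit dat uy dn r by (auto simp: m3_def fr1 fr2 solve_defs data_def v_def f_def)
  show ?thesis
  proof (cases "load r f v < cap v")
    case True
    define m4 where "m4 = m3(''us'' := (m ''us'')(v := load r f v + 1), ''dn'' := (m3 ''dn'')(0 := 1))"
    \<comment> \<open>The incremented counters are already the final loads: flipping changes the
      load of the free end \<open>v\<close> only.\<close>
    define h where "h = m4 ''us''"
    have "den (Put ''us'' (Var ''bv'') (Add (Read ''us'' (Var ''bv'')) (Const 1)) ;; ''dn'' ::= Const 1) m3 = m4"
      by (simp add: m4_def ca)
    then have m': "m' = den flip m4"
      using True by (simp add: m'_def phase_def m1_def[symmetric] m2_def[symmetric] m3[simplified] ca)
    have dat4: "data m4"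
      using dat3 by (rule data_cong) (simp add: m4_def; auto)
    have h: "h w = load r f w + of_bool (v = w)" if "w \<in> {0..<V}" for w
      using that se'(5) by (simp add: h_def m4_def)
    have m4: "m4 ''f'' = f" "m4 ''u'' = u" "m4 ''y'' = y" "m4 ''par'' = (m ''par'')(v := i)"
      "m4 ''bv'' 0 = v" "m4 ''r'' 0 = r" "m4 ''dn'' 0 = 1"
      by (simp_all add: m4_def ca)
    have "flipping r 0 f u y ?C ((m ''par'')(v := i)) (rank(v := k)) h v"
      unfolding flipping_def
    proof (intro conjI ballI impI)
      show "placed r f" using se'(1) by (simp add: matching_def)
      show "0 + (rank(v := k)) v < int (card ?C)"
        using hk3 by (simp add: hooked_def)
    next
      fix w assume w: "w \<in> ?C" "((m ''par'')(v := i)) w \<noteq> r"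
      then show "f (((m ''par'')(v := i)) w) \<in> ?C"
        "(rank(v := k)) (f (((m ''par'')(v := i)) w)) < (rank(v := k)) w"
        using hk3 unfolding hooked_def by blast+
    next
      fix w assume "w \<in> {0..<V}"
      then show "load r f w + of_bool (v = w) = h w" by (simp add: h)
    qed (use dual in auto)
    then have fin: "placed (r + 1) (m' ''f'')" "tight (r + 1) (m' ''f'') u y"
      "\<And>w. w \<in> {0..<V} \<Longrightarrow> load (r + 1) (m' ''f'') w = h w"
      using flip_spec[OF dat4 m4(6) n(3) n(2), of k ?C "rank(v := k)" h, unfolded m4, OF hk3]
      unfolding m' by blast+
    have fr4: "m' a = m4 a" if "a \<notin> writes flip" for a
      unfolding m' using that by (rule den_frame)
    have "data m'"
      using dat4 by (rule data_cong) (rule fr4; auto simp: solve_defs)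
    moreover have "m' ''u'' = u" "m' ''y'' = y" "m' ''us'' = h" "m' ''dn'' 0 = 1"
      using m4 by (auto simp: fr4 solve_defs h_def)
    moreover have "h w \<le> cap w" if "w \<in> {0..<V}" for w
      using h[OF that] True se'(1) that by (auto simp: matching_def)
    moreover have "load r f w < cap w" if "w \<in> {0..<V}" "h w < cap w" for w
      using h[OF that(1)] that(2) by (cases "v = w") simp_all
    ultimately have "settled (r + 1) m'"
      using fin dual by (simp add: settled_def partial_optimum_def matching_def slack_free_def)
    with \<open>m' ''dn'' 0 = 1\<close> show ?thesis by simp
  next
    case False
    have m': "m' = den grow m3"
      using False by (simp add: m'_def phase_def m1_def[symmetric] m2_def[symmetric] m3[simplified] ca)
    have fr4: "m' a = m3 a" if "a \<notin> writes grow" for a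
      unfolding m' using that by (rule den_frame)
    have "data m'"
      using dat3 by (rule data_cong) (rule fr4; auto simp: solve_defs)
    moreover have eqs: "m' ''u'' = u" "m' ''y'' = y" "m' ''us'' = m ''us''" "m' ''dn'' 0 = 0" "m' ''f'' = f"
      "m' ''tc'' = m3 ''tc''" "m' ''par'' = (m ''par'')(v := i)"
      using ca by (auto simp: fr4 solve_defs)
    moreover have "m' ''tr'' = (\<lambda>j. if j \<in> {0..<r} \<and> f j = v then 1 else m ''tr'' j)"
      unfolding m' using grow_spec[of m3 r] ca n dat3 r n_le_V by (auto simp: data_def)
    then have "marked (m' ''tr'') = tree_rows r f ?C"
      using mem r n_le_V by (auto simp: tree_rows_def set_eq_iff)
    moreover have "full r f ?C"
      using se'(1,7) False exit by (force simp: full_def matching_def)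
    ultimately have "searching r (k + 1) m'"
      using se' dual hk3 tc unfolding searching_def by (intro conjI) (auto simp only:)
    with eqs show ?thesis by simp
  qed
qed

lemma clear_spec:
  assumes "0 \<le> V" "m ''V'' 0 = V" "V \<le> m ''input_length'' 0"
  shows "\<forall>v\<in>{0..<V}. den clear m ''tr'' v = 0 \<and> den clear m ''tc'' v = 0"
  unfolding clear_def
  by (rule Upto_rule[where B = V and J = "\<lambda>x m'. \<forall>v\<in>{0..<x}. m' ''tr'' v = 0 \<and> m' ''tc'' v = 0"])
    (use assms in auto)

text \<open>The new row may begin with dual value 0 because costs and prices are nonnegative, and an
  empty tree hooks no column.\<close>

lemma insert_row_spec:
  assumes se: "settled r m" and r: "m ''r'' 0 = r" "r \<in> {0..<n}"
  shows "settled (r + 1) (den insert_row m)"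
proof -
  define m1 where "m1 = den clear m"
  define m2 where "m2 = m1(''tr'' := (m1 ''tr'')(r := 1), ''u'' := (m1 ''u'')(r := 0), ''dn'' := (m1 ''dn'')(0 := 0))"
  have n: "0 \<le> n" "0 \<le> V" "0 \<le> r" using r n_le_V by auto
  have dat: "data m" using se by (simp add: settled_def)
  have V: "m ''V'' 0 = V" "V \<le> m ''input_length'' 0" using dat by (auto simp: data_def)
  have fr1: "m1 a = m a" if "a \<notin> {''tr'', ''tc'', ''x''}" for a
    unfolding m1_def using that by (intro den_frame) (auto simp: clear_def)
  have cl: "m1 ''tr'' v = 0" "m1 ''tc'' v = 0" if "v \<in> {0..<V}" for v
    using clear_spec[of m, OF n(2) V] that by (auto simp: m1_def)
  have m2: "den (Put ''tr'' (Var ''r'') (Const 1) ;; Put ''u'' (Var ''r'') (Const 0) ;; ''dn'' ::= Const 0) m1 = m2"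
    by (simp add: m2_def fr1 r)
  have fr2: "m2 a = m a" if "a \<notin> {''tr'', ''tc'', ''x'', ''u'', ''dn''}" for a
    using that by (simp add: m2_def fr1)
  have dat2: "data m2"
    using dat by (rule data_cong) (rule fr2; auto)
  have po: "partial_optimum r (m ''f'') (m ''u'') (m ''y'')"
    using se by (simp add: settled_def)
  have u2: "m2 ''u'' = (m ''u'')(r := 0)"
    by (simp add: m2_def fr1)
  have tc: "marked (m2 ''tc'') = {}" and tr: "marked (m2 ''tr'') = {r}"
    using cl r n_le_V by (auto simp: m2_def)
  have "dual_feasible (r + 1) (m2 ''u'') (m ''y'')"
    using po r c_nonneg interval_Suc[OF n(3)] unfolding u2
    by (auto simp: partial_optimum_def dual_feasible_def add_nonneg_nonneg)
  moreover have "tight r (m ''f'') (m2 ''u'') (m ''y'')"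
    using po unfolding u2 by (auto simp: partial_optimum_def tight_def)
  moreover have "hooked r 0 (m ''f'') (m2 ''u'') (m ''y'') {} (m ''par'') rank" for rank
    by (simp add: hooked_def)
  then have "\<exists>rank. hooked r 0 (m ''f'') (m2 ''u'') (m ''y'') {} (m ''par'') rank"
    by blast
  ultimately have "searching r 0 m2"
    using dat2 po se unfolding searching_def tc tr
    by (simp add: fr2 partial_optimum_def settled_def tree_rows_def full_def)
  define J where "J = (\<lambda>k m'. m' ''dn'' 0 = 0 \<and> searching r k m' \<or> m' ''dn'' 0 = 1 \<and> settled (r + 1) m')"
  have "settled (r + 1) (den (Upto ''k'' ''V'' (Branch (Equal (Var ''dn'') (Const 0)) phase Nop)) m2)"
  proof (rule Upto_rule[where B = V and J = J])
    show "0 \<le> V" "m2 ''V'' 0 = V" "V \<le> m2 ''input_length'' 0"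
      using n dat2 by (auto simp: data_def)
    show "J 0 (m2(''k'' := k))" for k
    proof -
      have "searching r 0 (m2(''k'' := k))"
        using \<open>searching r 0 m2\<close> by (rule searching_cong) auto
      then show ?thesis by (simp add: J_def m2_def)
    qed
  next
    fix k m' kk
    let ?b = "Branch (Equal (Var ''dn'') (Const 0)) phase Nop"
    assume k: "0 \<le> k" "k < V" "J k m'"
      and fr: "\<And>a. a \<notin> writes ?b \<Longrightarrow> a \<noteq> ''k'' \<Longrightarrow> m' a = m2 a"
    have "m' ''r'' = m ''r''"
      by (rule trans[OF fr]) (auto simp: solve_defs fr2)
    then have J: "J (k + 1) (den ?b m')"
      using phase_spec[of r k m'] k r by (auto simp: J_def)
    have "searching r (k + 1) (m(''k'' := kk))" if "searching r (k + 1) m" for m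
      using that by (rule searching_cong) auto
    moreover have "settled (r + 1) (m(''k'' := kk))" if "settled (r + 1) m" for m
      using that by (rule settled_cong) auto
    ultimately show "J (k + 1) ((den ?b m')(''k'' := kk))"
      using J unfolding J_def by fastforce
  next
    fix m' assume J: "J V m'"
    \<comment> \<open>Every unsuccessful phase adds a column. After \<open>V\<close> of them all
      columns would be in the tree, which then could have no exit.\<close>
    have "\<not> searching r V m'"
    proof
      assume s: "searching r V m'"
      define C where "C = marked (m' ''tc'')"
      have C: "C \<subseteq> {0..<V}" "int (card C) = V" "full r (m' ''f'') C" "placed r (m' ''f'')"
        using s by (auto simp: searching_def hooked_def matching_def C_def)
      then have "C = {0..<V}"
        using n by (intro card_subset_eq) auto
      with exit_exists[OF C(4,3,1)] r show False by simp
    qed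
    with J show "settled (r + 1) m'" by (auto simp: J_def)
  qed
  then show ?thesis
    using m2 by (simp add: insert_row_def m1_def)
qed

lemma solve_spec:
  assumes dat: "data m" and "0 \<le> n" "\<And>v. m ''y'' v = 0" "\<And>v. m ''us'' v = 0"
  shows "settled n (den solve m)"
  unfolding solve_def
proof (rule Upto_rule[where B = n and J = settled])
  show "0 \<le> n" "m ''D'' 0 = n" "n \<le> m ''input_length'' 0"
    using assms n_le_V by (auto simp: data_def)
  have "settled 0 m"
    using assms cap_nonneg
    by (auto simp: settled_def partial_optimum_def matching_def placed_def dual_feasible_def tight_def
        slack_free_def load_def)
  then show "settled 0 (m(''r'' := k))" for k
    by (rule settled_cong) auto
next
  fix r m' k
  assume "0 \<le> r" "r < n" "settled r m'" "m' ''r'' 0 = r"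
  then have "settled (r + 1) (den insert_row m')"
    by (intro insert_row_spec) auto
  then show "settled (r + 1) ((den insert_row m')(''r'' := k))"
    by (rule settled_cong) auto
qed

end

section \<open>Reachability in the graph of possible services\<close>

text \<open>
  \<open>nx\<close> holds, for a node and a demand, the next demand on some path between them plus one, or 0 as long
  as no path is known.  Each round of \<open>closure\<close> lengthens the known paths by at least one step.
\<close>

definition hop_first :: prog where
  "hop_first =
    Branch (Equal (entry ''e'' ''x'' ''j'') (Const 1))
      (Put ''nx'' (Add (Read ''oD'' (Var ''x'')) (Var ''j'')) (Add (Var ''j'') (Const 1))) Nop"

definition hop_via :: prog where
  "hop_via =
    Branch (Conj (Equal (entry ''e'' ''x'' ''z'') (Const 1)) (Neg (Equal (entry ''nx'' ''z'' ''j'') (Const 0))))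
      (Put ''nx'' (Add (Read ''oD'' (Var ''x'')) (Var ''j'')) (Add (Var ''z'') (Const 1))) Nop"

definition hop :: prog where
  "hop = hop_first ;; Upto ''z'' ''D'' hop_via"

definition closure :: prog where
  "closure = Upto ''k'' ''V'' (Upto ''x'' ''V'' (Upto ''j'' ''D'' hop))"

definition price_entry :: prog where
  "price_entry =
    Branch (Equal (Var ''v'') (Var ''i''))
    (Put ''co'' (Add (Read ''oD'' (Var ''v'')) (Var ''i'')) (Read ''w'' (Var ''i'')) ;;
     Put ''ok'' (Add (Read ''oD'' (Var ''v'')) (Var ''i'')) (Const 1))
    (Put ''co'' (Add (Read ''oD'' (Var ''v'')) (Var ''i'')) (Const 0) ;;
     Branch (Equal (entry ''nx'' ''v'' ''i'') (Const 0))
       (Put ''ok'' (Add (Read ''oD'' (Var ''v'')) (Var ''i'')) (Const 0))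
       (Put ''ok'' (Add (Read ''oD'' (Var ''v'')) (Var ''i'')) (Const 1)))"

definition price :: prog where
  "price = Upto ''v'' ''V'' (Upto ''i'' ''D'' price_entry)"

lemmas closure_defs = entry_def hop_first_def hop_via_def hop_def closure_def price_entry_def price_def

lemma index_inject:
  fixes n :: int
  assumes "j \<in> {0..<n}" "j' \<in> {0..<n}"
  shows "v * n + j = v' * n + j' \<longleftrightarrow> v = v' \<and> j = j'"
proof
  assume eq: "v * n + j = v' * n + j'"
  have "v = (v * n + j) div n" "v' = (v' * n + j') div n"
    using assms by auto
  with eq have "v = v'" by simp
  with eq show "v = v' \<and> j = j'" by simp
qed simp

section \<open>Transitive closure with next hops\<close>

locale digraph =
  fixes n V :: int
    and E :: "int \<Rightarrow> int \<Rightarrow> bool"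
    and \<tau> :: "int \<Rightarrow> int"
  assumes n_pos: "0 < n" and n_le_V: "n \<le> V"
    and E_time: "x \<in> {0..<n} \<Longrightarrow> z \<in> {0..<n} \<Longrightarrow> E x z \<Longrightarrow> \<tau> x < \<tau> z"
begin

fun reach :: "nat \<Rightarrow> int \<Rightarrow> int \<Rightarrow> bool" where
  "reach 0 x j \<longleftrightarrow> False"
| "reach (Suc k) x j \<longleftrightarrow> E x j \<or> (\<exists>z\<in>{0..<n}. E x z \<and> reach k z j)"

lemma reach_Suc: "reach k x j \<Longrightarrow> reach (Suc k) x j"
  by (induction k arbitrary: x) auto

lemma reach_mono: "k \<le> l \<Longrightarrow> reach k x j \<Longrightarrow> reach l x j"
  by (induction rule: dec_induct) (auto intro: reach_Suc simp del: reach.simps)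

definition edges :: "memory \<Rightarrow> bool" where
  "edges m \<longleftrightarrow> m ''D'' 0 = n \<and> m ''V'' 0 = V \<and> V \<le> m ''input_length'' 0 \<and>
     (\<forall>v\<in>{0..<V}. m ''oD'' v = v * n \<and> (\<forall>j\<in>{0..<n}. m ''e'' (v * n + j) = 1 \<longleftrightarrow> E v j))"

lemma edges_cong:
  assumes "edges m" "\<And>a. a \<in> {''D'', ''V'', ''input_length'', ''oD'', ''e''} \<Longrightarrow> m' a = m a"
  shows "edges m'"
  using assms by (simp add: edges_def)

text \<open>Later rounds may overwrite a hop by another one, so no path length is recorded; it is
  enough that the next node is the goal or has an entry itself. The clause on times compares the two
  ends directly, which later makes the predecessor relation of an assignment well-founded.\<close>

definition hops :: "memory \<Rightarrow> bool" where
  "hops m \<longleftrightarrow> (\<forall>x\<in>{0..<V}. \<forall>j\<in>{0..<n}. m ''nx'' (x * n + j) \<noteq> 0 \<longrightarrow>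
     (\<exists>z\<in>{0..<n}. m ''nx'' (x * n + j) = z + 1 \<and> E x z \<and> (z = j \<or> m ''nx'' (z * n + j) \<noteq> 0)) \<and>
     (x < n \<longrightarrow> \<tau> x < \<tau> j))"

lemma hopsE:
  assumes "hops m" "x \<in> {0..<V}" "j \<in> {0..<n}" "m ''nx'' (x * n + j) \<noteq> 0"
  obtains z where "z \<in> {0..<n}" "m ''nx'' (x * n + j) = z + 1" "E x z"
    "z = j \<or> m ''nx'' (z * n + j) \<noteq> 0" "x < n \<longrightarrow> \<tau> x < \<tau> j"
  using assms unfolding hops_def by blast

definition hops_for :: "(int \<times> int) set \<Rightarrow> memory \<Rightarrow> bool" where
  "hops_for P m \<longleftrightarrow> hops m \<and> (\<forall>(x, j)\<in>P. m ''nx'' (x * n + j) \<noteq> 0)"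

lemma hops_for_upd: "''nx'' \<noteq> x \<Longrightarrow> hops_for P (m(x := k)) \<longleftrightarrow> hops_for P m"
  by (simp add: hops_for_def hops_def)

lemma hops_for_subset: "hops_for Q m \<Longrightarrow> P \<subseteq> Q \<Longrightarrow> hops_for P m"
  by (auto simp: hops_for_def)

text \<open>Entries never return to 0, since \<open>z + 1\<close> is positive. Hence all other hops
  that lead through the changed entry remain justified.\<close>

lemma hops_for_set:
  assumes h: "hops_for P m" and x: "x \<in> {0..<V}" "j \<in> {0..<n}" "P \<subseteq> {0..<V} \<times> {0..<n}"
    and z: "z \<in> {0..<n}" "E x z" "z = j \<or> m ''nx'' (z * n + j) \<noteq> 0"
    and m': "m' ''nx'' = (m ''nx'')(x * n + j := z + 1)"
  shows "hops_for (insert (x, j) P) m'"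
proof -
  have nx: "m' ''nx'' (x' * n + j') = (if x' = x \<and> j' = j then z + 1 else m ''nx'' (x' * n + j'))"
    if "j' \<in> {0..<n}" for x' j'
    using that x by (simp add: m' index_inject)
  have nz: "m' ''nx'' (x' * n + j') \<noteq> 0" if "j' \<in> {0..<n}" "m ''nx'' (x' * n + j') \<noteq> 0" for x' j'
    using nx[OF that(1), of x'] that z by auto
  have time: "\<tau> x < \<tau> j" if "x < n"
  proof -
    have "\<tau> x < \<tau> z" using that x z by (intro E_time) auto
    moreover have "z = j \<or> \<tau> z < \<tau> j"
      using h z x n_le_V by (auto simp: hops_for_def hops_def)
    ultimately show ?thesis by auto
  qed
  have "hops m'"
    unfolding hops_def
  proof (intro ballI impI)
    fix x' j' assume x': "x' \<in> {0..<V}" "j' \<in> {0..<n}" "m' ''nx'' (x' * n + j') \<noteq> 0"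
    let ?c = "\<lambda>z'. m' ''nx'' (x' * n + j') = z' + 1 \<and> E x' z' \<and> (z' = j' \<or> m' ''nx'' (z' * n + j') \<noteq> 0)"
    show "(\<exists>z'\<in>{0..<n}. ?c z') \<and> (x' < n \<longrightarrow> \<tau> x' < \<tau> j')"
    proof (cases "x' = x \<and> j' = j")
      case True
      then have "?c z" using nx[of j x] nz[of j z] x z by auto
      with True z time show ?thesis by blast
    next
      case False
      then have old: "m' ''nx'' (x' * n + j') = m ''nx'' (x' * n + j')"
        using nx[OF x'(2), of x'] by auto
      have "hops m" "m ''nx'' (x' * n + j') \<noteq> 0"
        using h x' old by (simp_all add: hops_for_def)
      then obtain z' where "z' \<in> {0..<n}" "m ''nx'' (x' * n + j') = z' + 1" "E x' z'"
        "z' = j' \<or> m ''nx'' (z' * n + j') \<noteq> 0" "x' < n \<longrightarrow> \<tau> x' < \<tau> j'"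
        using hopsE x'(1,2) by blast
      then show ?thesis
        using old nz[OF x'(2), of z'] by auto
    qed
  qed
  moreover have "m' ''nx'' (x * n + j) \<noteq> 0"
    using nx[of j x] x z by auto
  moreover have "m' ''nx'' (a * n + b) \<noteq> 0" if "(a, b) \<in> P" for a b
    using h that x(3) by (intro nz) (auto simp: hops_for_def)
  ultimately show ?thesis
    by (auto simp: hops_for_def)
qed

lemma hop_spec:
  assumes ed: "edges m" and h: "hops_for P m" and P: "P \<subseteq> {0..<V} \<times> {0..<n}"
    and x: "m ''x'' 0 = x" "x \<in> {0..<V}" and j: "m ''j'' 0 = j" "j \<in> {0..<n}"
  shows "hops_for (P \<union> (if E x j \<or> (\<exists>z\<in>{0..<n}. E x z \<and> (z, j) \<in> P) then {(x, j)} else {})) (den hop m)"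
proof -
  define Q where "Q z = P \<union> (if E x j \<or> (\<exists>z'\<in>{0..<z}. E x z' \<and> (z', j) \<in> P) then {(x, j)} else {})" for z
  have Q: "Q z \<subseteq> {0..<V} \<times> {0..<n}" for z
    using P x j by (auto simp: Q_def)
  define m1 where "m1 = den hop_first m"
  have fr1: "m1 a = m a" if "a \<noteq> ''nx''" for a
    unfolding m1_def using that by (intro den_frame) (auto simp: hop_first_def)
  have e: "m ''e'' (x * n + z) = 1 \<longleftrightarrow> E x z" if "z \<in> {0..<n}" for z
    using ed x that by (auto simp: edges_def)
  have oD: "m ''oD'' x = x * n"
    using ed x by (auto simp: edges_def)
  have h1: "hops_for (Q 0) m1"
  proof (cases "E x j")
    case True
    have "hops_for (insert (x, j) P) m1"
      by (rule hops_for_set[OF h x(2) j(2) P, of j])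
        (use True j(2) in \<open>simp_all add: m1_def hop_first_def entry_def e oD j(1) x(1)\<close>)
    then show ?thesis using True by (simp add: Q_def)
  next
    case False
    then show ?thesis using h by (simp add: Q_def m1_def hop_first_def entry_def oD e[OF j(2)] j(1) x(1))
  qed
  have "hops_for (Q n) (den (Upto ''z'' ''D'' hop_via) m1)"
  proof (rule Upto_rule[where B = n and J = "\<lambda>z. hops_for (Q z)"])
    show "0 \<le> n" "m1 ''D'' 0 = n" "n \<le> m1 ''input_length'' 0"
      using ed n_pos n_le_V by (auto simp: fr1 edges_def)
    show "hops_for (Q 0) (m1(''z'' := k))" for k
      using h1 by (simp add: hops_for_upd)
  next
    fix z m' k
    assume z: "0 \<le> z" "z < n" "hops_for (Q z) m'" "m' ''z'' 0 = z"
      and fr: "\<And>a. a \<notin> writes hop_via \<Longrightarrow> a \<noteq> ''z'' \<Longrightarrow> m' a = m1 a"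
    have fr2: "m' a = m a" if "a \<noteq> ''nx''" "a \<noteq> ''z''" for a
      using that fr[of a] fr1[of a] by (simp add: hop_via_def)
    have zV: "z \<in> {0..<V}" using z n_le_V by simp
    have oDz: "m ''oD'' z = z * n" using ed zV by (simp add: edges_def)
    have step: "den hop_via m' = (if E x z \<and> m' ''nx'' (z * n + j) \<noteq> 0
        then m'(''nx'' := (m' ''nx'')(x * n + j := z + 1)) else m')"
      using z(1,2) by (simp add: hop_via_def entry_def fr2 oD oDz e[of z] x(1) j(1) z(4))
    have "hops_for (Q (z + 1)) (den hop_via m')"
    proof (cases "E x z \<and> m' ''nx'' (z * n + j) \<noteq> 0")
      case True
      have "hops_for (insert (x, j) (Q z)) (den hop_via m')"
        unfolding step
        by (rule hops_for_set[OF z(3) x(2) j(2) Q, of z]) (use True z in auto)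
      moreover have "Q (z + 1) \<subseteq> insert (x, j) (Q z)"
        by (auto simp: Q_def)
      ultimately show ?thesis
        by (rule hops_for_subset)
    next
      case False
      then have "\<not> (E x z \<and> (z, j) \<in> P)"
        using z(3) by (auto simp: hops_for_def Q_def)
      then have "Q (z + 1) = Q z"
        unfolding Q_def interval_Suc[OF z(1)] by auto
      with False z(3) show ?thesis unfolding step by auto
    qed
    then show "hops_for (Q (z + 1)) ((den hop_via m')(''z'' := k))"
      by (simp add: hops_for_upd)
  qed
  then show ?thesis
    unfolding hop_def den.simps(3) m1_def[symmetric] Q_def by simp
qed

definition reached :: "int \<Rightarrow> (int \<times> int) set" where
  "reached k = {(x, j). x \<in> {0..<V} \<and> j \<in> {0..<n} \<and> reach (nat k) x j}"

lemma reached_Suc: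
  assumes "0 \<le> k" "(x, j) \<in> reached (k + 1)"
  shows "E x j \<or> (\<exists>z\<in>{0..<n}. E x z \<and> (z, j) \<in> reached k)"
  using assms n_le_V by (auto simp: reached_def nat_add_distrib)

text \<open>The table is updated in place, so a round may already use entries made in the same round
  and find longer paths. The invariant is therefore only a lower bound on the set of pairs that have
  an entry.\<close>

lemma closure_round:
  assumes ed: "edges m" and k: "0 \<le> k" and h: "hops_for (reached k) m"
  shows "hops_for (reached (k + 1)) (den (Upto ''x'' ''V'' (Upto ''j'' ''D'' hop)) m)"
proof -
  let ?pos = "\<lambda>(x, j). (int x, int j)"
  define X where "X P = reached k \<union> (reached (k + 1) \<inter> ?pos ` P)" for P
  have "hops_for (X ({..<nat V} \<times> {..<nat n})) (den (Upto ''x'' ''V'' (Upto ''j'' ''D'' hop)) m)"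
  proof (rule Upto_Upto_rule[where \<Phi> = "\<lambda>P. hops_for (X P)"], goal_cases)
    case (15 x j P m')
    let ?new = "if E (int x) (int j) \<or> (\<exists>z\<in>{0..<n}. E (int x) z \<and> (z, int j) \<in> X P)
      then {(int x, int j)} else {}"
    have "hops_for (X P \<union> ?new) (den hop m')"
    proof (rule hop_spec[OF _ 15(4) _ 15(5) _ 15(6)])
      show "edges m'"
        using ed by (rule edges_cong) (rule 15(7); auto simp: closure_defs)
      show "X P \<subseteq> {0..<V} \<times> {0..<n}" by (auto simp: X_def reached_def)
    qed (use 15 in auto)
    moreover have "X (insert (x, j) P) \<subseteq> X P \<union> ?new"
      using reached_Suc[OF k, of "int x" "int j"] by (auto simp: X_def)
    ultimately show ?case by (rule hops_for_subset)
  next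
    case (13 P m' c x)
    then show ?case by (auto simp: hops_for_upd)
  next
    case 14
    then show ?case using h by (simp add: X_def)
  qed (use ed n_pos n_le_V in \<open>auto simp: edges_def closure_defs\<close>)
  moreover have "reached (k + 1) \<subseteq> X ({..<nat V} \<times> {..<nat n})"
  proof
    fix p assume p: "p \<in> reached (k + 1)"
    then have "p = ?pos (nat (fst p), nat (snd p))" "(nat (fst p), nat (snd p)) \<in> {..<nat V} \<times> {..<nat n}"
      by (auto simp: reached_def)
    with p show "p \<in> X ({..<nat V} \<times> {..<nat n})" unfolding X_def by blast
  qed
  ultimately show ?thesis by (rule hops_for_subset)
qed

lemma closure_spec:
  assumes ed: "edges m" and "\<And>i. m ''nx'' i = 0"
  shows "hops_for (reached V) (den closure m)"
  unfolding closure_def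
proof (rule Upto_rule[where B = V and J = "\<lambda>k. hops_for (reached k)"])
  show "hops_for (reached 0) (m(''k'' := k))" for k
    using assms by (simp add: hops_for_def hops_def reached_def)
next
  let ?round = "Upto ''x'' ''V'' (Upto ''j'' ''D'' hop)"
  fix k m' c
  assume k: "0 \<le> k" "hops_for (reached k) m'"
    and fr: "\<And>a. a \<notin> writes ?round \<Longrightarrow> a \<noteq> ''k'' \<Longrightarrow> m' a = m a"
  have "edges m'"
    using ed by (rule edges_cong) (rule fr; auto simp: closure_defs)
  then show "hops_for (reached (k + 1)) ((den ?round m')(''k'' := c))"
    using closure_round k by (simp add: hops_for_upd)
qed (use ed n_pos n_le_V in \<open>auto simp: edges_def\<close>)

lemma price_spec:
  assumes ed: "edges m" and "v \<in> {0..<V}" "i \<in> {0..<n}"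
  shows "(den price m ''ok'' (v * n + i) = 1 \<longleftrightarrow> v = i \<or> m ''nx'' (v * n + i) \<noteq> 0) \<and>
    den price m ''co'' (v * n + i) = (if v = i then m ''w'' i else 0)"
proof -
  define good where "good m' v i \<longleftrightarrow> (m' ''ok'' (v * n + i) = 1 \<longleftrightarrow> v = i \<or> m ''nx'' (v * n + i) \<noteq> 0) \<and>
    m' ''co'' (v * n + i) = (if v = i then m ''w'' i else 0)" for m' :: memory and v i
  have all: "\<forall>(v, i)\<in>{..<nat V} \<times> {..<nat n}. good (den price m) (int v) (int i)"
    unfolding price_def
  proof (rule Upto_Upto_rule[where \<Phi> = "\<lambda>P m'. \<forall>(v, i)\<in>P. good m' (int v) (int i)"], goal_cases)
    case (15 v i P m')
    have fr: "m' a = m a" if "a \<in> {''nx'', ''w'', ''oD''}" for a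
      using that 15(7)[of a] by (auto simp: closure_defs)
    have oD: "m ''oD'' (int v) = int v * n" using ed 15(1) by (simp add: edges_def)
    have vals: "den price_entry m' ''co'' = (m' ''co'')(int v * n + int i := if v = i then m ''w'' (int i) else 0)"
      "den price_entry m' ''ok'' = (m' ''ok'')(int v * n + int i :=
        if v = i \<or> m ''nx'' (int v * n + int i) \<noteq> 0 then 1 else 0)"
      using oD by (cases "v = i"; simp add: price_entry_def entry_def fr 15(5,6))+
    have "good (den price_entry m') (int v') (int i')" if p: "(v', i') \<in> insert (v, i) P" for v' i'
    proof -
      have "int i' < n" using p 15(2,3) by auto
      then have "int v' * n + int i' = int v * n + int i \<longleftrightarrow> v' = v \<and> i' = i"
        using index_inject[of "int i'" n "int i" "int v'" "int v"] 15(2) by auto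
      then show ?thesis
        using p 15(4) unfolding good_def vals fun_upd_apply by auto
    qed
    then show ?case by blast
  qed (use ed n_pos n_le_V in \<open>auto simp: edges_def closure_defs good_def\<close>)
  have "(nat v, nat i) \<in> {..<nat V} \<times> {..<nat n}"
    using assms(2,3) by auto
  with all have "good (den price m) (int (nat v)) (int (nat i))" by blast
  then show ?thesis using assms(2,3) by (simp add: good_def)
qed

end

section \<open>Reading off the paths\<close>

definition push :: "aexp \<Rightarrow> prog" where
  "push e = Put ''output'' (Var ''output_length'') e ;;
     ''output_length'' ::= Add (Var ''output_length'') (Const 1)"

text \<open>\<open>su\<close> inverts \<open>f\<close> on the demands, shifted by one so that 0
  means that there is no successor. A starting location may have several successors and keeps only
  the last one; during a walk \<open>su\<close> is consulted at demands only.\<close>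

definition link :: prog where
  "link = Branch (Equal (Read ''f'' (Var ''i'')) (Var ''i'')) Nop
     (Put ''su'' (Read ''f'' (Var ''i'')) (Add (Var ''i'') (Const 1)))"

definition links :: prog where
  "links = Upto ''i'' ''D'' link"

definition arrive :: prog where
  "arrive =
    Branch (Equal (Var ''x'') (Var ''t''))
      (Branch (Equal (Read ''su'' (Var ''x'')) (Const 0)) (''fin'' ::= Const 1)
         (''t'' ::= Sub (Read ''su'' (Var ''x'')) (Const 1)))
      Nop"

definition step :: prog where
  "step = ''x'' ::= Sub (entry ''nx'' ''x'' ''t'') (Const 1) ;; push (Var ''x'') ;; arrive"

text \<open>
  The length of a path is not known before the path has been written; its cell is reserved by
  \<open>push (Const 0)\<close> and its position kept in \<open>q\<close>.
\<close>

definition emit_path :: prog where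
  "emit_path =
    ''v'' ::= Read ''f'' (Var ''d'') ;; ''q'' ::= Add (Var ''output_length'') (Const 3) ;;
    push (Read ''ty'' (Var ''v'')) ;; push (Read ''lo'' (Var ''v'')) ;; push (Read ''cnt'' (Var ''v'')) ;;
    push (Const 0) ;;
    Put ''cnt'' (Var ''v'') (Add (Read ''cnt'' (Var ''v'')) (Const 1)) ;;
    ''x'' ::= Var ''v'' ;; ''t'' ::= Var ''d'' ;; ''fin'' ::= Const 0 ;;
    Upto ''k'' ''V'' (Branch (Equal (Var ''fin'') (Const 0)) step Nop) ;;
    Put ''output'' (Var ''q'') (Sub (Sub (Var ''output_length'') (Var ''q'')) (Const 1))"

text \<open>Columns from \<open>D\<close> on are starting locations, so exactly the first demands of
  the chains trigger a path.\<close>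

definition emit :: prog where
  "emit = Upto ''d'' ''D'' (Branch (Less (Read ''f'' (Var ''d'')) (Var ''D'')) Nop emit_path)"

lemmas emit_defs = entry_def push_def link_def links_def arrive_def step_def emit_path_def emit_def

definition written :: "memory \<Rightarrow> int list \<Rightarrow> bool" where
  "written m L \<longleftrightarrow> m ''output_length'' 0 = int (length L) \<and> (\<forall>i<length L. m ''output'' (int i) = L ! i)"

lemma written_cong:
  "written m L \<Longrightarrow> m' ''output'' = m ''output'' \<Longrightarrow> m' ''output_length'' = m ''output_length'' \<Longrightarrow> written m' L"
  by (simp add: written_def)

lemma written_upd:
  "''output'' \<noteq> x \<Longrightarrow> ''output_length'' \<noteq> x \<Longrightarrow> written (m(x := k)) L \<longleftrightarrow> written m L"
  by (simp add: written_def)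

lemma written_push:
  assumes "written m L"
  shows "written (den (push e) m) (L @ [aval m e])"
  using assms by (auto simp: written_def push_def nth_append)

lemma written_output_of: "written m L \<Longrightarrow> output_of m = L"
  by (auto simp: written_def output_of_def intro: nth_equalityI)

section \<open>From chains to routes and their output\<close>

locale plan = assignment n V ok c cap + digraph n V E \<tau>
  for n V :: int and ok c cap E \<tau> +
  fixes f nx ty lo :: "int \<Rightarrow> int"
  assumes f_matching: "matching n f"
    and time_nonneg: "0 \<le> \<tau> x"
    and nx_hop: "x \<in> {0..<V} \<Longrightarrow> j \<in> {0..<n} \<Longrightarrow> nx (x * n + j) \<noteq> 0 \<Longrightarrow>
      \<exists>z\<in>{0..<n}. nx (x * n + j) = z + 1 \<and> E x z \<and> (z = j \<or> nx (z * n + j) \<noteq> 0)"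
    and nx_time: "x \<in> {0..<n} \<Longrightarrow> j \<in> {0..<n} \<Longrightarrow> nx (x * n + j) \<noteq> 0 \<Longrightarrow> \<tau> x < \<tau> j"
    and ok_iff: "i \<in> {0..<n} \<Longrightarrow> v \<in> {0..<V} \<Longrightarrow> ok i v \<longleftrightarrow> v = i \<or> nx (v * n + i) \<noteq> 0"
begin

text \<open>The condition \<open>a \<noteq> b\<close> leaves out the demands that are given
  up.\<close>

definition follows :: "int \<Rightarrow> int \<Rightarrow> bool" where
  "follows a b \<longleftrightarrow> b \<in> {0..<n} \<and> f b = a \<and> a \<noteq> b"

abbreviation leads :: "int \<Rightarrow> int \<Rightarrow> bool" where
  "leads \<equiv> follows\<^sup>*\<^sup>*"

lemma f_column: "i \<in> {0..<n} \<Longrightarrow> f i \<in> {0..<V}"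
  and f_ok: "i \<in> {0..<n} \<Longrightarrow> ok i (f i)"
  using f_matching by (auto simp: matching_def placed_def)

lemma f_inject:
  assumes "i \<in> {0..<n}" "j \<in> {0..<n}" "f i = f j" "f i < n"
  shows "i = j"
proof (rule ccontr)
  assume "i \<noteq> j"
  have "(\<Sum>k\<in>{i, j}. of_bool (f k = f i)) \<le> load n f (f i)"
    unfolding load_def using assms by (intro sum_mono2) auto
  moreover have "(\<Sum>k\<in>{i, j}. of_bool (f k = f i)) = (2 :: int)"
    using \<open>i \<noteq> j\<close> assms by simp
  moreover have "load n f (f i) \<le> cap (f i)"
    using f_matching f_column[OF assms(1)] unfolding matching_def by blast
  moreover have "cap (f i) = 1"
    using f_column[OF assms(1)] assms(4) by (intro self_cap) auto
  ultimately show False by simp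
qed

lemma follows_hop:
  assumes "follows a b"
  shows "nx (a * n + b) \<noteq> 0" "a \<in> {0..<V}" "b \<in> {0..<n}"
  using assms f_column f_ok ok_iff unfolding follows_def by blast+

text \<open>Going back along \<open>f\<close> lowers the start time, so it ends. It can end only at
  a starting location, since a predecessor that was given up would share its own column, of capacity
  1, with its successor.\<close>

lemma chain_start:
  assumes "d \<in> {0..<n}" "f d \<noteq> d"
  shows "\<exists>d0\<in>{0..<n}. n \<le> f d0 \<and> leads d0 d"
  using assms
proof (induction "nat (\<tau> d)" arbitrary: d rule: less_induct)
  case less
  show ?case
  proof (cases "n \<le> f d")
    case True
    then show ?thesis using less by auto
  next
    case False
    define a where "a = f d"
    have a: "a \<in> {0..<n}" "follows a d"
      using False less f_column[OF less(2)] by (auto simp: a_def follows_def)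
    have "f a \<noteq> a"
      using f_inject[of a d] a less(2,3) by (auto simp: a_def)
    moreover have "\<tau> a < \<tau> d"
      using a follows_hop[OF a(2)] by (intro nx_time) auto
    ultimately obtain d0 where "d0 \<in> {0..<n}" "n \<le> f d0" "leads d0 a"
      using less(1)[of a] a time_nonneg[of a] by auto
    then show ?thesis
      using a(2) by (meson rtranclp.rtrancl_into_rtrancl)
  qed
qed

definition route :: "int \<Rightarrow> int list \<Rightarrow> bool" where
  "route v p \<longleftrightarrow> set p \<subseteq> {0..<n} \<and> successively E (v # p)"

lemma route_snoc: "route v p \<Longrightarrow> z \<in> {0..<n} \<Longrightarrow> E (last (v # p)) z \<Longrightarrow> route v (p @ [z])"
  by (auto simp: route_def successively_append_iff simp del: last.simps simp flip: append_Cons)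

text \<open>Start times strictly increase along a route, so no demand recurs. This is what bounds
  the number of steps of a walk, however the hops were chosen.\<close>

lemma route_distinct:
  assumes "route v p"
  shows "distinct p" "int (length p) \<le> n"
proof -
  have "successively E p"
    using assms by (cases p) (auto simp: route_def)
  then have "successively (\<lambda>x y. \<tau> x < \<tau> y) p"
  proof (rule successively_mono)
    fix x y assume "x \<in> set p" "y \<in> set p" "E x y"
    then show "\<tau> x < \<tau> y"
      using assms by (intro E_time) (auto simp: route_def)
  qed
  then have "sorted_wrt (\<lambda>x y. \<tau> x < \<tau> y) p"
    by (subst (asm) successively_iff_sorted_wrt_strong) (auto intro: less_trans)
  then show "distinct p"
    by (induction p) auto
  then have "length p = card (set p)" by (simp add: distinct_card)
  also have "\<dots> \<le> card {0..<n}"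
    using assms by (intro card_mono) (auto simp: route_def)
  finally show "int (length p) \<le> n"
    using n_pos by simp
qed

text \<open>While the walk goes on, each demand of the chain of \<open>d\<close> has been visited or
  is still ahead, from the present target \<open>t\<close> on. Demands passed between two targets
  are not controlled and need not be.\<close>

definition walking :: "int \<Rightarrow> int \<Rightarrow> int \<Rightarrow> int \<Rightarrow> int list \<Rightarrow> bool" where
  "walking d x t fin p \<longleftrightarrow> d \<in> {0..<n} \<and> n \<le> f d \<and> route (f d) p \<and> x = last (f d # p) \<and>
     (if fin = 0 then t \<in> {0..<n} \<and> nx (x * n + t) \<noteq> 0 \<and>
        (\<forall>e. leads d e \<longrightarrow> e \<in> set p \<or> leads t e)
      else \<forall>e. leads d e \<longrightarrow> e \<in> set p)"

lemma walking_start: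
  assumes "d \<in> {0..<n}" "n \<le> f d" 
  shows "walking d (f d) d 0 []"
  using assms follows_hop(1)[of "f d" d] by (auto simp: walking_def route_def follows_def)

lemma walking_step:
  assumes "walking d x t 0 p"
  defines "z \<equiv> nx (x * n + t) - 1"
  shows "z \<noteq> t \<Longrightarrow> walking d z t 0 (p @ [z])"
    and "z = t \<Longrightarrow> \<nexists>b. follows z b \<Longrightarrow> walking d z t' 1 (p @ [z])"
    and "z = t \<Longrightarrow> follows z b \<Longrightarrow> walking d z b 0 (p @ [z])"
proof -
  have w: "d \<in> {0..<n}" "n \<le> f d" "route (f d) p" "x = last (f d # p)" "t \<in> {0..<n}" "nx (x * n + t) \<noteq> 0"
    and cov: "\<And>e. leads d e \<Longrightarrow> e \<in> set p \<or> leads t e"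
    using assms by (auto simp: walking_def)
  have "x \<in> {0..<V}"
  proof (cases "p = []")
    case True
    then show ?thesis using w(4) f_column[OF w(1)] by simp
  next
    case False
    then have "x \<in> set p" using w(4) by simp
    then show ?thesis using w(3) n_le_V by (auto simp: route_def)
  qed
  from nx_hop[OF this w(5,6)] obtain z' where
    "z' \<in> {0..<n}" "nx (x * n + t) = z' + 1" "E x z'" "z' = t \<or> nx (z' * n + t) \<noteq> 0"
    by blast
  moreover from this have "z' = z" by (simp add: z_def)
  ultimately have z: "z \<in> {0..<n}" "E x z" "z = t \<or> nx (z * n + t) \<noteq> 0"
    by simp_all
  have r: "route (f d) (p @ [z])"
    using route_snoc[OF w(3) z(1)] z(2) w(4) by blast
  have from_t: "e = t \<or> (\<exists>b. follows t b \<and> leads b e)" if "leads t e" for e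
    using that by (rule converse_rtranclpE) auto
  have cov': "e \<in> set (p @ [z]) \<or> leads t e" if "leads d e" for e
    using cov[OF that] by auto
  show "walking d z t 0 (p @ [z])" if "z \<noteq> t"
    unfolding walking_def using that w(1,2,5) z r cov' by simp
  show "walking d z t' 1 (p @ [z])" if "z = t" "\<nexists>b. follows z b"
  proof -
    have "e \<in> set (p @ [z])" if "leads d e" for e
      using cov'[OF that] from_t[of e] \<open>z = t\<close> \<open>\<nexists>b. follows z b\<close> by auto
    then show ?thesis
      unfolding walking_def using w(1,2) r by simp
  qed
  show "walking d z b 0 (p @ [z])" if "z = t" "follows z b"
  proof -
    \<comment> \<open>The capacity 1 of a demand makes the continuation of the chain unique, so no
      branch of it is lost by following \<open>b\<close>.\<close>
    have unique: "b' = b" if "follows z b'" for b'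
      using f_inject[of b' b] that \<open>follows z b\<close> z(1) unfolding follows_def by simp
    have "e \<in> set (p @ [z]) \<or> leads b e" if "leads d e" for e
      using cov'[OF that] from_t[of e] unique \<open>z = t\<close> by auto
    then show ?thesis
      unfolding walking_def using w(1,2) r follows_hop[OF that(2)] by simp
  qed
qed

definition plan_data :: "memory \<Rightarrow> bool" where
  "plan_data m \<longleftrightarrow> m ''D'' 0 = n \<and> m ''V'' 0 = V \<and> V \<le> m ''input_length'' 0 \<and>
     (\<forall>v\<in>{0..<V}. m ''oD'' v = v * n) \<and> m ''f'' = f \<and> m ''nx'' = nx \<and> m ''ty'' = ty \<and> m ''lo'' = lo"

lemma plan_data_cong:
  assumes "plan_data m"
    "\<And>a. a \<in> {''D'', ''V'', ''input_length'', ''oD'', ''f'', ''nx'', ''ty'', ''lo''} \<Longrightarrow> m' a = m a"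
  shows "plan_data m'"
  using assms(1) by (simp add: plan_data_def assms(2))

definition linked :: "(int \<Rightarrow> int) \<Rightarrow> bool" where
  "linked s \<longleftrightarrow> (\<forall>v. s v = 0 \<and> (\<nexists>b. follows v b) \<or> s v \<noteq> 0 \<and> follows v (s v - 1))"

lemma links_spec:
  assumes "plan_data m" "\<And>v. m ''su'' v = 0"
  shows "linked (den links m ''su'')"
proof -
  let ?J = "\<lambda>i m'. \<forall>v. m' ''su'' v = 0 \<and> (\<nexists>b. follows v b \<and> b < i) \<or>
    m' ''su'' v \<noteq> 0 \<and> follows v (m' ''su'' v - 1)"
  have "?J n (den links m)"
    unfolding links_def
  proof (rule Upto_rule[where B = n and J = ?J], goal_cases)
    case (5 i m' k)
    have "m' ''f'' = f"
      using 5(5)[of "''f''"] assms by (simp add: plan_data_def link_def)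
    then have su: "den link m' ''su'' = (if f i = i then m' ''su'' else (m' ''su'')(f i := i + 1))"
      using 5(4) by (simp add: link_def)
    have new: "follows v b \<and> b < i + 1 \<longleftrightarrow> follows v b \<and> b < i \<or> b = i \<and> f i = v \<and> v \<noteq> i" for v b
      using 5(1,2) by (auto simp: follows_def order_le_less)
    have "den link m' ''su'' v = 0 \<and> (\<nexists>b. follows v b \<and> b < i + 1) \<or>
      den link m' ''su'' v \<noteq> 0 \<and> follows v (den link m' ''su'' v - 1)" for v
    proof (cases "f i = v \<and> v \<noteq> i")
      case True
      then have "den link m' ''su'' v = i + 1" "follows v i"
        using 5(1,2) unfolding su by (auto simp: follows_def)
      then show ?thesis using 5(1) by simp
    next
      case False
      then have "den link m' ''su'' v = m' ''su'' v"
        unfolding su by auto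
      moreover have "(\<nexists>b. follows v b \<and> b < i + 1) \<longleftrightarrow> (\<nexists>b. follows v b \<and> b < i)"
        unfolding new using False by auto
      ultimately show ?thesis using 5(3) by simp
    qed
    then show ?case by simp
  qed (use assms n_le_V n_pos in \<open>auto simp: plan_data_def follows_def\<close>)
  then show ?thesis
    by (auto simp: linked_def follows_def)
qed

definition ent :: "int \<times> int \<times> int list \<Rightarrow> int list" where
  "ent = (\<lambda>(v, k, p). [ty v, lo v, k, int (length p)] @ p)"

lemma step_spec:
  assumes dat: "plan_data m" "linked (m ''su'')"
    and w: "walking d (m ''x'' 0) (m ''t'' 0) (m ''fin'' 0) p" "m ''fin'' 0 = 0" "written m L"
  shows "\<exists>z. walking d (den step m ''x'' 0) (den step m ''t'' 0) (den step m ''fin'' 0) (p @ [z]) \<and>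
    written (den step m) (L @ [z])"
proof -
  define x t where "x = m ''x'' 0" and "t = m ''t'' 0"
  define z where "z = nx (x * n + t) - 1"
  have w0: "walking d x t 0 p" using w by (simp add: x_def t_def)
  have x: "x \<in> {0..<V}"
    using w0 f_column[of d] n_le_V
    by (cases p rule: rev_cases) (auto simp: walking_def route_def)
  have val: "aval m (Sub (entry ''nx'' ''x'' ''t'') (Const 1)) = z"
    using dat x by (simp add: entry_def plan_data_def z_def x_def t_def)
  define m1 where "m1 = den (''x'' ::= Sub (entry ''nx'' ''x'' ''t'') (Const 1)) m"
  define m2 where "m2 = den (push (Var ''x'')) m1"
  have m1: "m1 = m(''x'' := (m ''x'')(0 := z))"
    unfolding m1_def den.simps val by simp
  have "written m1 L" using w by (simp add: m1 written_upd)
  from written_push[OF this, of "Var ''x''"] have wr: "written m2 (L @ [z])"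
    unfolding m2_def by (simp add: m1)
  have m2: "m2 ''x'' 0 = z" "m2 ''t'' 0 = t" "m2 ''su'' = m ''su''" "m2 ''fin'' 0 = 0"
    using w by (auto simp: m2_def m1 push_def t_def)
  have st: "den step m = den arrive m2"
    by (simp only: step_def den.simps(3) m1_def m2_def)
  have li: "m ''su'' z = 0 \<and> (\<nexists>b. follows z b) \<or> m ''su'' z \<noteq> 0 \<and> follows z (m ''su'' z - 1)"
    using dat by (simp add: linked_def)
  have "walking d (den step m ''x'' 0) (den step m ''t'' 0) (den step m ''fin'' 0) (p @ [z])"
  proof (cases "z = t")
    case True
    show ?thesis
    proof (cases "m ''su'' z = 0")
      case su: True
      then have "walking d z t 1 (p @ [z])"
        using walking_step(2)[OF w0] li True by (simp add: z_def[symmetric])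
      with True su show ?thesis unfolding st by (simp add: arrive_def m2)
    next
      case su: False
      then have "walking d z (m ''su'' z - 1) 0 (p @ [z])"
        using walking_step(3)[OF w0] li True by (simp add: z_def[symmetric])
      with True su show ?thesis unfolding st by (simp add: arrive_def m2)
    qed
  next
    case False
    then have "walking d z t 0 (p @ [z])"
      using walking_step(1)[OF w0] by (simp add: z_def[symmetric])
    with False show ?thesis unfolding st by (simp add: arrive_def m2)
  qed
  moreover have "written (den step m) (L @ [z])"
    using wr unfolding st by (simp add: arrive_def written_upd)
  ultimately show ?thesis by blast
qed

lemma emit_path_spec:
  assumes dat: "plan_data m" "linked (m ''su'')" and d: "m ''d'' 0 = d" "d \<in> {0..<n}" "n \<le> f d"
    and L: "written m L"
  shows "\<exists>p. route (f d) p \<and> (\<forall>e. leads d e \<longrightarrow> e \<in> set p) \<and>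
      written (den emit_path m) (L @ ent (f d, m ''cnt'' (f d), p))"
    and "den emit_path m ''cnt'' = (m ''cnt'')(f d := m ''cnt'' (f d) + 1)"
proof -
  define v where "v = f d"
  let ?head = "''v'' ::= Read ''f'' (Var ''d'') ;; ''q'' ::= Add (Var ''output_length'') (Const 3)"
  let ?tail = "Put ''cnt'' (Var ''v'') (Add (Read ''cnt'' (Var ''v'')) (Const 1)) ;;
    ''x'' ::= Var ''v'' ;; ''t'' ::= Var ''d'' ;; ''fin'' ::= Const 0"
  let ?walk = "Branch (Equal (Var ''fin'') (Const 0)) step Nop"
  let ?patch = "Put ''output'' (Var ''q'') (Sub (Sub (Var ''output_length'') (Var ''q'')) (Const 1))"
  define m0 where "m0 = den ?head m"
  define m1 where "m1 = den (push (Read ''ty'' (Var ''v''))) m0"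
  define m2 where "m2 = den (push (Read ''lo'' (Var ''v''))) m1"
  define m3 where "m3 = den (push (Read ''cnt'' (Var ''v''))) m2"
  define m4 where "m4 = den (push (Const 0)) m3"
  define m5 where "m5 = den ?tail m4"
  define m6 where "m6 = den (Upto ''k'' ''V'' ?walk) m5"
  have full: "den emit_path m = den ?patch m6"
    by (simp only: emit_path_def den.simps(3) m6_def m5_def m4_def m3_def m2_def m1_def m0_def)
  have fd: "m ''f'' = f" using dat by (simp add: plan_data_def)
  define H where "H = L @ [ty v, lo v, m ''cnt'' v, 0]"
  have fr: "m4 a = m0 a" "m3 a = m0 a" "m2 a = m0 a" "m1 a = m0 a"
    if "a \<noteq> ''output''" "a \<noteq> ''output_length''" for a
    using that by (simp_all add: m4_def m3_def m2_def m1_def push_def)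
  have m0: "m0 ''v'' 0 = v" "m0 ''q'' 0 = int (length L) + 3"
    "\<And>a. a \<noteq> ''v'' \<Longrightarrow> a \<noteq> ''q'' \<Longrightarrow> m0 a = m a"
    using d L by (auto simp: m0_def fd v_def written_def)
  have "written m0 L" using L by (rule written_cong) (auto simp: m0)
  then have "written m1 (L @ [ty v])"
    using dat written_push[of m0 L "Read ''ty'' (Var ''v'')"] by (simp add: m1_def[symmetric] m0 plan_data_def)
  then have "written m2 (L @ [ty v, lo v])"
    using dat written_push[of m1 _ "Read ''lo'' (Var ''v'')"]
    by (fastforce simp: m2_def[symmetric] m0 fr plan_data_def)
  then have "written m3 (L @ [ty v, lo v, m ''cnt'' v])"
    using dat written_push[of m2 _ "Read ''cnt'' (Var ''v'')"]
    by (fastforce simp: m3_def[symmetric] m0 fr plan_data_def)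
  then have "written m4 H"
    using written_push[of m3 _ "Const 0"] by (fastforce simp: m4_def[symmetric] H_def)
  then have H5: "written m5 H" by (simp add: m5_def written_upd)
  have m5: "m5 ''x'' 0 = v" "m5 ''t'' 0 = d" "m5 ''fin'' 0 = 0"
    "m5 ''cnt'' = (m ''cnt'')(v := m ''cnt'' v + 1)" "m5 ''q'' 0 = int (length L) + 3"
    "\<And>a. a \<notin> {''x'', ''t'', ''fin'', ''cnt'', ''v'', ''q'', ''output'', ''output_length''} \<Longrightarrow> m5 a = m a"
    using d by (auto simp: m5_def fr m0)
  have dat5: "plan_data m5"
    using dat(1) by (rule plan_data_cong) (rule m5(6); auto)
  have fr6: "m6 a = m5 a" if "a \<notin> insert ''k'' (writes step)" for a
    unfolding m6_def using that by (intro den_frame) auto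
  define J where "J = (\<lambda>k m'. \<exists>p. walking d (m' ''x'' 0) (m' ''t'' 0) (m' ''fin'' 0) p \<and> written m' (H @ p) \<and>
    (m' ''fin'' 0 = 0 \<longrightarrow> int (length p) = k))"
  have "\<exists>p. walking d (m6 ''x'' 0) (m6 ''t'' 0) 1 p \<and> written m6 (H @ p)"
    unfolding m6_def
  proof (rule Upto_rule[where B = V and J = J])
    show "0 \<le> V" "m5 ''V'' 0 = V" "V \<le> m5 ''input_length'' 0"
      using dat5 n_pos n_le_V by (auto simp: plan_data_def)
    show "J 0 (m5(''k'' := k))" for k
      unfolding J_def using walking_start[OF d(2,3)] H5
      by (intro exI[of _ "[]"]) (simp add: m5 written_upd v_def)
  next
    fix k m' kk
    assume k: "0 \<le> k" "k < V" "J k m'"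
      and fr': "\<And>a. a \<notin> writes ?walk \<Longrightarrow> a \<noteq> ''k'' \<Longrightarrow> m' a = m5 a"
    obtain p where p: "walking d (m' ''x'' 0) (m' ''t'' 0) (m' ''fin'' 0) p" "written m' (H @ p)"
      "m' ''fin'' 0 = 0 \<longrightarrow> int (length p) = k"
      using k by (auto simp: J_def)
    have "J (k + 1) (den ?walk m')"
    proof (cases "m' ''fin'' 0 = 0")
      case True
      have "plan_data m'"
        using dat5 by (rule plan_data_cong) (rule fr'; auto simp: emit_defs)
      moreover have "linked (m' ''su'')"
        using dat(2) fr'[of "''su''"] m5(6)[of "''su''"] by (simp add: emit_defs)
      ultimately obtain z where "walking d (den step m' ''x'' 0) (den step m' ''t'' 0) (den step m' ''fin'' 0) (p @ [z])"
        "written (den step m') ((H @ p) @ [z])"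
        using step_spec p True by blast
      then show ?thesis
        using True p(3) by (auto simp: J_def intro!: exI[of _ "p @ [z]"])
    next
      case False
      then show ?thesis using p by (auto simp: J_def)
    qed
    then show "J (k + 1) ((den ?walk m')(''k'' := kk))"
      by (simp add: J_def written_upd)
  next
    fix m' assume "J V m'"
    then obtain p where p: "walking d (m' ''x'' 0) (m' ''t'' 0) (m' ''fin'' 0) p" "written m' (H @ p)"
      "m' ''fin'' 0 = 0 \<longrightarrow> int (length p) = V"
      by (auto simp: J_def)
    \<comment> \<open>The starting location is a column beyond the demands. A walk unfinished after
      \<open>V\<close> rounds would have visited \<open>V\<close> distinct demands, more than there
      are.\<close>
    have "n < V" using d f_column[OF d(2)] by simp
    then have "m' ''fin'' 0 \<noteq> 0"
      using p route_distinct(2)[of "f d" p] by (auto simp: walking_def)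
    then show "\<exists>p. walking d (m' ''x'' 0) (m' ''t'' 0) 1 p \<and> written m' (H @ p)"
      using p by (auto simp: walking_def)
  qed
  then obtain p where p: "walking d (m6 ''x'' 0) (m6 ''t'' 0) 1 p" "written m6 (H @ p)"
    by blast
  \<comment> \<open>Type, location and index take three cells; the next one was reserved for the
    length.\<close>
  have "m6 ''q'' 0 = int (length L) + 3"
    using fr6[of "''q''"] m5 by (simp add: emit_defs)
  then have val: "den ?patch m6 = m6(''output'' := (m6 ''output'')(int (length L + 3) := int (length p)))"
    using p(2) by (simp add: written_def H_def add.commute)
  have "written (den ?patch m6) ((H @ p)[length L + 3 := int (length p)])"
    unfolding val using p(2) by (auto simp: written_def nth_list_update)
  also have "(H @ p)[length L + 3 := int (length p)] = L @ ent (v, m ''cnt'' v, p)"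
    by (simp add: H_def ent_def list_update_append numeral_3_eq_3)
  finally have "written (den emit_path m) (L @ ent (f d, m ''cnt'' (f d), p))"
    unfolding full v_def .
  then show "\<exists>p. route (f d) p \<and> (\<forall>e. leads d e \<longrightarrow> e \<in> set p) \<and>
      written (den emit_path m) (L @ ent (f d, m ''cnt'' (f d), p))"
    using p(1) by (intro exI[of _ p] conjI) (simp_all add: walking_def)
  show "den emit_path m ''cnt'' = (m ''cnt'')(f d := m ''cnt'' (f d) + 1)"
    using fr6[of "''cnt''"] m5(4) unfolding full by (simp add: emit_defs v_def)
qed

text \<open>An index below the load so far makes the next index, the load itself, fresh. As loads
  respect capacities, it also guarantees in the end that the resource exists.\<close>

definition listing :: "int \<Rightarrow> (int \<times> int \<times> int list) list \<Rightarrow> bool" where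
  "listing d es \<longleftrightarrow> int (length es) \<le> d \<and> distinct (map (\<lambda>(v, k, p). (v, k)) es) \<and>
     (\<forall>(v, k, p)\<in>set es. v \<in> {n..<V} \<and> k \<in> {0..<load d f v} \<and> route v p) \<and>
     (\<forall>d'\<in>{0..<d}. n \<le> f d' \<longrightarrow> (\<exists>(v, k, p)\<in>set es. \<forall>e. leads d' e \<longrightarrow> e \<in> set p))"

lemma listing_skip:
  assumes "listing d es" "0 \<le> d" "f d < n"
  shows "listing (d + 1) es"
  using assms interval_Suc[OF assms(2)]
  by (fastforce simp: listing_def load_Suc)

lemma listing_add:
  assumes l: "listing d es" and d: "d \<in> {0..<n}" "n \<le> f d"
    and p: "route (f d) p" "\<forall>e. leads d e \<longrightarrow> e \<in> set p"
  shows "listing (d + 1) (es @ [(f d, load d f (f d), p)])"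
proof -
  have d0: "0 \<le> d" using d by simp
  have "(f d, load d f (f d)) \<notin> (\<lambda>(v, k, p). (v, k)) ` set es"
    using l by (auto simp: listing_def)
  moreover have "load d f v \<le> load (d + 1) f v" for v
    by (simp add: load_Suc[OF d0])
  then have "k \<in> {0..<load (d + 1) f v}" if "k \<in> {0..<load d f v}" for k v
    using that by (meson atLeastLessThan_iff less_le_trans)
  moreover have "load d f (f d) \<in> {0..<load (d + 1) f (f d)}"
    by (simp add: load_Suc[OF d0] load_nonneg)
  ultimately show ?thesis
    using l d p f_column[OF d(1)] unfolding listing_def interval_Suc[OF d0]
    by (auto simp: split_def)
qed

lemma emit_spec:
  assumes dat: "plan_data m" "linked (m ''su'')" and "m ''output_length'' 0 = 0" "\<And>v. m ''cnt'' v = 0"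
  obtains es where "listing n es" "output_of (den emit m) = concat (map ent es)"
proof -
  let ?b = "Branch (Less (Read ''f'' (Var ''d'')) (Var ''D'')) Nop emit_path"
  define J where "J = (\<lambda>d m'. (\<exists>es. listing d es \<and> written m' (concat (map ent es))) \<and>
    (\<forall>v. n \<le> v \<longrightarrow> m' ''cnt'' v = load d f v))"
  have upd: "J d (m'(''d'' := k)) \<longleftrightarrow> J d m'" for d m' k
    by (simp add: J_def written_upd)
  have "\<exists>es. listing n es \<and> output_of (den emit m) = concat (map ent es)"
    unfolding emit_def
  proof (rule Upto_rule[where B = n and J = J])
    show "0 \<le> n" "m ''D'' 0 = n" "n \<le> m ''input_length'' 0"
      using dat n_pos n_le_V by (auto simp: plan_data_def)
    have "J 0 m"
      using assms by (auto simp: J_def listing_def written_def load_def intro!: exI[of _ "[]"])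
    then show "J 0 (m(''d'' := k))" for k by (simp add: upd)
  next
    fix d m' k
    assume d: "0 \<le> d" "d < n" "J d m'" "m' ''d'' 0 = d"
      and fr: "\<And>a. a \<notin> writes ?b \<Longrightarrow> a \<noteq> ''d'' \<Longrightarrow> m' a = m a"
    have dat': "plan_data m'"
      using dat(1) by (rule plan_data_cong) (rule fr; auto simp: emit_defs)
    have li: "linked (m' ''su'')"
      using dat(2) fr[of "''su''"] by (simp add: emit_defs)
    obtain es where es: "listing d es" "written m' (concat (map ent es))"
      and cnt: "\<And>v. n \<le> v \<Longrightarrow> m' ''cnt'' v = load d f v"
      using d by (auto simp: J_def)
    have test: "bval m' (Less (Read ''f'' (Var ''d'')) (Var ''D'')) \<longleftrightarrow> f d < n"
      using dat' d by (simp add: plan_data_def)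
    have "J (d + 1) (den ?b m')"
    proof (cases "f d < n")
      case True
      then have "\<forall>v. n \<le> v \<longrightarrow> m' ''cnt'' v = load (d + 1) f v"
        using cnt d by (auto simp: load_Suc)
      then show ?thesis
        using True listing_skip[OF es(1) d(1) True] es test by (auto simp: J_def)
    next
      case False
      have dn: "d \<in> {0..<n}" "n \<le> f d" using d False by auto
      note ep = emit_path_spec[OF dat' li d(4) dn es(2)]
      obtain p where p: "route (f d) p" "\<forall>e. leads d e \<longrightarrow> e \<in> set p"
        "written (den emit_path m') (concat (map ent es) @ ent (f d, load d f (f d), p))"
        using ep(1) cnt[OF dn(2)] by auto
      have "\<forall>v. n \<le> v \<longrightarrow> den emit_path m' ''cnt'' v = load (d + 1) f v"
        using cnt d unfolding ep(2) by (auto simp: load_Suc)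
      moreover have "written (den emit_path m') (concat (map ent (es @ [(f d, load d f (f d), p)])))"
        using p(3) by simp
      ultimately have "J (d + 1) (den emit_path m')"
        using listing_add[OF es(1) dn p(1,2)] unfolding J_def by blast
      then show ?thesis using False test by simp
    qed
    then show "J (d + 1) ((den ?b m')(''d'' := k))" by (simp add: upd)
  next
    fix m' assume "J n m'"
    then show "\<exists>es. listing n es \<and> output_of m' = concat (map ent es)"
      by (auto simp: J_def dest: written_output_of)
  qed
  with that show thesis by blast
qed

text \<open>A demand that is not given up lies on the chain of some head, and the entry of the head
  contains the whole chain.\<close>

lemma listing_covers:
  assumes "listing n es" "d \<in> {0..<n}" "f d \<noteq> d"
  shows "\<exists>(v, k, p)\<in>set es. d \<in> set p"
proof -
  obtain d0 where d0: "d0 \<in> {0..<n}" "n \<le> f d0" "leads d0 d"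
    using chain_start[OF assms(2,3)] by blast
  then obtain e where "e \<in> set es" "case e of (v, k, p) \<Rightarrow> \<forall>d. leads d0 d \<longrightarrow> d \<in> set p"
    using assms(1) unfolding listing_def by blast
  then show ?thesis using d0(3) by (intro bexI[of _ e]) auto
qed

end

section \<open>Reading the instance\<close>

lemma length_blocks:
  "(\<And>i. i < n \<Longrightarrow> length (g i) = k) \<Longrightarrow> length (concat (map g [0..<n])) = n * k"
  by (induction n) auto

lemma nth_blocks:
  assumes "\<And>i. i < n \<Longrightarrow> length (g i) = k" "i < n" "j < k"
  shows "concat (map g [0..<n]) ! (i * k + j) = g i ! j"
  using assms
proof (induction n)
  case (Suc n)
  have len: "length (concat (map g [0..<n])) = n * k"
    using Suc.prems by (intro length_blocks) auto
  show ?case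
  proof (cases "i < n")
    case True
    have "i * k + j < i * k + k" using Suc.prems by simp
    also have "\<dots> = Suc i * k" by simp
    also have "\<dots> \<le> n * k" using True by (intro mult_le_mono1) auto
    finally show ?thesis
      using Suc True len by (simp add: nth_append)
  next
    case False
    then have "i = n" using Suc.prems by simp
    then show ?thesis using len by (simp add: nth_append)
  qed
qed simp

lemma nth_inner: "k < length ys \<Longrightarrow> (xs @ ys @ zs) ! (length xs + k) = ys ! k"
  by (simp add: nth_append)

definition index_entry :: prog where
  "index_entry =
    Put ''oD'' (Add (Var ''i'') (Const 1)) (Add (Read ''oD'' (Var ''i'')) (Var ''D'')) ;;
    Put ''oT'' (Add (Var ''i'') (Const 1)) (Add (Read ''oT'' (Var ''i'')) (Var ''T'')) ;;
    Put ''oL'' (Add (Var ''i'') (Const 1)) (Add (Read ''oL'' (Var ''i'')) (Var ''L''))"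

text \<open>Products are read off tables of multiples built by repeated addition. \<open>bR\<close>,
  \<open>bS\<close>, \<open>bF\<close> and \<open>bG\<close> are the addresses in the input at which
  the required types, the numbers of the demands, the travel times between demands and those from
  starting locations begin; the leading 3 skips the header.\<close>

definition index_tables :: prog where
  "index_tables =
    Upto ''i'' ''input_length'' index_entry ;;
    ''V'' ::= Add (Var ''D'') (Read ''oL'' (Var ''T'')) ;;
    ''bR'' ::= Add (Const 3) (Add (Read ''oL'' (Var ''T'')) (Read ''oL'' (Var ''T''))) ;;
    ''bS'' ::= Add (Var ''bR'') (Read ''oT'' (Var ''D'')) ;;
    ''bF'' ::= Add (Var ''bS'') (Add (Var ''D'') (Add (Var ''D'') (Var ''D''))) ;;
    ''bG'' ::= Add (Var ''bF'') (Read ''oD'' (Var ''D''))"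

definition demand_types :: prog where
  "demand_types =
    Upto ''d'' ''D'' (Upto ''r'' ''T''
      (Branch (Equal (Read ''input'' (Add (Var ''bR'') (Add (Read ''oT'' (Var ''d'')) (Var ''r'')))) (Const 1))
         (Put ''ty'' (Var ''d'') (Var ''r'')) Nop))"

definition demand_data :: prog where
  "demand_data =
    Upto ''d'' ''D''
      (''x'' ::= Add (Var ''bS'') (Add (Var ''d'') (Add (Var ''d'') (Var ''d''))) ;;
       Put ''tau'' (Var ''d'') (Read ''input'' (Var ''x'')) ;;
       Put ''rd'' (Var ''d'') (Add (Read ''input'' (Var ''x'')) (Read ''input'' (Add (Var ''x'') (Const 1)))) ;;
       Put ''w'' (Var ''d'') (Read ''input'' (Add (Var ''x'') (Const 2))) ;;
       Put ''ad'' (Var ''d'') (Add (Var ''bF'') (Read ''oD'' (Var ''d''))) ;;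
       Put ''cap'' (Var ''d'') (Const 1))"

text \<open>The pair number \<open>x\<close> in the table of amounts begins at address
  \<open>3 + 2x\<close>, its second component is at \<open>4 + 2x\<close>. That component is 0 where
  the location is no start of this type, so such a pair needs no case distinction: it becomes a
  column without capacity.\<close>

definition start_entry :: prog where
  "start_entry =
    ''x'' ::= Add (Read ''oL'' (Var ''r'')) (Var ''s'') ;;
    ''v'' ::= Add (Var ''D'') (Var ''x'') ;;
    Put ''ty'' (Var ''v'') (Var ''r'') ;;
    Put ''lo'' (Var ''v'') (Var ''s'') ;;
    Put ''rd'' (Var ''v'') (Const 0) ;;
    Put ''ad'' (Var ''v'') (Add (Var ''bG'') (Read ''oD'' (Var ''s''))) ;;
    Put ''cap'' (Var ''v'') (Read ''input'' (Add (Const 4) (Add (Var ''x'') (Var ''x''))))"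

definition start_data :: prog where
  "start_data = Upto ''r'' ''T'' (Upto ''s'' ''L'' start_entry)"

definition edge_entry :: prog where
  "edge_entry =
    Branch (Conj (Equal (Read ''ty'' (Var ''v'')) (Read ''ty'' (Var ''j'')))
        (Neg (Less (Read ''tau'' (Var ''j''))
          (Add (Read ''rd'' (Var ''v'')) (Read ''input'' (Add (Read ''ad'' (Var ''v'')) (Var ''j'')))))))
      (Put ''e'' (Add (Read ''oD'' (Var ''v'')) (Var ''j'')) (Const 1))
      (Put ''e'' (Add (Read ''oD'' (Var ''v'')) (Var ''j'')) (Const 0))"

definition edge_table :: prog where
  "edge_table = Upto ''v'' ''V'' (Upto ''j'' ''D'' edge_entry)"

text \<open>
  \<open>rd\<close> is the time at which a resource is ready to leave a node, and \<open>ad\<close> the address of the travel times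
  from there; so demands and starting locations can be treated alike by \<open>edge_entry\<close>.
\<close>

definition prepare :: prog where
  "prepare = index_tables ;; demand_types ;; demand_data ;; start_data ;; edge_table"

lemmas prepare_defs = index_entry_def start_entry_def edge_entry_def index_tables_def demand_types_def demand_data_def start_data_def edge_table_def
  prepare_def

section \<open>Correctness of the decoding\<close>

locale single_type =
  fixes I :: mrmd
  assumes mR1D: "I \<in> mR1D" and demands: "0 < num_demands I"
begin

abbreviation "D \<equiv> num_demands I"
abbreviation "T \<equiv> num_types I"
abbreviation "L \<equiv> num_locs I"

definition rt :: "nat \<Rightarrow> nat" where
  "rt d = the_elem (required I d)"

lemma required: "d < D \<Longrightarrow> required I d = {rt d}"
  using mR1D unfolding mR1D_def rt_def by (auto simp: card_1_singleton_iff)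

lemma rt_less: "d < D \<Longrightarrow> rt d < T"
  using mR1D required[of d] by (auto simp: mR1D_def mRmD_def)

definition capacity :: "nat \<Rightarrow> nat \<Rightarrow> nat" where
  "capacity r s = (if s \<in> starts I r then amount I r s else 0)"

abbreviation "enc \<equiv> encode_instance I"

definition "part1 = concat (map (\<lambda>r. concat (map (\<lambda>s.
         if s \<in> starts I r then [1, int (amount I r s)] else [0, 0]) [0..<L])) [0..<T])"
definition "part2 = concat (map (\<lambda>d. map (\<lambda>r. of_bool (r \<in> required I d) :: int) [0..<T]) [0..<D])"
definition "part3 = concat (map (\<lambda>d. map int [start_time I d, duration I d, reward I d]) [0..<D])"
definition "part4 = concat (map (\<lambda>i. map (\<lambda>j. int (travel I i j)) [0..<D]) [0..<D])"
definition "part5 = concat (map (\<lambda>s. map (\<lambda>d. int (travel_from I s d)) [0..<D]) [0..<L])"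

lemma enc_parts: "enc = [int D, int T, int L] @ part1 @ part2 @ part3 @ part4 @ part5"
  by (simp add: encode_instance_def part1_def part2_def part3_def part4_def part5_def)

lemma length_parts:
  "length part1 = T * (L * 2)" "length part2 = D * T" "length part3 = D * 3"
  "length part4 = D * D" "length part5 = L * D"
  unfolding part1_def part2_def part3_def part4_def part5_def
  by (auto intro!: length_blocks)

lemma length_enc: "length enc = 3 + T * (L * 2) + D * T + D * 3 + D * D + L * D"
  by (simp add: enc_parts length_parts)

lemma enc_amount:
  assumes "r < T" "s < L"
  shows "enc ! (3 + (r * (L * 2) + (s * 2 + 1))) = int (capacity r s)"
proof -
  let ?h = "\<lambda>s. if s \<in> starts I r then [1, int (amount I r s)] else [0, 0]"
  have len: "length (concat (map (\<lambda>s. if s \<in> starts I r then [1, int (amount I r s)] else [0, 0]) [0..<L])) = L * 2" for r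
    by (rule length_blocks) auto
  have "s * 2 + 1 < L * 2" using assms by simp
  then have "part1 ! (r * (L * 2) + (s * 2 + 1)) = concat (map ?h [0..<L]) ! (s * 2 + 1)"
    unfolding part1_def using assms len by (subst nth_blocks[where k = "L * 2"]) auto
  also have "\<dots> = ?h s ! 1"
    using assms by (subst nth_blocks[where k = 2]) auto
  also have "\<dots> = int (capacity r s)" by (simp add: capacity_def)
  finally have p: "part1 ! (r * (L * 2) + (s * 2 + 1)) = int (capacity r s)" .
  have "r * (L * 2) + (s * 2 + 1) < r * (L * 2) + L * 2" using assms by simp
  also have "\<dots> = Suc r * (L * 2)" by simp
  also have "\<dots> \<le> T * (L * 2)" using assms by (intro mult_le_mono1) auto
  finally show ?thesis
    using nth_inner[of "r * (L * 2) + (s * 2 + 1)" part1 "[int D, int T, int L]"] p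
    by (simp add: enc_parts length_parts)
qed

lemma block_index: "i < n \<Longrightarrow> j < k \<Longrightarrow> i * k + j < n * (k :: nat)"
proof -
  assume "i < n" "j < k"
  then have "i * k + j < Suc i * k" by simp
  also have "\<dots> \<le> n * k" using \<open>i < n\<close> by (intro mult_le_mono1) auto
  finally show ?thesis .
qed

lemma enc_required:
  assumes "d < D" "r < T"
  shows "enc ! (3 + T * (L * 2) + (d * T + r)) = of_bool (r = rt d)"
proof -
  have "part2 ! (d * T + r) = of_bool (r = rt d)"
    unfolding part2_def using assms by (subst nth_blocks[where k = T]) (auto simp: required)
  then show ?thesis
    using nth_inner[of "d * T + r" part2 "[int D, int T, int L] @ part1"] block_index[OF assms]
    by (simp add: enc_parts length_parts)
qed

lemma enc_data:
  assumes "d < D" "i < 3"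
  shows "enc ! (3 + T * (L * 2) + D * T + (d * 3 + i)) = int ([start_time I d, duration I d, reward I d] ! i)"
proof -
  have "part3 ! (d * 3 + i) = int ([start_time I d, duration I d, reward I d] ! i)"
    unfolding part3_def using assms by (subst nth_blocks[where k = 3]) (auto simp: less_Suc_eq numeral_3_eq_3)
  then show ?thesis
    using nth_inner[of "d * 3 + i" part3 "[int D, int T, int L] @ part1 @ part2"] block_index[OF assms]
    by (simp add: enc_parts length_parts add.assoc)
qed

lemma enc_travel:
  assumes "i < D" "j < D"
  shows "enc ! (3 + T * (L * 2) + D * T + D * 3 + (i * D + j)) = int (travel I i j)"
proof -
  have "part4 ! (i * D + j) = int (travel I i j)"
    unfolding part4_def using assms by (subst nth_blocks[where k = D]) auto
  then show ?thesis
    using nth_inner[of "i * D + j" part4 "[int D, int T, int L] @ part1 @ part2 @ part3"] block_index[OF assms]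
    by (simp add: enc_parts length_parts add.assoc)
qed

lemma enc_travel_from:
  assumes "s < L" "j < D"
  shows "enc ! (3 + T * (L * 2) + D * T + D * 3 + D * D + (s * D + j)) = int (travel_from I s j)"
proof -
  have "part5 ! (s * D + j) = int (travel_from I s j)"
    unfolding part5_def using assms by (subst nth_blocks[where k = D]) auto
  then show ?thesis
    using nth_inner[of "s * D + j" part5 "[int D, int T, int L] @ part1 @ part2 @ part3 @ part4" "[]"]
      block_index[OF assms]
    by (simp add: enc_parts length_parts add.assoc)
qed

abbreviation "N \<equiv> length enc"

text \<open>Needed because loops are capped and tables end at the input length. For \<open>T\<close>
  and \<open>L\<close> this depends on there being a demand: without demands and locations the input
  consists of three numbers, whatever \<open>T\<close> is.\<close>

lemma bounds: "D + T * L \<le> N" "D \<le> N" "T \<le> N" "L \<le> N"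
proof -
  have "T \<le> D * T" "L \<le> L * D" using demands by auto
  moreover have "T * (L * 2) = T * L + T * L" by simp
  ultimately show "D + T * L \<le> N" "D \<le> N" "T \<le> N" "L \<le> N"
    unfolding length_enc by linarith+
qed

definition given :: "memory \<Rightarrow> bool" where
  "given m \<longleftrightarrow> (\<forall>i<N. m ''input'' (int i) = enc ! i) \<and> m ''input_length'' 0 = int N \<and>
     m ''D'' 0 = int D \<and> m ''T'' 0 = int T \<and> m ''L'' 0 = int L"

definition indexed :: "memory \<Rightarrow> bool" where
  "indexed m \<longleftrightarrow> given m \<and> m ''V'' 0 = int (D + T * L) \<and>
     m ''bR'' 0 = int (3 + T * (L * 2)) \<and> m ''bS'' 0 = int (3 + T * (L * 2) + D * T) \<and>
     m ''bF'' 0 = int (3 + T * (L * 2) + D * T + D * 3) \<and>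
     m ''bG'' 0 = int (3 + T * (L * 2) + D * T + D * 3 + D * D) \<and>
     (\<forall>i\<le>N. m ''oD'' (int i) = int (i * D) \<and> m ''oT'' (int i) = int (i * T) \<and> m ''oL'' (int i) = int (i * L))"

lemma indexed_cong:
  assumes "indexed m" "\<And>a. a \<in> {''input'', ''input_length'', ''D'', ''T'', ''L'', ''V'', ''bR'', ''bS'', ''bF'',
    ''bG'', ''oD'', ''oT'', ''oL''} \<Longrightarrow> m' a = m a"
  shows "indexed m'"
  using assms(1) by (simp add: indexed_def given_def assms(2))

lemma index_tables_spec:
  assumes g: "given m" and z: "m ''oD'' 0 = 0" "m ''oT'' 0 = 0" "m ''oL'' 0 = 0"
  shows "indexed (den index_tables m)"
proof -
  define m1 where "m1 = den (Upto ''i'' ''input_length'' index_entry) m"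
  define J where "J = (\<lambda>k m'. \<forall>i\<le>k. m' ''oD'' (int i) = int (i * D) \<and> m' ''oT'' (int i) = int (i * T) \<and>
    m' ''oL'' (int i) = int (i * L))"
  have "J N m1"
    unfolding m1_def
  proof (rule Upto_rule_nat[where B = N and J = J])
    fix k m' kk
    assume k: "k < N" "J k m'" "m' ''i'' 0 = int k"
      and fr: "\<And>a. a \<notin> writes index_entry \<Longrightarrow> a \<noteq> ''i'' \<Longrightarrow> m' a = m a"
    have "m' ''D'' 0 = int D" "m' ''T'' 0 = int T" "m' ''L'' 0 = int L"
      using g fr by (auto simp: given_def index_entry_def)
    then show "J (Suc k) ((den index_entry m')(''i'' := kk))"
      using k by (auto simp: J_def le_Suc_eq algebra_simps index_entry_def)
  qed (use g z in \<open>auto simp: given_def J_def\<close>)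
  moreover have fr1: "m1 a = m a" if "a \<notin> insert ''i'' (writes index_entry)" for a
    unfolding m1_def using that by (intro den_frame) auto
  moreover have "given m1"
    using g by (simp add: given_def fr1 index_entry_def)
  ultimately show ?thesis
    using bounds unfolding index_tables_def den.simps(3) m1_def[symmetric]
    by (simp add: indexed_def given_def J_def algebra_simps)
qed

lemma demand_types_spec:
  assumes ix: "indexed m"
  shows "\<forall>d<D. den demand_types m ''ty'' (int d) = int (rt d)"
proof -
  define \<Phi> where "\<Phi> = (\<lambda>P m'. \<forall>(d, r)\<in>P. r = rt d \<longrightarrow> m' ''ty'' (int d) = int (rt d))"
    for P :: "(nat \<times> nat) set" and m' :: memory
  have "\<Phi> ({..<D} \<times> {..<T}) (den demand_types m)"
    unfolding demand_types_def
  proof (rule Upto_Upto_rule, goal_cases)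
    case (15 d r P m')
    have "m' ''bR'' 0 + (m' ''oT'' (int d) + int r) = int (3 + T * (L * 2) + (d * T + r))"
      using ix 15(1,7) bounds by (simp add: indexed_def)
    moreover have "3 + T * (L * 2) + (d * T + r) < N"
      using block_index[OF 15(1,2)] by (simp add: length_enc)
    ultimately have "m' ''input'' (m' ''bR'' 0 + (m' ''oT'' (int d) + int r)) = of_bool (r = rt d)"
      using ix 15(7) enc_required[OF 15(1,2)] by (simp add: indexed_def given_def del: of_nat_add of_nat_mult)
    then show ?case
      using 15(4-6) by (auto simp: \<Phi>_def)
  qed (use ix bounds in \<open>auto simp: indexed_def given_def \<Phi>_def\<close>)
  then show ?thesis
    using rt_less by (auto simp: \<Phi>_def)
qed

definition demand_ready :: "nat \<Rightarrow> memory \<Rightarrow> bool" where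
  "demand_ready d m \<longleftrightarrow> m ''tau'' (int d) = int (start_time I d) \<and>
     m ''rd'' (int d) = int (start_time I d + duration I d) \<and> m ''w'' (int d) = int (reward I d) \<and>
     m ''ad'' (int d) = int (3 + T * (L * 2) + D * T + D * 3 + d * D) \<and> m ''cap'' (int d) = 1"

lemma demand_data_spec:
  assumes ix: "indexed m"
  shows "\<forall>d<D. demand_ready d (den demand_data m)"
  unfolding demand_data_def
proof (rule Upto_rule_nat[where B = D and J = "\<lambda>k m'. \<forall>d<k. demand_ready d m'"], goal_cases)
  case (4 d m' k)
  have ix': "indexed m'"
    using ix by (rule indexed_cong) (rule 4(4); auto)
  have x: "m' ''bS'' 0 + (int d + (int d + int d)) = int (3 + T * (L * 2) + D * T + (d * 3 + 0))"
    using ix' by (simp add: indexed_def)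
  have lt: "3 + T * (L * 2) + D * T + (d * 3 + i) < N" if "i < 3" for i
    using block_index[OF 4(1) that] by (simp add: length_enc)
  have inp: "m' ''input'' (m' ''bS'' 0 + (int d + (int d + int d)) + int i) =
      int ([start_time I d, duration I d, reward I d] ! i)" if "i < 3" for i
  proof -
    have "m' ''bS'' 0 + (int d + (int d + int d)) + int i = int (3 + T * (L * 2) + D * T + (d * 3 + i))"
      unfolding x by simp
    then show ?thesis
      using ix' lt[OF that] enc_data[OF 4(1) that]
      by (simp add: indexed_def given_def del: of_nat_add of_nat_mult)
  qed
  have oD: "m' ''bF'' 0 + m' ''oD'' (int d) = int (3 + T * (L * 2) + D * T + D * 3 + d * D)"
    using ix' 4(1) bounds by (simp add: indexed_def)
  show ?case
    using 4(2,3) inp[of 0] inp[of 1] inp[of 2] oD by (auto simp: demand_ready_def less_Suc_eq)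
qed (use ix bounds in \<open>auto simp: indexed_def given_def\<close>)

definition start_ready :: "nat \<Rightarrow> nat \<Rightarrow> memory \<Rightarrow> bool" where
  "start_ready r s m \<longleftrightarrow> (let v = int (D + (r * L + s)) in m ''ty'' v = int r \<and> m ''lo'' v = int s \<and>
     m ''rd'' v = 0 \<and> m ''ad'' v = int (3 + T * (L * 2) + D * T + D * 3 + D * D + s * D) \<and>
     m ''cap'' v = int (capacity r s))"

lemma start_data_spec:
  assumes ix: "indexed m" and ty: "\<forall>d<D. m ''ty'' (int d) = int (rt d)"
    and rdy: "\<forall>d<D. demand_ready d m"
  defines "m' \<equiv> den start_data m"
  shows "\<forall>d<D. m' ''ty'' (int d) = int (rt d)" "\<forall>d<D. demand_ready d m'"
    "\<forall>r<T. \<forall>s<L. start_ready r s m'"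
proof -
  define \<Phi> where "\<Phi> P m' \<longleftrightarrow> (\<forall>d<D. m' ''ty'' (int d) = int (rt d)) \<and> (\<forall>d<D. demand_ready d m') \<and>
    (\<forall>(r, s)\<in>P. start_ready r s m')" for P :: "(nat \<times> nat) set" and m' :: memory
  have "\<Phi> ({..<T} \<times> {..<L}) (den start_data m)"
    unfolding start_data_def
  proof (rule Upto_Upto_rule, goal_cases)
    case (15 r s P m1)
    have ix1: "indexed m1"
      using ix by (rule indexed_cong) (rule 15(7); auto simp: start_entry_def)
    define v where "v = int (D + (r * L + s))"
    define b where "b = den start_entry m1"
    have oL: "m1 ''oL'' (int r) = int (r * L)" "m1 ''oD'' (int s) = int (s * D)"
      using ix1 15(1,2) bounds by (auto simp: indexed_def)
    have "4 + (int (r * L) + int s + (int (r * L) + int s)) = int (3 + (r * (L * 2) + (s * 2 + 1)))"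
      by (simp add: algebra_simps)
    moreover have "3 + (r * (L * 2) + (s * 2 + 1)) < N"
      using block_index[of r T "s * 2 + 1" "L * 2"] 15(1,2) by (simp add: length_enc)
    moreover have "given m1" using ix1 by (simp add: indexed_def)
    ultimately have inp: "m1 ''input'' (4 + (int (r * L) + int s + (int (r * L) + int s))) = int (capacity r s)"
      using enc_amount[OF 15(1,2)] unfolding given_def by metis
    have vals: "b ''ty'' = (m1 ''ty'')(v := int r)" "b ''lo'' = (m1 ''lo'')(v := int s)"
      "b ''rd'' = (m1 ''rd'')(v := 0)"
      "b ''ad'' = (m1 ''ad'')(v := int (3 + T * (L * 2) + D * T + D * 3 + D * D + s * D))"
      "b ''cap'' = (m1 ''cap'')(v := int (capacity r s))" "b ''tau'' = m1 ''tau''" "b ''w'' = m1 ''w''"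
      using ix1 15(5,6) oL inp by (simp_all add: b_def start_entry_def v_def indexed_def given_def)
    have old: "int d \<noteq> v" if "d < D" for d
      using that unfolding v_def of_nat_eq_iff by simp
    have other: "int (D + (r' * L + s')) = v \<longleftrightarrow> (r', s') = (r, s)" if "(r', s') \<in> insert (r, s) P" for r' s'
    proof -
      have "s' < L" using that 15(2,3) by auto
      then have "int r' * int L + int s' = int r * int L + int s \<longleftrightarrow> int r' = int r \<and> int s' = int s"
        using 15(2) by (intro index_inject) auto
      then show ?thesis by (simp add: v_def)
    qed
    have "\<Phi> (insert (r, s) P) b"
      unfolding \<Phi>_def
    proof (intro conjI)
      show "\<forall>d<D. b ''ty'' (int d) = int (rt d)" "\<forall>d<D. demand_ready d b"
        using 15(4) old unfolding vals \<Phi>_def demand_ready_def by auto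
      show "\<forall>(r', s')\<in>insert (r, s) P. start_ready r' s' b"
      proof clarify
        fix r' s' assume p: "(r', s') \<in> insert (r, s) P"
        show "start_ready r' s' b"
        proof (cases "(r', s') = (r, s)")
          case True
          then show ?thesis
            by (simp add: start_ready_def Let_def vals v_def[symmetric] del: of_nat_add)
        next
          case False
          then have "start_ready r' s' m1" using p 15(4) by (auto simp: \<Phi>_def)
          moreover have "int (D + (r' * L + s')) \<noteq> v" using other[OF p] False by simp
          ultimately show ?thesis
            by (simp add: start_ready_def Let_def vals del: of_nat_add)
        qed
      qed
    qed
    then show ?case by (simp only: b_def)
  qed (use ix bounds ty rdy in \<open>auto simp: start_entry_def indexed_def given_def \<Phi>_def start_ready_def demand_ready_def\<close>)
  then show "\<forall>d<D. m' ''ty'' (int d) = int (rt d)" "\<forall>d<D. demand_ready d m'"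
    "\<forall>r<T. \<forall>s<L. start_ready r s m'"
    by (auto simp: \<Phi>_def m'_def)
qed

text \<open>As each demand has only one type, the type of a step between demands can be read off its
  target; the type of a first step is contained in the number of the starting node.\<close>

definition edge :: "nat \<Rightarrow> nat \<Rightarrow> bool" where
  "edge v j \<longleftrightarrow> (if v < D then can_serve_after I (rt j) v j
     else can_serve_first I ((v - D) div L) ((v - D) mod L) j)"

lemma start_node:
  assumes "D \<le> v" "v < D + T * L"
  shows "(v - D) div L < T" "(v - D) mod L < L" "D + ((v - D) div L * L + (v - D) mod L) = v"
proof -
  have "v - D < T * L" using assms by linarith
  then show "(v - D) div L < T" by (simp add: less_mult_imp_div_less)
  have "0 < L" using \<open>v - D < T * L\<close> by (cases L) auto
  then show "(v - D) mod L < L" by simp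
  show "D + ((v - D) div L * L + (v - D) mod L) = v" using assms by simp
qed

lemma edge_table_spec:
  assumes ix: "indexed m" and ty: "\<forall>d<D. m ''ty'' (int d) = int (rt d)"
    and rdy: "\<forall>d<D. demand_ready d m" and st: "\<forall>r<T. \<forall>s<L. start_ready r s m"
  shows "\<forall>v<D + T * L. \<forall>j<D. den edge_table m ''e'' (int v * int D + int j) = 1 \<longleftrightarrow> edge v j"
proof -
  define \<Phi> where "\<Phi> P m' \<longleftrightarrow> (\<forall>(v, j)\<in>P. m' ''e'' (int v * int D + int j) = 1 \<longleftrightarrow> edge v j)"
    for P :: "(nat \<times> nat) set" and m' :: memory
  have test: "m ''ty'' (int v) = m ''ty'' (int j) \<and>
      \<not> m ''tau'' (int j) < m ''rd'' (int v) + m ''input'' (m ''ad'' (int v) + int j) \<longleftrightarrow> edge v j"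
    if v: "v < D + T * L" and j: "j < D" for v j
  proof (cases "v < D")
    case True
    have "m ''ad'' (int v) + int j = int (3 + T * (L * 2) + D * T + D * 3 + (v * D + j))"
      using rdy True by (simp add: demand_ready_def)
    moreover have "3 + T * (L * 2) + D * T + D * 3 + (v * D + j) < N"
      using block_index[OF True j] by (simp add: length_enc)
    ultimately have "m ''input'' (m ''ad'' (int v) + int j) = int (travel I v j)"
      using ix enc_travel[OF True j] by (simp add: indexed_def given_def del: of_nat_add of_nat_mult)
    then show ?thesis
      using True j ty rdy
      by (auto simp: edge_def can_serve_after_def required demand_ready_def)
  next
    case False
    define r s where "r = (v - D) div L" and "s = (v - D) mod L"
    have rs: "r < T" "s < L" "D + (r * L + s) = v"
      using start_node[of v] v False by (auto simp: r_def s_def)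
    have sr: "m ''ty'' (int v) = int r" "m ''rd'' (int v) = 0"
      "m ''ad'' (int v) = int (3 + T * (L * 2) + D * T + D * 3 + D * D + s * D)"
      using st rs by (auto simp: start_ready_def Let_def simp del: of_nat_add)
    have "m ''ad'' (int v) + int j = int (3 + T * (L * 2) + D * T + D * 3 + D * D + (s * D + j))"
      using sr by simp
    moreover have "3 + T * (L * 2) + D * T + D * 3 + D * D + (s * D + j) < N"
      using block_index[OF rs(2) j] by (simp add: length_enc)
    ultimately have "m ''input'' (m ''ad'' (int v) + int j) = int (travel_from I s j)"
      using ix enc_travel_from[OF rs(2) j] by (simp add: indexed_def given_def del: of_nat_add of_nat_mult)
    then show ?thesis
      using False j ty rdy sr
      by (auto simp: edge_def can_serve_first_def required demand_ready_def r_def[symmetric] s_def[symmetric])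
  qed
  have "\<Phi> ({..<D + T * L} \<times> {..<D}) (den edge_table m)"
    unfolding edge_table_def
  proof (rule Upto_Upto_rule, goal_cases)
    case (15 v j P m1)
    have oD: "m ''oD'' (int v) = int v * int D"
      using ix 15(1) bounds by (simp add: indexed_def)
    have e: "den edge_entry m1 ''e'' = (m1 ''e'')(int v * int D + int j := of_bool (edge v j))"
      using 15(5-7) test[OF 15(1,2)] oD by (auto simp: edge_entry_def)
    have same: "int v' * int D + int j' = int v * int D + int j \<longleftrightarrow> (v', j') = (v, j)"
      if "(v', j') \<in> insert (v, j) P" for v' j'
    proof -
      have "j' < D" using that 15(2,3) by auto
      then have "int v' * int D + int j' = int v * int D + int j \<longleftrightarrow> int v' = int v \<and> int j' = int j"
        using 15(2) by (intro index_inject) auto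
      then show ?thesis by simp
    qed
    show ?case
      unfolding \<Phi>_def
    proof clarify
      fix v' j' assume p: "(v', j') \<in> insert (v, j) P"
      show "den edge_entry m1 ''e'' (int v' * int D + int j') = 1 \<longleftrightarrow> edge v' j'"
        using same[OF p] 15(4) p unfolding e fun_upd_apply \<Phi>_def by auto
    qed
  qed (use ix bounds in \<open>auto simp: edge_entry_def indexed_def given_def \<Phi>_def simp del: of_nat_add of_nat_mult\<close>)
  then show ?thesis by (auto simp: \<Phi>_def)
qed

lemma prepare_spec:
  assumes "given m" "m ''oD'' 0 = 0" "m ''oT'' 0 = 0" "m ''oL'' 0 = 0"
  defines "m' \<equiv> den prepare m"
  shows "indexed m'" "\<forall>d<D. demand_ready d m'" "\<forall>r<T. \<forall>s<L. start_ready r s m'"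
    "\<forall>v<D + T * L. \<forall>j<D. m' ''e'' (int v * int D + int j) = 1 \<longleftrightarrow> edge v j"
proof -
  define m1 where "m1 = den index_tables m"
  define m2 where "m2 = den demand_types m1"
  define m3 where "m3 = den demand_data m2"
  define m4 where "m4 = den start_data m3"
  have m': "m' = den edge_table m4"
    by (simp add: m'_def prepare_def m4_def m3_def m2_def m1_def)
  have ix1: "indexed m1"
    unfolding m1_def by (rule index_tables_spec) fact+
  have ix2: "indexed m2"
    using ix1 by (rule indexed_cong) (unfold m2_def, rule den_frame, auto simp: prepare_defs)
  have ix3: "indexed m3"
    using ix2 by (rule indexed_cong) (unfold m3_def, rule den_frame, auto simp: prepare_defs)
  have ix4: "indexed m4"
    using ix3 by (rule indexed_cong) (unfold m4_def, rule den_frame, auto simp: prepare_defs)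
  show "indexed m'"
    using ix4 by (rule indexed_cong) (unfold m', rule den_frame, auto simp: prepare_defs)
  have "\<forall>d<D. m2 ''ty'' (int d) = int (rt d)"
    unfolding m2_def using ix1 by (rule demand_types_spec)
  moreover have "m3 ''ty'' = m2 ''ty''"
    unfolding m3_def by (rule den_frame) (auto simp: prepare_defs)
  ultimately have ty3: "\<forall>d<D. m3 ''ty'' (int d) = int (rt d)" by simp
  have rdy3: "\<forall>d<D. demand_ready d m3"
    unfolding m3_def using ix2 by (rule demand_data_spec)
  note s4 = start_data_spec[OF ix3 ty3 rdy3, folded m4_def]
  have fr: "m' a = m4 a" if "a \<notin> {''v'', ''j'', ''e''}" for a
    unfolding m' using that by (intro den_frame) (auto simp: prepare_defs)
  show "\<forall>d<D. demand_ready d m'" "\<forall>r<T. \<forall>s<L. start_ready r s m'"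
    using s4 by (simp_all add: demand_ready_def start_ready_def fr)
  show "\<forall>v<D + T * L. \<forall>j<D. m' ''e'' (int v * int D + int j) = 1 \<longleftrightarrow> edge v j"
    unfolding m' by (rule edge_table_spec[OF ix4 s4])
qed

end

section \<open>Assignments and solutions\<close>

context single_type
begin

definition arc :: "int \<Rightarrow> int \<Rightarrow> bool" where
  "arc v j \<longleftrightarrow> edge (nat v) (nat j)"

definition time :: "int \<Rightarrow> int" where
  "time d = int (start_time I (nat d))"

text \<open>The nodes are the demands, followed by the pairs of a type and a location in row-major order.\<close>

definition start :: "nat \<Rightarrow> nat \<Rightarrow> nat" where
  "start r s = D + (r * L + s)"

definition nodes :: nat where
  "nodes = D + T * L"

lemma nodes_ge: "D \<le> nodes"
  by (simp add: nodes_def)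

lemma duration_pos: "d < D \<Longrightarrow> 0 < duration I d"
  using mR1D by (auto simp: mR1D_def mRmD_def)

lemma starts_less: "r < T \<Longrightarrow> s \<in> starts I r \<Longrightarrow> s < L"
  using mR1D by (auto simp: mR1D_def mRmD_def)

text \<open>Positive durations make every step between demands strictly later.\<close>

sublocale digraph "int D" "int nodes" arc time
proof
  fix x z assume "x \<in> {0..<int D}" "z \<in> {0..<int D}" "arc x z"
  then show "time x < time z"
    using duration_pos[of "nat x"] by (auto simp: arc_def edge_def can_serve_after_def time_def nat_less_iff)
qed (use demands nodes_ge in auto)

lemma start_ge: "\<not> start r s < D"
  by (simp add: start_def)

lemma start_less: "r < T \<Longrightarrow> s < L \<Longrightarrow> start r s < nodes"
  using block_index[of r T s L] by (simp add: start_def nodes_def)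

lemma start_div_mod:
  assumes "s < L"
  shows "(start r s - D) div L = r" "(start r s - D) mod L = s"
  using assms by (simp_all add: start_def)

lemma start_inject: "s < L \<Longrightarrow> s' < L \<Longrightarrow> start r s = start r' s' \<longleftrightarrow> r = r' \<and> s = s'"
  by (metis start_div_mod)

lemma edge_after:
  assumes "can_serve_after I r i j" "i < D" "j < D"
  shows "edge i j" "start_time I i < start_time I j" "rt i = r" "rt j = r"
  using assms duration_pos[of i] by (auto simp: can_serve_after_def edge_def required)

lemma path_distinct_times:
  assumes "is_path I r s p"
  shows "sorted_wrt (\<lambda>i j. start_time I i < start_time I j) p" "length p \<le> D"
proof -
  have p: "set p \<subseteq> {..<D}" "successively (can_serve_after I r) p"
    using assms by (auto simp: is_path_def)
  have "successively (\<lambda>i j. start_time I i < start_time I j) p"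
  proof (rule successively_mono[OF p(2)])
    fix i j assume "i \<in> set p" "j \<in> set p" "can_serve_after I r i j"
    then show "start_time I i < start_time I j"
      using p(1) edge_after(2) by blast
  qed
  then show sorted: "sorted_wrt (\<lambda>i j. start_time I i < start_time I j) p"
    by (subst (asm) successively_iff_sorted_wrt_strong) (auto intro: less_trans)
  then have "distinct p"
    by (induction p) auto
  then have "length p = card (set p)" by (simp add: distinct_card)
  also have "\<dots> \<le> D" using card_mono[OF _ p(1)] by simp
  finally show "length p \<le> D" .
qed

text \<open>All pairs of positions matter, not only neighbours: a resource may pass demands that are
  credited to another resource, and these are skipped in its chain.\<close>

lemma reach_along:
  assumes "successively arc q" "set (tl q) \<subseteq> {0..<int D}" "a < b" "b < length q"
  shows "reach (b - a) (q ! a) (q ! b)"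
  using assms
proof (induction q arbitrary: a b)
  case (Cons x ys)
  obtain b' where b: "b = Suc b'" using Cons.prems by (cases b) auto
  have ys: "successively arc ys" "set (tl ys) \<subseteq> {0..<int D}"
    using Cons.prems by (cases ys; auto)+
  show ?case
  proof (cases a)
    case 0
    have y0: "arc x (ys ! 0)" "ys ! 0 \<in> {0..<int D}"
      using Cons.prems b by (cases ys; auto)+
    show ?thesis
    proof (cases "b' = 0")
      case True
      then show ?thesis using y0 by (simp add: 0 b)
    next
      case False
      then have "reach (b' - 0) (ys ! 0) (ys ! b')"
        using Cons.prems b by (intro Cons.IH ys) auto
      then show ?thesis using y0 by (auto simp: 0 b)
    qed
  next
    case (Suc a')
    have "reach (b' - a') (ys ! a') (ys ! b')"
      using Cons.prems b Suc by (intro Cons.IH ys) auto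
    then show ?thesis by (simp add: b Suc)
  qed
qed simp

lemma sorted_wrt_inj_on:
  fixes h :: "'a \<Rightarrow> nat"
  shows "sorted_wrt (\<lambda>i j. h i < h j) p \<Longrightarrow> inj_on h (set p)"
  by (induction p) (auto simp: image_iff)

lemma arc_path:
  assumes "is_path I r s p" "r < T" "s < L"
  shows "successively arc (map int (start r s # p))"
proof -
  have "successively (\<lambda>i j. arc (int i) (int j)) p"
  proof (rule successively_mono)
    show "successively (can_serve_after I r) p"
      using assms(1) by (simp add: is_path_def)
    fix i j assume "i \<in> set p" "j \<in> set p" "can_serve_after I r i j"
    then show "arc (int i) (int j)"
      using assms(1) edge_after(1)[of r i j] by (auto simp: is_path_def arc_def)
  qed
  moreover have "arc (int (start r s)) (int (hd p))" if "p \<noteq> []"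
    using that assms by (simp add: is_path_def arc_def edge_def start_ge start_div_mod)
  ultimately show ?thesis
    unfolding successively_map by (cases p) auto
qed

end

section \<open>From feasible solutions to assignments\<close>

locale connected = single_type +
  fixes nx :: "int \<Rightarrow> int"
  assumes nx_reached: "(x, j) \<in> reached (int nodes) \<Longrightarrow> nx (x * int D + j) \<noteq> 0"
begin

definition allowed :: "int \<Rightarrow> int \<Rightarrow> bool" where
  "allowed i v \<longleftrightarrow> v = i \<or> nx (v * int D + i) \<noteq> 0"

definition loss :: "int \<Rightarrow> int \<Rightarrow> int" where
  "loss i v = (if v = i then int (reward I (nat i)) else 0)"

definition room :: "int \<Rightarrow> int" where
  "room v = (if v < int D then 1
     else int (capacity ((nat v - D) div L) ((nat v - D) mod L)))"

sublocale assignment "int D" "int nodes" allowed loss room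
  by unfold_locales (auto simp: allowed_def loss_def room_def nodes_ge)

lemma room_start: "s < L \<Longrightarrow> room (int (start r s)) = int (capacity r s)"
  by (simp add: room_def start_ge start_div_mod)

lemma path_nx:
  assumes "is_path I r s p" "r < T" "s < L" "d \<in> set p"
  shows "nx (int (start r s) * int D + int d) \<noteq> 0"
    and "e \<in> set p \<Longrightarrow> start_time I e < start_time I d \<Longrightarrow> nx (int e * int D + int d) \<noteq> 0"
proof -
  let ?q = "map int (start r s # p)"
  have p: "set p \<subseteq> {..<D}" "length p \<le> D"
    using assms path_distinct_times[OF assms(1)] by (auto simp: is_path_def)
  have q: "successively arc ?q" "set (tl ?q) \<subseteq> {0..<int D}"
    using arc_path[OF assms(1-3)] p by auto
  have nx: "nx (?q ! a * int D + ?q ! b) \<noteq> 0" if "a < b" "b < length ?q" for a b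
  proof (rule nx_reached)
    have "reach (b - a) (?q ! a) (?q ! b)"
      using that by (intro reach_along q) auto
    \<comment> \<open>A path visits a demand at most once, so at most \<open>D\<close> steps
      separate two positions and the rounds of the closure suffice.\<close>
    then have "reach nodes (?q ! a) (?q ! b)"
      by (rule reach_mono[rotated]) (use that p nodes_ge in auto)
    moreover have "?q ! b \<in> {0..<int D}"
    proof (cases b)
      case (Suc b')
      then have "p ! b' \<in> set p" using that by auto
      then have "p ! b' < D" using p by auto
      then show ?thesis using Suc that by simp
    qed (use that in simp)
    moreover have "?q ! a \<in> {0..<int nodes}"
    proof (cases a)
      case 0
      then show ?thesis using start_less[OF assms(2,3)] by simp
    next
      case (Suc a')
      then have "p ! a' \<in> set p" using that by auto
      then have "p ! a' < nodes" using p nodes_ge by fastforce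
      then show ?thesis using Suc that by simp
    qed
    ultimately show "(?q ! a, ?q ! b) \<in> reached (int nodes)"
      by (simp add: reached_def)
  qed
  obtain b where b: "b < length p" "p ! b = d"
    using assms(4) by (auto simp: in_set_conv_nth)
  show "nx (int (start r s) * int D + int d) \<noteq> 0"
    using nx[of 0 "Suc b"] b by simp
  show "nx (int e * int D + int d) \<noteq> 0" if e: "e \<in> set p" "start_time I e < start_time I d"
  proof -
    obtain a where a: "a < length p" "p ! a = e"
      using e by (auto simp: in_set_conv_nth)
    have "a < b"
    proof (rule ccontr)
      assume "\<not> a < b"
      then have "b = a \<or> start_time I (p ! b) < start_time I (p ! a)"
        using sorted_wrt_nth_less[OF path_distinct_times(1)[OF assms(1)], of b a] a by (cases "b = a") auto
      then show False using a b e by auto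
    qed
    then show ?thesis
      using nx[of "Suc a" "Suc b"] a b by simp
  qed
qed

text \<open>Every met demand is credited to one resource \<open>x d\<close> that visits it. Its
  predecessor is the latest earlier demand credited to the same resource or, if there is none, the
  starting location of that resource; unmet demands take their own column. Demands credited to one
  resource lie on one path and are thus ordered by start time, which yields reachability as well as
  the capacity bounds.\<close>

lemma feasible_matching:
  assumes "feasible I \<sigma>"
  obtains g where "matching (int D) g" "cost g = int (\<Sum>d | d < D \<and> \<not> met I \<sigma> d. reward I d)"
proof -
  define M where "M = {d. d < D \<and> met I \<sigma> d}"
  have "\<forall>d\<in>M. \<exists>x. x \<in> resources I \<and> fst x = rt d \<and> d \<in> set (\<sigma> x)"
  proof
    fix d assume "d \<in> M"
    then have "d < D" "met I \<sigma> d" by (auto simp: M_def)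
    then obtain s k where "(rt d, s, k) \<in> resources I" "d \<in> set (\<sigma> (rt d, s, k))"
      using required[of d] by (auto simp: met_def)
    then show "\<exists>x. x \<in> resources I \<and> fst x = rt d \<and> d \<in> set (\<sigma> x)"
      by (intro exI[of _ "(rt d, s, k)"]) simp
  qed
  then obtain x where x: "\<And>d. d \<in> M \<Longrightarrow> x d \<in> resources I" "\<And>d. d \<in> M \<Longrightarrow> fst (x d) = rt d"
      "\<And>d. d \<in> M \<Longrightarrow> d \<in> set (\<sigma> (x d))"
    by metis
  define loc where "loc d = fst (snd (x d))" for d
  have res: "rt d < T" "loc d < L" "loc d \<in> starts I (rt d)" "snd (snd (x d)) < amount I (rt d) (loc d)"
    "is_path I (rt d) (loc d) (\<sigma> (x d))" if dM: "d \<in> M" for d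
  proof -
    obtain k where k: "x d = (rt d, loc d, k)"
      using x(2)[OF dM] by (metis loc_def prod.collapse)
    then show "rt d < T" "loc d \<in> starts I (rt d)" "snd (snd (x d)) < amount I (rt d) (loc d)"
      using x(1)[OF dM] by (auto simp: resources_def)
    then show "loc d < L" by (intro starts_less)
    show "is_path I (rt d) (loc d) (\<sigma> (x d))"
      using assms x(1)[OF dM] k by (auto simp: feasible_def)
  qed
  have same_time: "d = e" if "d \<in> M" "e \<in> M" "x d = x e" "start_time I d = start_time I e" for d e
  proof -
    have "inj_on (start_time I) (set (\<sigma> (x d)))"
      by (rule sorted_wrt_inj_on) (rule path_distinct_times(1)[OF res(5)[OF that(1)]])
    then show ?thesis
      using x(3)[OF that(1)] x(3)[OF that(2)] that by (auto simp: inj_on_def)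
  qed
  define prev where "prev d = {e \<in> M. x e = x d \<and> start_time I e < start_time I d}" for d
  have fin: "finite (prev d)" for d
    by (auto simp: prev_def M_def)
  have "\<exists>e\<in>prev d. \<forall>e'\<in>prev d. start_time I e' \<le> start_time I e" if "prev d \<noteq> {}" for d
  proof -
    have "Max (start_time I ` prev d) \<in> start_time I ` prev d"
      using that fin[of d] by (intro Max_in) auto
    then obtain e where "e \<in> prev d" "start_time I e = Max (start_time I ` prev d)"
      by auto
    then show ?thesis
      using fin[of d] by (intro bexI[of _ e]) auto
  qed
  then obtain q where q: "\<And>d. prev d \<noteq> {} \<Longrightarrow> q d \<in> prev d"
      "\<And>d e. e \<in> prev d \<Longrightarrow> start_time I e \<le> start_time I (q d)"
    by (metis empty_iff)
  define h where "h d = (if d \<in> M then if prev d = {} then start (rt d) (loc d) else q d else d)" for d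
  define g where "g i = int (h (nat i))" for i
  have MD: "d < D" if "d \<in> M" for d using that by (simp add: M_def)
  have qM: "q d \<in> M" "x (q d) = x d" "start_time I (q d) < start_time I d" if "prev d \<noteq> {}" for d
    using q(1)[OF that] by (auto simp: prev_def)
  have self: "h d = d \<longleftrightarrow> d \<notin> M" if "d < D" for d
    using that qM(3)[of d] start_ge[of "rt d" "loc d"] by (cases "prev d = {}") (auto simp: h_def)
  have "placed (int D) g"
    unfolding placed_def
  proof (intro ballI conjI)
    fix i assume i: "i \<in> {0..<int D}"
    define d where "d = nat i"
    have d: "i = int d" "d < D" using i by (auto simp: d_def)
    have "h d < nodes \<and> allowed (int d) (int (h d))"
    proof (cases "d \<in> M")
      case False
      then show ?thesis using d nodes_ge by (simp add: h_def allowed_def)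
    next
      case True
      note path = path_nx[OF res(5,1,2)[OF True] x(3)[OF True]]
      show ?thesis
      proof (cases "prev d = {}")
        case empty: True
        then show ?thesis
          using True start_less[OF res(1,2)[OF True]] path(1) by (simp add: h_def allowed_def)
      next
        case False
        then have "nx (int (q d) * int D + int d) \<noteq> 0"
          using qM[OF False] x(3)[of "q d"] by (intro path(2)) auto
        then show ?thesis
          using True False MD[OF qM(1)[OF False]] nodes_ge by (simp add: h_def allowed_def)
      qed
    qed
    then show "g i \<in> {0..<int nodes}" "allowed i (g i)"
      by (auto simp: g_def d)
  qed
  moreover have "load (int D) g v \<le> room v" if v: "v \<in> {0..<int nodes}" for v
  proof -
    define w where "w = nat v"
    have w: "v = int w" "w < nodes" using v
      by (auto simp: w_def nat_less_iff)
    define A where "A = {d. d < D \<and> h d = w}"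
    have "{0..<int D} \<inter> {i. g i = v} = int ` A"
    proof (intro equalityI subsetI)
      fix i assume "i \<in> {0..<int D} \<inter> {i. g i = v}"
      then have "i = int (nat i)" "nat i \<in> A"
        by (auto simp: A_def g_def w nat_less_iff)
      then show "i \<in> int ` A" by blast
    qed (auto simp: A_def g_def w)
    then have load: "load (int D) g v = int (card A)"
      by (simp add: load_def card_image)
    show ?thesis
    proof (cases "w < D")
      case True
      \<comment> \<open>If \<open>w\<close> is met, two demands with predecessor \<open>w\<close>
        share its resource; the earlier one would be a later predecessor of the other than
        \<open>w\<close> is. If \<open>w\<close> is not met, only \<open>w\<close> itself takes its
        column.\<close>
      have "d = e" if "d \<in> A" "e \<in> A" for d e
      proof (cases "w \<in> M")
        case False
        have "d = w" if "d < D" "h d = w" for d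
          using that True False qM(1)[of d] by (auto simp: h_def start_def split: if_splits)
        then show ?thesis using \<open>d \<in> A\<close> \<open>e \<in> A\<close> by (auto simp: A_def)
      next
        case wM: True
        have key: "d \<in> M \<and> prev d \<noteq> {} \<and> q d = w" if "d < D" "h d = w" for d
          using that True wM self[of d] by (auto simp: h_def start_def split: if_splits)
        have d: "d \<in> M" "prev d \<noteq> {}" "q d = w" and e: "e \<in> M" "prev e \<noteq> {}" "q e = w"
          using key that by (auto simp: A_def)
        have xs: "x d = x e" using qM(2)[OF d(2)] qM(2)[OF e(2)] d e by simp
        have "\<not> start_time I d < start_time I e"
        proof
          assume "start_time I d < start_time I e"
          then have "d \<in> prev e" using d xs by (simp add: prev_def)
          then have "start_time I d \<le> start_time I w" using q(2) e(3) by blast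
          then show False using qM(3)[OF d(2)] d(3) by simp
        qed
        moreover have "\<not> start_time I e < start_time I d"
        proof
          assume "start_time I e < start_time I d"
          then have "e \<in> prev d" using e xs by (simp add: prev_def)
          then have "start_time I e \<le> start_time I w" using q(2) d(3) by blast
          then show False using qM(3)[OF e(2)] e(3) by simp
        qed
        ultimately show ?thesis using same_time[OF d(1) e(1) xs] by simp
      qed
      then have "card A \<le> 1"
        by (metis card_le_Suc0_iff_eq card.infinite One_nat_def le_SucI zero_le)
      then show ?thesis using True unfolding load unfolding w(1) by (simp add: room_def)
    next
      case False
      define r s where "r = (w - D) div L" and "s = (w - D) mod L"
      have rs: "r < T" "s < L" "start r s = w"
        using start_node[of w, folded nodes_def] w False by (auto simp: r_def s_def start_def)
      have key: "d \<in> M \<and> prev d = {} \<and> rt d = r \<and> loc d = s" if "d \<in> A" for d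
      proof -
        have d: "d < D" "h d = w" using that by (auto simp: A_def)
        then have "d \<in> M" "prev d = {}"
          using False MD[OF qM(1)[of d]] by (auto simp: h_def split: if_splits)
        moreover from this have "start (rt d) (loc d) = start r s"
          using d rs by (simp add: h_def)
        ultimately show ?thesis
          using start_inject[OF res(2) rs(2)] by auto
      qed
      \<comment> \<open>Demands placed at one starting location are the first ones of their
        resources. Type and location being fixed, the index determines the resource, and a resource
        has only one first demand.\<close>
      have "inj_on (\<lambda>d. snd (snd (x d))) A"
      proof (rule inj_onI)
        fix d e assume de: "d \<in> A" "e \<in> A" "snd (snd (x d)) = snd (snd (x e))"
        have M: "d \<in> M" "e \<in> M" "prev d = {}" "prev e = {}"
          using key de by auto
        have "fst (x d) = fst (x e)" "fst (snd (x d)) = fst (snd (x e))"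
          using key[OF de(1)] key[OF de(2)] x(2) by (auto simp: loc_def)
        then have xs: "x d = x e" using de(3) by (simp add: prod_eq_iff)
        have "\<not> start_time I d < start_time I e" "\<not> start_time I e < start_time I d"
          using M xs by (auto simp: prev_def)
        then show "d = e" using same_time[OF M(1,2) xs] by simp
      qed
      moreover have "(\<lambda>d. snd (snd (x d))) ` A \<subseteq> {..<capacity r s}"
        using key res(3,4) by (fastforce simp: capacity_def)
      ultimately have "card A \<le> capacity r s"
        using card_inj_on_le[of _ A "{..<capacity r s}"] by simp
      then show ?thesis
        using rs(3) room_start[OF rs(2), of r] unfolding load unfolding w(1) by simp
    qed
  qed
  ultimately have "matching (int D) g"
    unfolding matching_def by blast
  moreover have "cost g = int (\<Sum>d | d < D \<and> \<not> met I \<sigma> d. reward I d)"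
  proof -
    have "cost g = (\<Sum>d\<in>{..<D}. loss (int d) (g (int d)))"
      unfolding cost_def
      by (rule sum.reindex_bij_witness[of _ int nat]) auto
    also have "\<dots> = (\<Sum>d\<in>{..<D}. if d \<notin> M then int (reward I d) else 0)"
      by (rule sum.cong) (auto simp: loss_def g_def self)
    also have "\<dots> = (\<Sum>d | d < D \<and> \<not> met I \<sigma> d. int (reward I d))"
      by (simp add: sum.inter_filter[symmetric] M_def)
    finally show ?thesis by simp
  qed
  ultimately show thesis by (rule that)
qed

end

section \<open>From an optimal assignment back to an optimal solution\<close>

locale scheduled = connected +
  fixes f ty lo :: "int \<Rightarrow> int"
  assumes plan: "plan (int D) (int nodes) allowed loss room arc time f nx"
    and optimum: "matching (int D) g \<Longrightarrow> cost f \<le> cost g"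
    and labels: "r < T \<Longrightarrow> s < L \<Longrightarrow> ty (int (start r s)) = int r \<and> lo (int (start r s)) = int s"
begin

sublocale plan "int D" "int nodes" allowed loss room arc time f nx ty lo
  by (rule plan)

definition resource_of :: "int \<times> int \<times> int list \<Rightarrow> resource" where
  "resource_of = (\<lambda>(v, k, p). ((nat v - D) div L, (nat v - D) mod L, nat k))"

definition entry_of :: "int \<times> int \<times> int list \<Rightarrow> resource \<times> nat list" where
  "entry_of e = (resource_of e, map nat (snd (snd e)))"

text \<open>A step between demands forces their single types to coincide, so the type of the first
  demand spreads along the chain.\<close>

lemma edge_chain:
  assumes "successively edge q" "set q \<subseteq> {..<D}" "q \<noteq> []" "rt (hd q) = r"
  shows "successively (can_serve_after I r) q \<and> (\<forall>d\<in>set q. rt d = r)"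
  using assms
proof (induction q rule: induct_list012)
  case (3 x y ys)
  have "edge x y" and xy: "x < D" "y < D"
    using "3.prems" by auto
  then have after: "can_serve_after I (rt y) x y"
    by (simp add: edge_def)
  then have r: "rt x = rt y" "rt y = r"
    using edge_after(3)[OF after xy] "3.prems"(4) by simp_all
  have "successively (can_serve_after I r) (y # ys) \<and> (\<forall>d\<in>set (y # ys). rt d = r)"
    using "3.prems" r by (intro "3.IH"(2)) auto
  with after r show ?case by simp
qed auto

text \<open>The number of the starting node determines type and location, the bound of its load by
  its capacity makes the index that of an existing resource, and the first edge fixes the type for
  the whole route.\<close>

lemma entry_path:
  assumes es: "listing (int D) es" and e: "(v, k, p) \<in> set es" and rs: "resource_of (v, k, p) = (r, s, k')"
  shows "start r s = nat v" "r < T" "s < L" "(r, s, k') \<in> resources I" "int k' = k"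
    "is_path I r s (map nat p)" "\<forall>d\<in>set p. rt (nat d) = r" "map int (map nat p) = p"
    "ent (v, k, p) = encode_entry (entry_of (v, k, p))"
proof -
  have v: "v \<in> {int D..<int nodes}" "k \<in> {0..<load (int D) f v}" "route v p"
    using es e by (auto simp: listing_def)
  have "D \<le> nat v" "nat v < nodes"
    using v(1) by (auto simp: nat_less_iff nat_le_iff)
  then show st: "start r s = nat v" and r: "r < T" and s: "s < L"
    using rs start_node[of "nat v", folded nodes_def] by (auto simp: resource_of_def start_def)
  have vs: "v = int (start r s)" using v(1) st by simp
  show k: "int k' = k" using rs v(2) by (auto simp: resource_of_def)
  have "load (int D) f v \<le> int (capacity r s)"
    using f_matching v(1) unfolding room_start[OF s, of r, symmetric] vs[symmetric] matching_def
    by (meson atLeastLessThan_iff of_nat_0_le_iff order_trans)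
  then have "k' < capacity r s" using v(2) k by simp
  then show "(r, s, k') \<in> resources I"
    using r by (auto simp: resources_def capacity_def split: if_splits)
  have p: "set p \<subseteq> {0..<int D}" "successively arc (v # p)"
    using v(3) by (auto simp: route_def)
  then show pint: "map int (map nat p) = p"
    unfolding map_map by (intro map_idI) auto
  have pD: "set (map nat p) \<subseteq> {..<D}"
    using p(1) by (auto simp: nat_less_iff)
  have "successively arc p"
    using p(2) by (cases p) auto
  then have chain: "successively edge (map nat p)"
    by (simp add: successively_map arc_def[abs_def])
  have "is_path I r s (map nat p) \<and> (\<forall>d\<in>set (map nat p). rt d = r)"
  proof (cases "p = []")
    case True
    then show ?thesis by (simp add: is_path_def)
  next
    case False
    have "arc v (hd p)" using p(2) False by (cases p) auto
    then have first: "can_serve_first I r s (hd (map nat p))"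
      using False by (simp add: arc_def edge_def vs start_ge start_div_mod[OF s] hd_map)
    moreover have "hd (map nat p) < D"
      using pD False by (metis hd_in_set lessThan_iff map_is_Nil_conv subsetD)
    ultimately have "rt (hd (map nat p)) = r"
      using required by (auto simp: can_serve_first_def)
    from edge_chain[OF chain pD _ this] False first pD show ?thesis
      by (simp add: is_path_def)
  qed
  then show "is_path I r s (map nat p)" "\<forall>d\<in>set p. rt (nat d) = r" by auto
  show "ent (v, k, p) = encode_entry (entry_of (v, k, p))"
    using labels[OF r s] k pint rs unfolding vs
    by (simp add: ent_def encode_entry_def entry_of_def)
qed

lemma resource_of_inject:
  assumes "listing (int D) es" "(v, k, p) \<in> set es" "(v', k', p') \<in> set es"
    "resource_of (v, k, p) = resource_of (v', k', p')"
  shows "v = v' \<and> k = k'"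
proof -
  obtain r s j where rs: "resource_of (v, k, p) = (r, s, j)" by (metis prod.exhaust)
  note a = entry_path[OF assms(1,2) rs] and b = entry_path[OF assms(1,3) rs[unfolded assms(4)]]
  have "v \<in> {int D..<int nodes}" "v' \<in> {int D..<int nodes}"
    using assms by (auto simp: listing_def)
  then show ?thesis
    using a(1,5) b(1,5) by (simp add: nat_eq_iff)
qed

text \<open>Reward gained and reward missed have a constant sum, so it suffices to minimise what is
  missed. The emitted solution misses at most \<open>cost f\<close>, and any feasible solution
  misses the cost of some matching, which is at least \<open>cost f\<close>.\<close>

lemma listing_optimal:
  assumes es: "listing (int D) es"
  shows "outputs_optimal_solution I (concat (map ent es))"
proof -
  define es' where "es' = map entry_of es"
  define \<sigma> where "\<sigma> x = (case map_of es' x of Some ds \<Rightarrow> ds | None \<Rightarrow> [])" for x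
  have "distinct (map (\<lambda>(v, k, p). (v, k)) es)"
    using es by (simp add: listing_def)
  then have d: "distinct es" "inj_on (\<lambda>(v, k, p). (v, k)) (set es)"
    by (simp_all add: distinct_map)
  have "inj_on resource_of (set es)"
  proof (rule inj_onI)
    fix e e' assume e: "e \<in> set es" "e' \<in> set es" "resource_of e = resource_of e'"
    obtain v k p v' k' p' where "e = (v, k, p)" "e' = (v', k', p')"
      by (metis prod.exhaust)
    with e resource_of_inject[OF es, of v k p v' k' p'] d(2) show "e = e'"
      by (auto simp: inj_on_def)
  qed
  then have dist: "distinct (map fst es')"
    using d(1) by (simp add: es'_def entry_of_def comp_def distinct_map)
  have entry: "(x, map nat p) \<in> set es' \<and> \<sigma> x = map nat p" if "(v, k, p) \<in> set es" "x = resource_of (v, k, p)" for v k p x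
  proof -
    have "(x, map nat p) \<in> set es'"
      using that unfolding es'_def by (force simp: entry_of_def)
    then show ?thesis
      using map_of_is_SomeI[OF dist] by (simp add: \<sigma>_def)
  qed
  have "ent e = encode_entry (entry_of e)" if "e \<in> set es" for e
    using that entry_path(9)[OF es, of "fst e" "fst (snd e)" "snd (snd e)"] by (metis prod.collapse)
  then have "concat (map ent es) = concat (map encode_entry es')"
    by (simp add: es'_def comp_def cong: map_cong)
  moreover have "fst ` set es' \<subseteq> resources I"
  proof
    fix x assume "x \<in> fst ` set es'"
    then obtain v k p where e: "(v, k, p) \<in> set es" "x = resource_of (v, k, p)"
      by (auto simp: es'_def entry_of_def)
    obtain r s j where "x = (r, s, j)" by (metis prod.exhaust)
    with entry_path(4)[OF es e(1)] e(2) show "x \<in> resources I" by metis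
  qed
  ultimately have enc: "encodes_assignment I (concat (map ent es)) \<sigma>"
    using dist unfolding encodes_assignment_def by (intro exI[of _ es']) (auto simp: \<sigma>_def)
  have feas: "feasible I \<sigma>"
    unfolding feasible_def
  proof clarify
    fix r s j assume "(r, s, j) \<in> resources I"
    show "is_path I r s (\<sigma> (r, s, j))"
    proof (cases "map_of es' (r, s, j)")
      case None
      then show ?thesis by (simp add: \<sigma>_def is_path_def)
    next
      case (Some ds)
      then have "((r, s, j), ds) \<in> set es'" by (rule map_of_SomeD)
      then obtain v k p where "(v, k, p) \<in> set es" "resource_of (v, k, p) = (r, s, j)" "ds = map nat p"
        by (auto simp: es'_def entry_of_def)
      with entry_path(6)[OF es] Some show ?thesis
        by (simp add: \<sigma>_def)
    qed
  qed
  have met: "met I \<sigma> d" if d: "d < D" "f (int d) \<noteq> int d" for d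
  proof -
    obtain v k p where e: "(v, k, p) \<in> set es" "int d \<in> set p"
      using listing_covers[OF es, of "int d"] d by auto
    obtain r s j where rs: "resource_of (v, k, p) = (r, s, j)" by (metis prod.exhaust)
    note ep = entry_path[OF es e(1) rs]
    have "rt d = r" using ep(7) e(2) by force
    moreover have "d \<in> set (\<sigma> (r, s, j))"
      using entry[OF e(1) rs[symmetric]] e(2) by force
    ultimately show ?thesis
      using ep(4) required[OF d(1)] by (auto simp: met_def)
  qed
  define missed where "missed \<sigma> = (\<Sum>d | d < D \<and> \<not> met I \<sigma> d. reward I d)" for \<sigma>
  have split: "total_reward I \<sigma> + missed \<sigma> = (\<Sum>d | d < D. reward I d)" for \<sigma>
    unfolding total_reward_def missed_def
    by (subst sum.union_disjoint[symmetric]) (auto intro!: sum.cong)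
  \<comment> \<open>Not an equality: a demand that was given up may be met in passing when a step of
    the closure is expanded.\<close>
  have "int (missed \<sigma>) \<le> cost f"
  proof -
    have "cost f = (\<Sum>d\<in>{..<D}. loss (int d) (f (int d)))"
      unfolding cost_def by (rule sum.reindex_bij_witness[of _ int nat]) auto
    moreover have "int (missed \<sigma>) = (\<Sum>d\<in>{..<D}. if \<not> met I \<sigma> d then int (reward I d) else 0)"
      by (simp add: missed_def sum.inter_filter[symmetric])
    moreover have "(if \<not> met I \<sigma> d then int (reward I d) else 0) \<le> loss (int d) (f (int d))" if "d \<in> {..<D}" for d
      using met[of d] that by (auto simp: loss_def)
    ultimately show ?thesis
      by (simp only:) (rule sum_mono)
  qed
  moreover have "cost f \<le> int (missed \<sigma>')" if "feasible I \<sigma>'" for \<sigma>'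
    using feasible_matching[OF that] optimum unfolding missed_def by metis
  ultimately have "missed \<sigma> \<le> missed \<sigma>'" if "feasible I \<sigma>'" for \<sigma>'
    using that by (meson of_nat_le_iff order_trans)
  then have "total_reward I \<sigma>' \<le> total_reward I \<sigma>" if "feasible I \<sigma>'" for \<sigma>'
    using split[of \<sigma>] split[of \<sigma>'] that by fastforce
  with feas enc show ?thesis
    unfolding outputs_optimal_solution_def optimal_def by blast
qed

text \<open>At most \<open>D\<close> entries, each of four leading cells and a route without
  repetitions.\<close>

lemma listing_length:
  assumes "listing (int D) es"
  shows "length (concat (map ent es)) \<le> D * (D + 4)"
proof -
  have "length (ent e) \<le> D + 4" if "e \<in> set es" for e
  proof -
    obtain v k p where e: "e = (v, k, p)" by (metis prod.exhaust)
    then have "route v p" using assms that by (auto simp: listing_def)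
    then show ?thesis using route_distinct(2)[of v p] by (simp add: e ent_def)
  qed
  then have "length (concat (map ent es)) \<le> length es * (D + 4)"
    by (induction es) (auto simp: add_mono)
  also have "\<dots> \<le> D * (D + 4)"
    using assms by (intro mult_le_mono1) (simp add: listing_def)
  finally show ?thesis .
qed

end

section \<open>The algorithm\<close>

definition main :: prog where
  "main =
    ''D'' ::= Read ''input'' (Const 0) ;; ''T'' ::= Read ''input'' (Const 1) ;;
    ''L'' ::= Read ''input'' (Const 2) ;;
    Branch (Less (Const 0) (Var ''D'')) (prepare ;; closure ;; price ;; solve ;; links ;; emit) Nop"

lemmas main_defs = main_def prepare_defs closure_defs solve_defs emit_defs

lemma well_formed_main: "well_formed main"
  by (simp add: main_defs)

lemma oneR1D_subset: "oneR1D \<subseteq> mR1D"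
proof
  fix I assume "I \<in> oneR1D"
  then have I: "I \<in> mRmD" "num_types I = 1"
    by (auto simp: oneR1D_def)
  have "required I d = {0}" if "d < num_demands I" for d
    using I that by (fastforce simp: mRmD_def)
  with I show "I \<in> mR1D"
    by (simp add: mR1D_def)
qed

text \<open>Without demands the loops need not reach their bounds, hence the guard in
  \<open>main\<close>. No reward can be gained, so empty paths are optimal.\<close>

lemma main_no_demands:
  assumes "num_demands I = 0"
  shows "output_of (den main (input_memory (encode_instance I))) = []"
    and "outputs_optimal_solution I []"
proof -
  have "input_memory (encode_instance I) ''input'' 0 = 0"
    using assms by (simp add: input_memory_def encode_instance_def)
  then show "output_of (den main (input_memory (encode_instance I))) = []"
    by (simp add: main_def output_of_def input_memory_def)
  have "encodes_assignment I [] (\<lambda>_. [])"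
    unfolding encodes_assignment_def by (intro exI[of _ "[]"]) simp
  moreover have "optimal I (\<lambda>_. [])"
    using assms by (auto simp: optimal_def feasible_def is_path_def total_reward_def)
  ultimately show "outputs_optimal_solution I []"
    unfolding outputs_optimal_solution_def by blast
qed

context single_type
begin

text \<open>The six stages communicate through arrays only. Frame facts carry each array from the
  stage that writes it to those that read it, and show that arrays not yet written are still
  zero.\<close>

lemma main_run:
  defines "m \<equiv> den main (input_memory enc)"
  shows "outputs_optimal_solution I (output_of m)" "length (output_of m) \<le> D * (D + 4)"
proof -
  let ?mi = "input_memory enc"
  define mr where "mr = den (''D'' ::= Read ''input'' (Const 0) ;; ''T'' ::= Read ''input'' (Const 1) ;;
    ''L'' ::= Read ''input'' (Const 2)) ?mi"
  define mp where "mp = den prepare mr"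
  define mc where "mc = den closure mp"
  define mq where "mq = den price mc"
  define ms where "ms = den solve mq"
  define ml where "ml = den links ms"
  have enc0: "enc ! 0 = int D" "enc ! 1 = int T" "enc ! 2 = int L"
    by (simp_all add: enc_parts)
  have N3: "3 \<le> N" by (simp add: length_enc)
  then have inp: "?mi ''input'' 0 = int D" "?mi ''input'' 1 = int T" "?mi ''input'' 2 = int L"
    using enc0 by (auto simp: input_memory_def)
  have mr: "mr a = ?mi a" if "a \<notin> {''D'', ''T'', ''L''}" for a
    using that by (simp add: mr_def)
  have mrD: "mr ''D'' 0 = int D" "mr ''T'' 0 = int T" "mr ''L'' 0 = int L"
    by (simp_all add: mr_def inp)
  have zero: "mr a i = 0" if "a \<notin> {''D'', ''T'', ''L'', ''input'', ''input_length''}" for a i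
    using that by (simp add: mr input_memory_def)
  have m: "m = den emit ml"
    using mrD(1) demands unfolding m_def main_def mp_def mc_def mq_def ms_def ml_def
    by (simp add: mr_def)
  have "given mr"
    using mrD by (simp add: given_def mr input_memory_def)
  note pre = prepare_spec[OF this zero zero zero, folded mp_def, simplified]
  have fp: "mp a = mr a" if "a \<notin> writes prepare" for a
    unfolding mp_def using that by (rule den_frame)
  have fc: "mc a = mp a" if "a \<notin> writes closure" for a
    unfolding mc_def using that by (rule den_frame)
  have fq: "mq a = mc a" if "a \<notin> writes price" for a
    unfolding mq_def using that by (rule den_frame)
  have fs: "ms a = mq a" if "a \<notin> writes solve" for a
    unfolding ms_def using that by (rule den_frame)
  have fl: "ml a = ms a" if "a \<notin> writes links" for a
    unfolding ml_def using that by (rule den_frame)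
  have oD: "mp ''oD'' v = v * int D" if "v \<in> {0..<int nodes}" for v
  proof -
    have "nat v \<le> N" using that bounds(1) by (simp add: nodes_def[symmetric] nat_le_iff)
    then have "mp ''oD'' (int (nat v)) = int (nat v * D)"
      using pre(1) unfolding indexed_def by blast
    then show ?thesis using that by simp
  qed
  have ep: "edges mp"
    unfolding edges_def
  proof (intro conjI ballI)
    show "mp ''D'' 0 = int D" "mp ''V'' 0 = int nodes" "int nodes \<le> mp ''input_length'' 0"
      using pre(1) bounds by (simp_all add: indexed_def given_def nodes_def[symmetric])
    fix v assume v: "v \<in> {0..<int nodes}"
    show "mp ''oD'' v = v * int D" using v by (rule oD)
    fix j assume j: "j \<in> {0..<int D}"
    have "nat v < nodes" "nat j < D"
      using v j by (simp_all add: nat_less_iff)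
    then have "mp ''e'' (int (nat v) * int D + int (nat j)) = 1 \<longleftrightarrow> edge (nat v) (nat j)"
      using pre(4)[folded nodes_def] by blast
    then show "mp ''e'' (v * int D + j) = 1 \<longleftrightarrow> arc v j"
      using v j by (simp add: arc_def)
  qed
  have hops: "hops_for (reached (int nodes)) mc"
    unfolding mc_def using ep by (rule closure_spec) (simp add: fp prepare_defs zero)
  have ec: "edges mc"
    using ep by (rule edges_cong) (rule fc; auto simp: closure_defs)
  define nx where "nx = mc ''nx''"
  interpret connected I nx
    by unfold_locales (use hops in \<open>auto simp: hops_for_def nx_def\<close>)
  have w: "mc ''w'' (int d) = int (reward I d)" if "d < D" for d
    using pre(2) that by (simp add: fc closure_defs demand_ready_def)
  have price: "(mq ''ok'' (v * int D + i) = 1 \<longleftrightarrow> allowed i v) \<and> mq ''co'' (v * int D + i) = loss i v"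
    if "v \<in> {0..<int nodes}" "i \<in> {0..<int D}" for v i
  proof -
    have "mc ''w'' i = int (reward I (nat i))"
      using w[of "nat i"] that by (auto simp: nat_less_iff)
    then show ?thesis
      using price_spec[OF ec that, folded mq_def nx_def] by (auto simp: allowed_def loss_def)
  qed
  have cap: "mp ''cap'' v = room v" if v: "v \<in> {0..<int nodes}" for v
  proof (cases "v < int D")
    case True
    then have "nat v < D" using v by (simp add: nat_less_iff)
    then have "mp ''cap'' (int (nat v)) = 1"
      using pre(2) unfolding demand_ready_def by blast
    then show ?thesis using True v by (simp add: room_def)
  next
    case False
    define r s where "r = (nat v - D) div L" and "s = (nat v - D) mod L"
    have rs: "r < T" "s < L" "start r s = nat v"
      using start_node[of "nat v"] v False
      by (auto simp: r_def s_def start_def nodes_def[symmetric] nat_less_iff)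
    then have "mp ''cap'' (int (nat v)) = int (capacity r s)"
      using pre(3) unfolding rs(3)[symmetric] by (simp add: start_ready_def Let_def start_def)
    then show ?thesis using False v by (simp add: room_def r_def s_def)
  qed
  have "data mq"
    unfolding data_def
  proof (intro conjI ballI)
    show "mq ''D'' 0 = int D" "mq ''V'' 0 = int nodes" "int nodes \<le> mq ''input_length'' 0"
      using ec by (simp_all add: fq closure_defs edges_def)
    fix v assume v: "v \<in> {0..<int nodes}"
    show "mq ''cap'' v = room v"
      using cap[OF v] by (simp add: fq fc closure_defs)
    have "mq ''oD'' v = v * int D"
      using oD[OF v] by (simp add: fq fc closure_defs)
    moreover fix i assume "i \<in> {0..<int D}"
    ultimately show "mq ''ok'' (mq ''oD'' v + i) = 1 \<longleftrightarrow> allowed i v" "mq ''co'' (mq ''oD'' v + i) = loss i v"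
      using price[OF v] by simp_all
  qed
  then have settled: "settled (int D) ms"
    unfolding ms_def by (rule solve_spec) (simp_all add: fq fc fp closure_defs prepare_defs zero)
  define f ty lo where "f = ms ''f''" and "ty = mp ''ty''" and "lo = mp ''lo''"
  have po: "partial_optimum (int D) f (ms ''u'') (ms ''y'')"
    using settled by (simp add: settled_def f_def)
  have h: "hops mc" using hops by (simp add: hops_for_def)
  have plan: "plan (int D) (int nodes) allowed loss room arc time f nx"
  proof unfold_locales
    show "matching (int D) f" using po by (simp add: partial_optimum_def)
    show "0 \<le> time x" for x by (simp add: time_def)
    show "\<exists>z\<in>{0..<int D}. nx (x * int D + j) = z + 1 \<and> arc x z \<and> (z = j \<or> nx (z * int D + j) \<noteq> 0)"
      if "x \<in> {0..<int nodes}" "j \<in> {0..<int D}" "nx (x * int D + j) \<noteq> 0" for x j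
      using h that unfolding hops_def nx_def by blast
    show "time x < time j" if "x \<in> {0..<int D}" "j \<in> {0..<int D}" "nx (x * int D + j) \<noteq> 0" for x j
      using hopsE[OF h, of x j] that nodes_ge unfolding nx_def by auto
    show "allowed i v \<longleftrightarrow> v = i \<or> nx (v * int D + i) \<noteq> 0" for i v
      by (simp add: allowed_def)
  qed
  have labels: "ty (int (start r s)) = int r \<and> lo (int (start r s)) = int s" if "r < T" "s < L" for r s
  proof -
    have "start_ready r s mp" using pre(3) that by blast
    then show ?thesis
      unfolding start_ready_def Let_def start_def[symmetric] by (simp add: ty_def lo_def)
  qed
  interpret scheduled I nx f ty lo
    by (intro scheduled.intro scheduled_axioms.intro connected_axioms plan labels
        partial_optimum_cost_le[OF po])
  have ps: "plan_data ms"
    unfolding plan_data_def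
  proof (intro conjI ballI)
    show "ms ''D'' 0 = int D" "ms ''V'' 0 = int nodes" "int nodes \<le> ms ''input_length'' 0"
      using ec by (simp_all add: fs fq closure_defs solve_defs edges_def)
    show "ms ''oD'' v = v * int D" if "v \<in> {0..<int nodes}" for v
      using oD[OF that] by (simp add: fs fq fc closure_defs solve_defs)
    show "ms ''f'' = f" "ms ''nx'' = nx" "ms ''ty'' = ty" "ms ''lo'' = lo"
      by (simp_all add: f_def nx_def ty_def lo_def fs fq fc closure_defs solve_defs)
  qed
  have "linked (ml ''su'')"
    unfolding ml_def using ps
    by (rule links_spec) (simp add: fs fq fc fp closure_defs prepare_defs solve_defs zero)
  moreover have "plan_data ml"
    using ps by (rule plan_data_cong) (rule fl; auto simp: emit_defs)
  moreover have "ml ''output_length'' 0 = 0" "\<And>v. ml ''cnt'' v = 0"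
    by (simp_all add: fl fs fq fc fp closure_defs prepare_defs solve_defs emit_defs zero)
  ultimately obtain es where "listing (int D) es" "output_of m = concat (map ent es)"
    using emit_spec[of ml] unfolding m by blast
  then show "outputs_optimal_solution I (output_of m)" "length (output_of m) \<le> D * (D + 4)"
    using listing_optimal listing_length by simp_all
qed

end

theorem theorem7:
  shows "solvable_in_polynomial_time oneR1D encode_instance outputs_optimal_solution \<and>
         solvable_in_polynomial_time mR1D encode_instance outputs_optimal_solution"
proof -
  \<comment> \<open>The polynomial \<open>[:0, 4, 1:]\<close> is the bound
    \<open>D * (D + 4)\<close> on the output length with \<open>D\<close> replaced by the input
    size.\<close>
  have "outputs_optimal_solution I (output_of (den main (input_memory (encode_instance I)))) \<and>
      length (output_of (den main (input_memory (encode_instance I))))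
        \<le> poly [:0, 4, 1:] (bits_size (encode_instance I))" if "I \<in> mR1D" for I
  proof (cases "num_demands I = 0")
    case True
    then show ?thesis by (simp add: main_no_demands)
  next
    case False
    then interpret single_type I
      by unfold_locales (use that in auto)
    have "D \<le> bits_size enc"
      using bounds(2) length_le_bits_size[of enc] by linarith
    then have "D * (D + 4) \<le> bits_size enc * (bits_size enc + 4)"
      by (intro mult_le_mono) auto
    then show ?thesis
      using main_run by (simp add: algebra_simps)
  qed
  then have "solvable_in_polynomial_time X encode_instance outputs_optimal_solution" if "X \<subseteq> mR1D" for X
    using that by (intro solvable_in_polynomial_timeI[OF well_formed_main, where q = "[:0, 4, 1:]"]) auto
  then show ?thesis
    using oneR1D_subset by blast
qed

end
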